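(* Let $H$ be a finite-dimensional Hopf algebra of dimension $2^np$ over an algebraically closed field $\Bbbk$ of characteristic zero, where $n\ge 0$ and $p$ is an odd prime. If $H$ has a semisimple Hopf subalgebra of dimension $2^n$, then $H$ is semisimple. *)

theory Defs
  imports "HOL-Computational_Algebra.Polynomial"
begin

definition alg_closed :: "'k::field itself \<Rightarrow> bool" where
  "alg_closed _ \<longleftrightarrow> (\<forall>q :: 'k poly. degree q > 0 \<longrightarrow> (\<exists>x. poly q x = 0))"

(* A finite-dimensional Hopf algebra given by structure constants w.r.t. a basis e_0,...,e_{d-1}:
   e_i e_j = \<Sum>_r mult i j r e_r;  1 = \<Sum>_r unit r e_r;
   \<Delta>(e_i) = \<Sum>_{a,b} comult i a b e_a \<otimes> e_b;  \<epsilon>(e_i) = counit i;  S(e_i) = \<Sum>_j anti i j e_j. *)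
record 'k hopf_data =
  hdim    :: nat
  hmult   :: "nat \<Rightarrow> nat \<Rightarrow> nat \<Rightarrow> 'k"
  hunit   :: "nat \<Rightarrow> 'k"
  hcomult :: "nat \<Rightarrow> nat \<Rightarrow> nat \<Rightarrow> 'k"
  hcounit :: "nat \<Rightarrow> 'k"
  hanti   :: "nat \<Rightarrow> nat \<Rightarrow> 'k"

definition is_hopf_algebra :: "'k::field hopf_data \<Rightarrow> bool" where
  "is_hopf_algebra H \<longleftrightarrow>
    (let d = hdim H; m = hmult H; u = hunit H; c = hcomult H; e = hcounit H; s = hanti H in
     \<comment> \<open>associativity\<close>
     (\<forall>i<d. \<forall>j<d. \<forall>k<d. \<forall>l<d.
        (\<Sum>r<d. m i j r * m r k l) = (\<Sum>r<d. m j k r * m i r l)) \<and>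
     \<comment> \<open>unit\<close>
     (\<forall>i<d. \<forall>l<d. (\<Sum>r<d. u r * m r i l) = (if i = l then 1 else 0)
                  \<and> (\<Sum>r<d. u r * m i r l) = (if i = l then 1 else 0)) \<and>
     \<comment> \<open>coassociativity\<close>
     (\<forall>i<d. \<forall>a<d. \<forall>b<d. \<forall>k<d.
        (\<Sum>r<d. c i r k * c r a b) = (\<Sum>r<d. c i a r * c r b k)) \<and>
     \<comment> \<open>counit\<close>
     (\<forall>i<d. \<forall>k<d. (\<Sum>r<d. e r * c i r k) = (if i = k then 1 else 0)
                  \<and> (\<Sum>r<d. e r * c i k r) = (if i = k then 1 else 0)) \<and>
     \<comment> \<open>comultiplication is an algebra map\<close>
     (\<forall>i<d. \<forall>j<d. \<forall>a<d. \<forall>b<d.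
        (\<Sum>r<d. m i j r * c r a b) =
        (\<Sum>a1<d. \<Sum>b1<d. \<Sum>a2<d. \<Sum>b2<d.
            c i a1 b1 * c j a2 b2 * m a1 a2 a * m b1 b2 b)) \<and>
     (\<forall>a<d. \<forall>b<d. (\<Sum>r<d. u r * c r a b) = u a * u b) \<and>
     \<comment> \<open>counit is an algebra map\<close>
     (\<forall>i<d. \<forall>j<d. (\<Sum>r<d. m i j r * e r) = e i * e j) \<and>
     (\<Sum>r<d. u r * e r) = 1 \<and>
     \<comment> \<open>antipode\<close>
     (\<forall>i<d. \<forall>l<d.
        (\<Sum>a<d. \<Sum>b<d. c i a b * (\<Sum>r<d. s a r * m r b l)) = e i * u l \<and>
        (\<Sum>a<d. \<Sum>b<d. c i a b * (\<Sum>r<d. s b r * m a r l)) = e i * u l))"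

definition hvecs :: "'k::field hopf_data \<Rightarrow> (nat \<Rightarrow> 'k) set" where
  "hvecs H = {v. \<forall>i. hdim H \<le> i \<longrightarrow> v i = 0}"

definition hmul :: "'k::field hopf_data \<Rightarrow> (nat \<Rightarrow> 'k) \<Rightarrow> (nat \<Rightarrow> 'k) \<Rightarrow> (nat \<Rightarrow> 'k)" where
  "hmul H x y = (\<lambda>k. if k < hdim H then
      (\<Sum>i<hdim H. \<Sum>j<hdim H. x i * y j * hmult H i j k) else 0)"

definition hone :: "'k::field hopf_data \<Rightarrow> (nat \<Rightarrow> 'k)" where
  "hone H = (\<lambda>k. if k < hdim H then hunit H k else 0)"

(* \<Delta>(x) as a coefficient matrix w.r.t. the basis e_a \<otimes> e_b of H \<otimes> H *)
definition hDelta :: "'k::field hopf_data \<Rightarrow> (nat \<Rightarrow> 'k) \<Rightarrow> (nat \<Rightarrow> nat \<Rightarrow> 'k)" where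
  "hDelta H x = (\<lambda>a b. if a < hdim H \<and> b < hdim H then
      (\<Sum>i<hdim H. x i * hcomult H i a b) else 0)"

definition hS :: "'k::field hopf_data \<Rightarrow> (nat \<Rightarrow> 'k) \<Rightarrow> (nat \<Rightarrow> 'k)" where
  "hS H x = (\<lambda>j. if j < hdim H then (\<Sum>i<hdim H. x i * hanti H i j) else 0)"

definition is_subspace :: "'k::field hopf_data \<Rightarrow> (nat \<Rightarrow> 'k) set \<Rightarrow> bool" where
  "is_subspace H K \<longleftrightarrow> K \<subseteq> hvecs H \<and> (\<lambda>_. 0) \<in> K \<and>
     (\<forall>x\<in>K. \<forall>y\<in>K. (\<lambda>i. x i + y i) \<in> K) \<and> (\<forall>c. \<forall>x\<in>K. (\<lambda>i. c * x i) \<in> K)"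

definition tensor_sq :: "(nat \<Rightarrow> 'k::field) set \<Rightarrow> (nat \<Rightarrow> nat \<Rightarrow> 'k) set" where
  "tensor_sq K = {T. \<exists>(N::nat) xs ys. (\<forall>q<N. xs q \<in> K \<and> ys q \<in> K) \<and>
                        T = (\<lambda>a b. \<Sum>q<N. xs q a * ys q b)}"

definition is_hopf_subalgebra :: "'k::field hopf_data \<Rightarrow> (nat \<Rightarrow> 'k) set \<Rightarrow> bool" where
  "is_hopf_subalgebra H K \<longleftrightarrow> is_subspace H K \<and> hone H \<in> K \<and>
     (\<forall>x\<in>K. \<forall>y\<in>K. hmul H x y \<in> K) \<and>
     (\<forall>x\<in>K. hDelta H x \<in> tensor_sq K) \<and>
     (\<forall>x\<in>K. hS H x \<in> K)"

definition lin_indep :: "(nat \<Rightarrow> 'k::field) set \<Rightarrow> bool" where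
  "lin_indep B \<longleftrightarrow> (\<forall>c. (\<forall>j. (\<Sum>b\<in>B. c b * b j) = 0) \<longrightarrow> (\<forall>b\<in>B. c b = 0))"

definition lin_span :: "(nat \<Rightarrow> 'k::field) set \<Rightarrow> (nat \<Rightarrow> 'k) set" where
  "lin_span B = {v. \<exists>c. v = (\<lambda>j. \<Sum>b\<in>B. c b * b j)}"

definition has_dim :: "(nat \<Rightarrow> 'k::field) set \<Rightarrow> nat \<Rightarrow> bool" where
  "has_dim K m \<longleftrightarrow> (\<exists>B. finite B \<and> card B = m \<and> B \<subseteq> K \<and> lin_indep B \<and> K = lin_span B)"

definition is_ideal_in :: "'k::field hopf_data \<Rightarrow> (nat \<Rightarrow> 'k) set \<Rightarrow> (nat \<Rightarrow> 'k) set \<Rightarrow> bool" where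
  "is_ideal_in H K I \<longleftrightarrow> is_subspace H I \<and> I \<subseteq> K \<and>
     (\<forall>x\<in>K. \<forall>y\<in>I. hmul H x y \<in> I \<and> hmul H y x \<in> I)"

definition is_nilpotent_set :: "'k::field hopf_data \<Rightarrow> (nat \<Rightarrow> 'k) set \<Rightarrow> bool" where
  "is_nilpotent_set H I \<longleftrightarrow> (\<exists>N\<ge>1. \<forall>xs. length xs = N \<and> set xs \<subseteq> I \<longrightarrow>
        foldr (hmul H) (butlast xs) (last xs) = (\<lambda>_. 0))"

(* A finite-dimensional (sub)algebra is semisimple iff its radical (the largest nilpotent
   ideal) is zero, i.e. it has no nonzero nilpotent two-sided ideal. *)
definition semisimple_subalg :: "'k::field hopf_data \<Rightarrow> (nat \<Rightarrow> 'k) set \<Rightarrow> bool" where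
  "semisimple_subalg H K \<longleftrightarrow> (\<forall>I. is_ideal_in H K I \<and> is_nilpotent_set H I \<longrightarrow> I = {\<lambda>_. 0})"

definition semisimple_hopf :: "'k::field hopf_data \<Rightarrow> bool" where
  "semisimple_hopf H \<longleftrightarrow> semisimple_subalg H (hvecs H)"

end

theory Submission
  imports Defs "HOL-Library.Function_Algebras" "HOL-Computational_Algebra.Primes"
begin

text \<open>Write \<open>K\<close> for the semisimple Hopf subalgebra and \<open>e\<close> for its normalised integral. By the
  theorem of Nichols and Zoeller \<open>eH\<close> has dimension \<open>p\<close>. If \<open>H\<close> is not semisimple, then its integral
  \<open>\<Lambda>\<close> satisfies \<open>\<epsilon>(\<Lambda>) = 0\<close>, and Radford's trace formula
  \<open>tr (x \<mapsto> e S\<^sup>2(x)) = \<epsilon>(\<Lambda>) \<lambda>(e)\<close> shows that \<open>S\<^sup>2\<close> has trace 0 on \<open>eH\<close>.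

  If \<open>H\<close> has a group-like element of order \<open>p\<close>, then its powers project to a basis of \<open>eH\<close>; if the
  dual of \<open>H\<close> has one, then its powers restrict to a basis of the dual of \<open>eH\<close>. In both cases
  \<open>S\<^sup>2\<close> is the identity on \<open>eH\<close> and has trace \<open>p\<close>. Otherwise all group-like elements of \<open>H\<close> and of its
  dual have 2-power order, so Radford's formula for \<open>S\<^sup>4\<close> shows that \<open>S\<^sup>2\<close> has 2-power order. But a sum
  of an odd number of roots of unity of 2-power order is nonzero.\<close>

section \<open>Linear algebra in coordinates\<close>

text \<open>The space \<open>eH\<close> is never constructed. Subspaces are represented by
  idempotent operators, and since in characteristic zero the trace of an idempotent is its rank,
  dimension counts, bases and invertibility become statements about traces. The squared antipode
  acts on \<open>eH\<close> because the antipode fixes \<open>e\<close>.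

  Where oddness of \<open>p\<close> enters: a trace on \<open>eH\<close> of an operator of 2-power
  order is a sum of \<open>p\<close> roots of unity of 2-power order. Sending these roots to 1 is a
  well-defined map from the integer polynomials in them to the field with two elements, and it takes
  the trace to \<open>p\<close> mod 2. Oddness also keeps \<open>p\<close> from dividing dim K, so
  that group-like elements of order \<open>p\<close>, in \<open>H\<close> or in the dual, cannot
  come from \<open>K\<close> and stay independent on \<open>eH\<close>.

  Since the Hopf subalgebras that occur are semisimple, freeness can be replaced by an identity of
  characters. It is applied to \<open>K\<close>, and also to the span of a cyclic group of prime
  order: this gives the form of Lagrange's theorem that controls the orders of group-like
  elements.\<close>

text \<open>Vectors are functions on the natural numbers. \<open>flin d F\<close> and \<open>vlin d d' f\<close> say that a functional and
  a map to \<open>d'\<close>-dimensional space are linear and ignore all but the first \<open>d\<close> coordinates; in \<open>vlin\<close> the values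
  are constrained in the first \<open>d'\<close> coordinates only, so that the identity qualifies. \<open>lmap\<close> and \<open>lop\<close>
  additionally require values in \<open>vecs\<close>.\<close>

definition bs :: "nat \<Rightarrow> nat \<Rightarrow> 'k::zero_neq_one" where
  "bs i = (\<lambda>j. if j = i then 1 else 0)"

definition flin :: "nat \<Rightarrow> ((nat \<Rightarrow> 'k::field) \<Rightarrow> 'k) \<Rightarrow> bool" where
  "flin d F \<longleftrightarrow> (\<forall>v. F v = (\<Sum>i<d. v i * F (bs i)))"

definition vlin :: "nat \<Rightarrow> nat \<Rightarrow> ((nat \<Rightarrow> 'k::field) \<Rightarrow> nat \<Rightarrow> 'k) \<Rightarrow> bool" where
  "vlin d d' f \<longleftrightarrow> (\<forall>i<d'. flin d (\<lambda>v. f v i))"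

definition vecs :: "nat \<Rightarrow> (nat \<Rightarrow> 'k::zero) set" where
  "vecs d = {v. \<forall>i\<ge>d. v i = 0}"

definition tr :: "nat \<Rightarrow> ((nat \<Rightarrow> 'k::field) \<Rightarrow> nat \<Rightarrow> 'k) \<Rightarrow> 'k" where
  "tr d F = (\<Sum>i<d. F (bs i) i)"

definition subsp :: "nat \<Rightarrow> (nat \<Rightarrow> 'k::field) set \<Rightarrow> bool" where
  "subsp d J \<longleftrightarrow> J \<subseteq> vecs d \<and> (\<lambda>_. 0) \<in> J \<and>
     (\<forall>x\<in>J. \<forall>y\<in>J. (\<lambda>i. x i + y i) \<in> J) \<and> (\<forall>c. \<forall>x\<in>J. (\<lambda>i. c * x i) \<in> J)"

named_theorems lin

lemma sum_bs [simp]: "(\<Sum>j<d. bs i j * (f j :: 'k::field)) = (if i < d then f i else 0)"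
proof -
  have "(\<Sum>j<d. bs i j * f j) = (\<Sum>j<d. if j = i then f j else 0)"
    by (rule sum.cong) (auto simp: bs_def)
  then show ?thesis by simp
qed

lemma sum_bs' [simp]: "(\<Sum>j<d. (f j :: 'k::field) * bs i j) = (if i < d then f i else 0)"
  using sum_bs[where f=f and i=i and d=d] by (simp add: mult.commute)

lemma sum_bs2 [simp]: "(\<Sum>j<d. (f j :: 'k::field) * bs j i) = (if i < d then f i else 0)"
proof -
  have "(\<Sum>j<d. f j * bs j i) = (\<Sum>j<d. f j * bs i j)"
    by (rule sum.cong) (auto simp: bs_def)
  then show ?thesis by simp
qed

lemma bs_vecs [simp, intro]: "i < d \<Longrightarrow> bs i \<in> vecs d"
  by (auto simp: vecs_def bs_def)

lemma flinD: "flin d F \<Longrightarrow> F v = (\<Sum>i<d. v i * F (bs i))"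
  unfolding flin_def by blast

lemma vlinD: "vlin d d' f \<Longrightarrow> i < d' \<Longrightarrow> f v i = (\<Sum>j<d. v j * f (bs j) i)"
  unfolding vlin_def flin_def by blast

lemma flin_cong: "flin d F \<Longrightarrow> (\<And>i. i < d \<Longrightarrow> v i = w i) \<Longrightarrow> F v = F w"
  using flinD[of d F v] flinD[of d F w] by simp

lemma flin_sum_apply:
  assumes "flin d F" "\<And>i. i < d \<Longrightarrow> v i = (\<Sum>x\<in>X. c x * w x i)"
  shows "F v = (\<Sum>x\<in>X. c x * F (w x))"
proof -
  have "F v = (\<Sum>i<d. (\<Sum>x\<in>X. c x * w x i) * F (bs i))"
    using assms(2) by (subst flinD[OF assms(1)]) simp
  also have "\<dots> = (\<Sum>i<d. \<Sum>x\<in>X. c x * (w x i * F (bs i)))"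
    by (simp add: sum_distrib_right mult.assoc)
  also have "\<dots> = (\<Sum>x\<in>X. \<Sum>i<d. c x * (w x i * F (bs i)))"
    by (rule sum.swap)
  also have "\<dots> = (\<Sum>x\<in>X. c x * (\<Sum>i<d. w x i * F (bs i)))"
    by (simp add: sum_distrib_left)
  also have "\<dots> = (\<Sum>x\<in>X. c x * F (w x))"
    by (simp only: flinD[OF assms(1), symmetric])
  finally show ?thesis .
qed

lemma flin_add:
  assumes F: "flin d F" shows "F (\<lambda>i. v i + w i) = F v + F w"
  by (simp add: flinD[OF F, of v] flinD[OF F, of w] flinD[OF F, of "\<lambda>i. v i + w i"]
      distrib_right sum.distrib)

lemma flin_diff:
  assumes F: "flin d F" shows "F (\<lambda>i. v i - w i) = F v - F w"
  by (simp add: flinD[OF F, of v] flinD[OF F, of w] flinD[OF F, of "\<lambda>i. v i - w i"]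
      left_diff_distrib sum_subtractf)

lemma flin_scale:
  assumes F: "flin d F" shows "F (\<lambda>i. c * v i) = c * F v"
  by (simp add: flinD[OF F, of v] flinD[OF F, of "\<lambda>i. c * v i"] mult.assoc sum_distrib_left)

lemma flin_zero:
  assumes F: "flin d F" shows "F (\<lambda>i. 0) = 0"
  by (simp add: flinD[OF F, of "\<lambda>i. 0"])

lemma flin_comp: "flin d' F \<Longrightarrow> vlin d d' f \<Longrightarrow> flin d (\<lambda>v. F (f v))"
  unfolding flin_def[of d "\<lambda>v. F (f v)"]
  by (intro allI flin_sum_apply[of d' F]) (auto intro: vlinD)

lemma flin_coord [lin]: "i < d \<Longrightarrow> flin d (\<lambda>v. v i)"
  unfolding flin_def by simp

lemma vlin_coord: "vlin d d' f \<Longrightarrow> i < d' \<Longrightarrow> flin d (\<lambda>v. f v i)"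
  unfolding vlin_def by simp

lemma vlinI: "(\<And>i. i < d' \<Longrightarrow> flin d (\<lambda>v. f v i)) \<Longrightarrow> vlin d d' f"
  unfolding vlin_def by blast

lemma vlin_id [lin]: "d' \<le> d \<Longrightarrow> vlin d d' (\<lambda>v. v)"
  unfolding vlin_def by (auto intro: flin_coord)

lemma vlin_comp: "vlin d' d'' g \<Longrightarrow> vlin d d' f \<Longrightarrow> vlin d d'' (\<lambda>v. g (f v))"
  by (rule vlinI, rule flin_comp[where F="\<lambda>v. g v i" for i]) (auto simp: vlin_def)

lemma flin_mult_left [lin]:
  assumes F: "flin d F" shows "flin d (\<lambda>v. c * F v)"
  unfolding flin_def
proof
  fix v show "c * F v = (\<Sum>i<d. v i * (c * F (bs i)))"
    unfolding flinD[OF F, of v] sum_distrib_left by (simp add: mult.left_commute)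
qed

lemma flin_mult_right [lin]: "flin d F \<Longrightarrow> flin d (\<lambda>v. F v * c)"
  using flin_mult_left[of d F c] by (simp add: mult.commute)

lemma flin_sum [lin]:
  assumes F: "\<And>i. i \<in> I \<Longrightarrow> flin d (F i)" shows "flin d (\<lambda>v. \<Sum>i\<in>I. F i v)"
  unfolding flin_def
proof
  fix v
  have "(\<Sum>i\<in>I. F i v) = (\<Sum>i\<in>I. \<Sum>j<d. v j * F i (bs j))"
    by (rule sum.cong) (auto intro: flinD[OF F])
  also have "\<dots> = (\<Sum>j<d. v j * (\<Sum>i\<in>I. F i (bs j)))"
    unfolding sum_distrib_left by (rule sum.swap)
  finally show "(\<Sum>i\<in>I. F i v) = (\<Sum>j<d. v j * (\<Sum>i\<in>I. F i (bs j)))" .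
qed

lemma flin_plus [lin]:
  assumes "flin d F" "flin d G" shows "flin d (\<lambda>v. F v + G v)"
  unfolding flin_def
proof
  fix v show "F v + G v = (\<Sum>i<d. v i * (F (bs i) + G (bs i)))"
    unfolding flinD[OF assms(1), of v] flinD[OF assms(2), of v]
    by (simp add: distrib_left sum.distrib)
qed

lemma flin_minus [lin]:
  assumes "flin d F" "flin d G" shows "flin d (\<lambda>v. F v - G v)"
  unfolding flin_def
proof
  fix v show "F v - G v = (\<Sum>i<d. v i * (F (bs i) - G (bs i)))"
    unfolding flinD[OF assms(1), of v] flinD[OF assms(2), of v]
    by (simp add: right_diff_distrib sum_subtractf)
qed

lemma flin_const0 [lin]: "flin d (\<lambda>v. 0)"
  unfolding flin_def by simp

lemma tr_cong: "(\<And>i. i < d \<Longrightarrow> F (bs i) i = G (bs i) i) \<Longrightarrow> tr d F = tr d G"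
  unfolding tr_def by simp

lemma tr_cyclic:
  assumes "vlin d d' G" "vlin d' d F"
  shows "tr d (\<lambda>v. F (G v)) = tr d' (\<lambda>v. G (F v))"
proof -
  have "tr d (\<lambda>v. F (G v)) = (\<Sum>i<d. \<Sum>j<d'. G (bs i) j * F (bs j) i)"
    unfolding tr_def by (rule sum.cong) (auto intro: vlinD[OF assms(2)])
  also have "\<dots> = (\<Sum>j<d'. \<Sum>i<d. F (bs j) i * G (bs i) j)"
    by (subst sum.swap) (simp add: mult.commute)
  also have "\<dots> = tr d' (\<lambda>v. G (F v))"
    unfolding tr_def by (rule sum.cong) (auto intro: vlinD[OF assms(1), symmetric])
  finally show ?thesis .
qed

lemma tr_sum: "tr d (\<lambda>v i. \<Sum>x\<in>X. F x v i) = (\<Sum>x\<in>X. tr d (F x))"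
  unfolding tr_def by (rule sum.swap)

lemma tr_rank_one:
  assumes w: "flin d w" shows "tr d (\<lambda>v i. w v * b i) = w b"
  unfolding tr_def flinD[OF w, of b] by (simp add: mult.commute)

lemma tr_id: "tr d (\<lambda>v. v) = of_nat d"
  unfolding tr_def by (simp add: bs_def)

section \<open>Bases of subspaces with dual functionals\<close>

interpretation fvs: vector_space "\<lambda>(c::'k::field) (v::nat \<Rightarrow> 'k) i. c * v i"
  by unfold_locales (auto simp: fun_eq_iff algebra_simps)

lemma sum_fun: "(\<Sum>x\<in>X. f x) = (\<lambda>i. \<Sum>x\<in>X. (f x :: 'b \<Rightarrow> 'c::ab_group_add) i)"
  by (induction X rule: infinite_finite_induct) (auto simp: fun_eq_iff)

lemma subspD:
  assumes "subsp d J"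
  shows "x \<in> J \<Longrightarrow> x \<in> vecs d" "(\<lambda>_. 0) \<in> J"
    "x \<in> J \<Longrightarrow> y \<in> J \<Longrightarrow> (\<lambda>i. x i + y i) \<in> J" "x \<in> J \<Longrightarrow> (\<lambda>i. c * x i) \<in> J"
  using assms unfolding subsp_def by blast+

lemma subsp_sum:
  assumes J: "subsp d J" and "\<And>x. x \<in> X \<Longrightarrow> w x \<in> J"
  shows "(\<lambda>i. \<Sum>x\<in>X. c x * w x i) \<in> J"
  using assms(2)
proof (induction X rule: infinite_finite_induct)
  case (insert x F)
  have "(\<lambda>i. c x * w x i + (\<Sum>x\<in>F. c x * w x i)) \<in> J"
    by (intro subspD(3)[OF J] subspD(4)[OF J] insert) (use insert in auto)
  then show ?case using insert by simp
qed (use subspD(2)[OF J] in simp_all)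

lemma vecs_expand: "x \<in> vecs d \<Longrightarrow> x i = (\<Sum>j<d. x j * bs j i :: 'k::field)"
  by (simp add: vecs_def)

lemma vecs_expand_fun:
  assumes "x \<in> vecs d"
  shows "x = (\<Sum>i<d. (\<lambda>k. x i * (bs i k :: 'k::field)))"
proof (rule ext)
  fix k
  show "x k = (\<Sum>i<d. (\<lambda>k. x i * bs i k)) k"
    using vecs_expand[OF assms, of k] unfolding sum_fun .
qed

text \<open>A basis of \<open>J\<close> with dual functionals that are linear on the whole space.
  With such a frame an operator with values in \<open>J\<close> is a sum of rank-one operators, so
  its trace can be read off.\<close>

lemma frame_exists:
  fixes J :: "(nat \<Rightarrow> 'k::field) set"
  assumes J: "subsp d J"
  obtains r b \<kappa> where "r \<le> d" "\<And>i. i < r \<Longrightarrow> b i \<in> J"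
    "\<And>i. i < r \<Longrightarrow> flin d (\<kappa> i)"
    "\<And>i j. i < r \<Longrightarrow> j < r \<Longrightarrow> \<kappa> i (b j) = (if i = j then 1 else 0)"
    "\<And>x i. x \<in> J \<Longrightarrow> x i = (\<Sum>j<r. \<kappa> j x * b j i)"
proof -
  let ?sc = "\<lambda>(c::'k) (v::nat \<Rightarrow> 'k) i. c * v i"
  have spanall: "J \<subseteq> fvs.span (bs ` {..<d})"
  proof
    fix x assume "x \<in> J"
    then have "x = (\<Sum>i<d. ?sc (x i) (bs i))"
      by (intro vecs_expand_fun subspD(1)[OF J])
    also have "\<dots> \<in> fvs.span (bs ` {..<d})"
      by (intro fvs.span_sum fvs.span_scale fvs.span_base) auto
    finally show "x \<in> fvs.span (bs ` {..<d})" .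
  qed
  obtain B where B: "B \<subseteq> J" "fvs.independent B" "J \<subseteq> fvs.span B"
    using fvs.maximal_independent_subset[of J] by blast
  have fB: "finite B \<and> card B \<le> card (bs ` {..<d} :: (nat \<Rightarrow> 'k) set)"
    by (rule fvs.independent_span_bound) (use B spanall in auto)
  have "card B \<le> d" using fB card_image_le[of "{..<d}" "bs :: nat \<Rightarrow> nat \<Rightarrow> 'k"] by simp
  define r where "r = card B"
  obtain b where b: "bij_betw b {..<r} B"
    using fB ex_bij_betw_nat_finite[of B] unfolding r_def atLeast0LessThan by blast
  \<comment> \<open>Coordinates with respect to \<open>B\<close> exist only on its span; completing
    \<open>B\<close> to a basis of the space of all functions makes them total. The truncation
    inside \<open>\<kappa>\<close> then makes them ignore the coordinates from \<open>d\<close>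
    on.\<close>
  define f where "f = fvs.extend_basis B"
  have Bf: "B \<subseteq> f" "fvs.independent f" "fvs.span f = UNIV"
    unfolding f_def using fvs.extend_basis_superset[OF B(2)] fvs.independent_extend_basis[OF B(2)]
      fvs.span_extend_basis[OF B(2)] by auto
  define R where "R v = fvs.representation f v" for v
  define \<kappa> where "\<kappa> i v = R (\<lambda>k. if k < d then v k else 0) (b i)" for i v
  have Radd: "R (v + w) x = R v x + R w x" for v w x
    unfolding R_def using fvs.representation_add[OF Bf(2)] Bf(3) by simp
  have Rsc: "R (?sc c v) x = c * R v x" for c v x
    unfolding R_def using fvs.representation_scale[OF Bf(2)] Bf(3) by simp
  have Rsum: "R (\<Sum>i\<in>I. ?sc (c i) (v i)) x = (\<Sum>i\<in>I. c i * R (v i) x)" for I :: "nat set" and c v x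
    unfolding R_def using fvs.representation_sum[OF Bf(2), of I "\<lambda>i. ?sc (c i) (v i)"] 
       fvs.representation_scale[OF Bf(2)] Bf(3) by (simp add: fun_eq_iff)
  have flk: "flin d (\<kappa> i)" for i
    unfolding flin_def
  proof
    fix v :: "nat \<Rightarrow> 'k"
    have 1: "(\<lambda>k. if k < d then v k else 0) = (\<Sum>i<d. ?sc (v i) (bs i))"
      unfolding sum_fun by (rule ext) simp
    have 2: "j < d \<Longrightarrow> (\<lambda>k. if k < d then bs j k else 0) = (bs j :: nat \<Rightarrow> 'k)" for j
      by (auto simp: bs_def fun_eq_iff)
    show "\<kappa> i v = (\<Sum>j<d. v j * \<kappa> i (bs j))"
      unfolding \<kappa>_def 1 Rsum by (rule sum.cong) (auto simp: 2)
  qed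
  have trunc: "x \<in> J \<Longrightarrow> (\<lambda>k. if k < d then x k else 0) = x" for x
    using subspD(1)[OF J, of x] unfolding vecs_def by (auto simp: fun_eq_iff)
  have bJ: "i < r \<Longrightarrow> b i \<in> J" for i using b B(1) unfolding bij_betw_def by auto
  have dual: "\<kappa> i (b j) = (if i = j then 1 else 0)" if "i < r" "j < r" for i j
  proof -
    have "b j \<in> f" using b Bf(1) that unfolding bij_betw_def by auto
    then have "\<kappa> i (b j) = (if b i = b j then 1 else 0)"
      unfolding \<kappa>_def trunc[OF bJ[OF that(2)]] R_def
      by (subst fvs.representation_basis[OF Bf(2)]) auto
    then show ?thesis using b that unfolding bij_betw_def inj_on_def by auto
  qed
  have exp: "x i = (\<Sum>j<r. \<kappa> j x * b j i)" if "x \<in> J" for x i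
  proof -
    have "x \<in> fvs.span B" using B(3) that by auto
    then obtain c where "x = (\<Sum>a\<in>B. ?sc (c a) a)"
      using fB by (auto simp: fvs.span_finite)
    then have x: "x = (\<Sum>j<r. ?sc (c (b j)) (b j))"
      using sum.reindex_bij_betw[OF b, of "\<lambda>a. ?sc (c a) a"] by simp
    have "\<kappa> k x = c (b k)" if "k < r" for k
    proof -
      have "\<kappa> k x = (\<Sum>j<r. c (b j) * \<kappa> k (b j))"
        by (rule flin_sum_apply[OF flk]) (unfold x sum_fun, rule refl)
      also have "\<dots> = (\<Sum>j<r. if j = k then c (b j) else 0)"
        by (rule sum.cong) (use that dual in auto)
      finally show ?thesis using that by simp
    qed
    moreover have "x i = (\<Sum>j<r. c (b j) * b j i)" unfolding x sum_fun ..
    ultimately show ?thesis by simp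
  qed
  show ?thesis using that[OF _ bJ flk dual exp] \<open>card B \<le> d\<close> r_def by blast
qed

lemma vecs_eqI:
  assumes "x \<in> vecs d" "y \<in> vecs d" "\<And>i. i < d \<Longrightarrow> x i = y i"
  shows "x = y"
proof
  fix i show "x i = y i"
    using assms by (cases "i < d") (simp_all add: vecs_def)
qed

lemma vecs_lin: "x \<in> vecs d \<Longrightarrow> y \<in> vecs d \<Longrightarrow> (\<lambda>i. a * x i + b * y i :: 'k::field) \<in> vecs d"
  unfolding vecs_def by simp

lemma vecs_sum: "(\<And>j. j \<in> I \<Longrightarrow> w j \<in> vecs d) \<Longrightarrow> (\<lambda>i. \<Sum>j\<in>I. c j * w j i :: 'k::field) \<in> vecs d"
  unfolding vecs_def by simp

section \<open>Linear maps between coordinate spaces; trace and rank of idempotents\<close>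

definition lmap :: "nat \<Rightarrow> nat \<Rightarrow> ((nat \<Rightarrow> 'k::field) \<Rightarrow> nat \<Rightarrow> 'k) \<Rightarrow> bool" where
  "lmap d d' F \<longleftrightarrow> vlin d d' F \<and> range F \<subseteq> vecs d'"

abbreviation lop :: "nat \<Rightarrow> ((nat \<Rightarrow> 'k::field) \<Rightarrow> nat \<Rightarrow> 'k) \<Rightarrow> bool" where
  "lop d \<equiv> lmap d d"

lemma lmapI: "vlin d d' F \<Longrightarrow> (\<And>v. F v \<in> vecs d') \<Longrightarrow> lmap d d' F"
  unfolding lmap_def by blast

lemma lmapD: "lmap d d' F \<Longrightarrow> vlin d d' F" "lmap d d' F \<Longrightarrow> F v \<in> vecs d'"
  unfolding lmap_def by blast+

lemma lmap_flin:
  assumes F: "lmap d d' F" shows "flin d (\<lambda>v. F v i)"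
proof (cases "i < d'")
  case True
  with lmapD(1)[OF F] show ?thesis by (rule vlin_coord)
next
  case False
  then have "F v i = 0" for v using lmapD(2)[OF F, of v] unfolding vecs_def by simp
  then show ?thesis by (simp add: flin_const0)
qed

lemma lmap_vlin_comp: "lmap d d' F \<Longrightarrow> vlin d'' d f \<Longrightarrow> vlin d'' n (\<lambda>v. F (f v))"
  by (rule vlinI, rule flin_comp[where F="\<lambda>v. F v i" for i], rule lmap_flin)

lemma lmap_sum:
  assumes "lmap d d' F"
  shows "F (\<lambda>i. \<Sum>j\<in>I. c j * w j i) = (\<lambda>i. \<Sum>j\<in>I. c j * F (w j) i)"
  by (rule ext) (rule flin_sum_apply[OF lmap_flin[OF assms]], simp)

lemma lmap_add: "lmap d d' F \<Longrightarrow> F (\<lambda>i. x i + y i) = (\<lambda>i. F x i + F y i)"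
  by (rule ext, rule flin_add, rule lmap_flin)

lemma lmap_scale: "lmap d d' F \<Longrightarrow> F (\<lambda>i. c * x i) = (\<lambda>i. c * F x i)"
  by (rule ext, rule flin_scale, rule lmap_flin)

lemma lmap_lin:
  assumes "lmap d d' F"
  shows "F (\<lambda>i. a * x i + b * y i) = (\<lambda>i. a * F x i + b * F y i)"
  by (simp add: lmap_add[OF assms] lmap_scale[OF assms])

lemma lmap_zero: "lmap d d' F \<Longrightarrow> F (\<lambda>i. 0) = (\<lambda>i. 0)"
  by (rule ext, rule flin_zero, rule lmap_flin)

lemma subsp_lmap_range:
  assumes F: "lmap d d' F" shows "subsp d' (range F)"
  unfolding subsp_def
proof (intro conjI ballI allI)
  show "range F \<subseteq> vecs d'" using lmapD(2)[OF F] by blast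
  have "(\<lambda>_. 0) = F (\<lambda>_. 0)" by (rule lmap_zero[OF F, symmetric])
  then show "(\<lambda>_. 0) \<in> range F" by (rule range_eqI[where f=F and x="\<lambda>_. 0"])
  fix x y assume "x \<in> range F" "y \<in> range F"
  then obtain v w where "x = F v" "y = F w" by blast
  then have "(\<lambda>i. x i + y i) = F (\<lambda>i. v i + w i)" by (simp only: lmap_add[OF F])
  then show "(\<lambda>i. x i + y i) \<in> range F" by (rule range_eqI[where f=F])
next
  fix c x assume "x \<in> range F"
  then obtain v where "x = F v" by blast
  then have "(\<lambda>i. c * x i) = F (\<lambda>i. c * v i)" by (simp only: lmap_scale[OF F])
  then show "(\<lambda>i. c * x i) \<in> range F" by (rule range_eqI[where f=F])
qed

lemma lmap_comp: "lmap d' d'' F \<Longrightarrow> lmap d d' G \<Longrightarrow> lmap d d'' (\<lambda>v. F (G v))"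
  by (rule lmapI) (auto intro: vlin_comp dest: lmapD)

lemma lop_add: "lop d F \<Longrightarrow> lop d G \<Longrightarrow> lop d (\<lambda>v i. a * F v i + b * G v i)"
  by (rule lmapI, rule vlinI) (simp_all add: flin_plus flin_mult_left lmap_flin vecs_lin lmapD)

lemma lop_funpow: "lop d F \<Longrightarrow> 0 < n \<Longrightarrow> lop d (F ^^ n)"
proof (induction n)
  case (Suc n)
  show ?case
  proof (cases "n = 0")
    case True with Suc show ?thesis by simp
  next
    case False
    then show ?thesis using lmap_comp[OF Suc(2) Suc(1)[OF Suc(2)]] by (simp add: comp_def)
  qed
qed simp

lemma tr_lin: "tr d (\<lambda>v i. a * F v i + b * G v i) = a * tr d F + b * tr d G"
  unfolding tr_def by (simp add: sum.distrib sum_distrib_left)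

text \<open>On a frame of its range an idempotent is a sum of \<open>r\<close> rank-one operators of
  trace 1 each. Since the characteristic is zero, an idempotent of trace 0 vanishes, which replaces
  dimension counting in what follows.\<close>

lemma lop_idempotent_trace:
  fixes F :: "(nat \<Rightarrow> 'k::field_char_0) \<Rightarrow> nat \<Rightarrow> 'k"
  assumes F: "lop d F" and id: "\<And>v. F (F v) = F v"
  shows "\<exists>r\<le>d. tr d F = of_nat r \<and> (r = 0 \<longrightarrow> (\<forall>v. F v = (\<lambda>_. 0)))"
proof -
  obtain r b \<kappa> where fr: "r \<le> d" "\<And>i. i < r \<Longrightarrow> b i \<in> range F"
    "\<And>i. i < r \<Longrightarrow> flin d (\<kappa> i)"
    "\<And>i j. i < r \<Longrightarrow> j < r \<Longrightarrow> \<kappa> i (b j) = (if i = j then 1 else 0)"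
    "\<And>x i. x \<in> range F \<Longrightarrow> x i = (\<Sum>j<r. \<kappa> j x * b j i)"
    using frame_exists[OF subsp_lmap_range[OF F]] by blast
  have "tr d F = tr d (\<lambda>v i. \<Sum>j<r. \<kappa> j (F v) * b j i)"
    by (rule tr_cong) (rule fr(5), simp)
  also have "\<dots> = (\<Sum>j<r. \<kappa> j (F (b j)))"
    unfolding tr_sum by (rule sum.cong[OF refl], rule tr_rank_one)
      (auto intro: flin_comp[OF fr(3) lmapD(1)[OF F]])
  also have "\<dots> = (\<Sum>j<r. 1)"
  proof (rule sum.cong)
    fix j assume j: "j \<in> {..<r}"
    then have "F (b j) = b j" using fr(2)[of j] id by auto
    then show "\<kappa> j (F (b j)) = 1" using j fr(4) by simp
  qed simp
  finally have "tr d F = of_nat r" by simp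
  moreover have "F v = (\<lambda>_. 0)" if "r = 0" for v
    by (rule ext) (use fr(5)[of "F v"] that in simp)
  ultimately show ?thesis using fr(1) by blast
qed

lemma lop_idempotent_trace_zero:
  fixes F :: "(nat \<Rightarrow> 'k::field_char_0) \<Rightarrow> nat \<Rightarrow> 'k"
  assumes "lop d F" "\<And>v. F (F v) = F v" "tr d F = 0"
  shows "F v = (\<lambda>_. 0)"
  using lop_idempotent_trace[OF assms(1,2)] assms(3) by (metis of_nat_eq_0_iff)

section \<open>Sums of roots of unity of 2-power order\<close>

text \<open>A compatible system of primitive 2^a-th roots of unity, each a square root of the one
  before. The value -1 is prescribed at level 1, since an arbitrary square root of 1 might be 1
  again.\<close>

primrec zeta :: "nat \<Rightarrow> 'k::field" where
  "zeta 0 = 1"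
| "zeta (Suc a) = (if a = 0 then - 1 else (SOME y. y * y = zeta a))"

declare zeta.simps(2) [simp del]

text \<open>\<open>cycl a x m\<close>: \<open>x\<close> is the value at \<open>zeta a\<close> of an integer polynomial whose value at 1 is \<open>m\<close>.\<close>

primrec cycl :: "nat \<Rightarrow> 'k::field_char_0 \<Rightarrow> int \<Rightarrow> bool" where
  "cycl 0 x m \<longleftrightarrow> x = of_int m"
| "cycl (Suc a) x m \<longleftrightarrow> (\<exists>u v m1 m2. cycl a u m1 \<and> cycl a v m2 \<and> x = u + zeta (Suc a) * v \<and> m = m1 + m2)"

definition sqrt_closed :: "'k::field itself \<Rightarrow> bool" where
  "sqrt_closed _ \<longleftrightarrow> (\<forall>x::'k. \<exists>y. y * y = x)"

lemma alg_closed_sqrt: 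
  assumes "alg_closed TYPE('k::field)" shows "sqrt_closed TYPE('k)"
  unfolding sqrt_closed_def
proof
  fix x :: 'k
  have "degree [:- x, 0, 1:] > 0" by simp
  then obtain y where "poly [:- x, 0, 1:] y = 0" using assms unfolding alg_closed_def by blast
  then show "\<exists>y. y * y = x" by (auto simp: algebra_simps)
qed

lemma zeta_square:
  assumes "sqrt_closed TYPE('k::field)"
  shows "(zeta (Suc a) :: 'k) * zeta (Suc a) = zeta a"
proof (cases "a = 0")
  case False
  have "\<exists>y::'k. y * y = zeta a" using assms unfolding sqrt_closed_def by blast
  from someI_ex[OF this] show ?thesis using False by (simp add: zeta.simps(2))
qed (simp add: zeta.simps(2))

lemma zeta_power:
  assumes "sqrt_closed TYPE('k::field)"
  shows "(zeta (Suc a) :: 'k) ^ (2 ^ a) = - 1"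
proof (induction a)
  case (Suc a)
  have "(zeta (Suc (Suc a)) :: 'k) ^ (2 ^ Suc a) = (zeta (Suc (Suc a)) * zeta (Suc (Suc a))) ^ (2 ^ a)"
    by (simp only: power_mult power_Suc[of 2] power2_eq_square)
  then show ?case using Suc unfolding zeta_square[OF assms] by simp
qed (simp add: zeta.simps(2))

lemma cycl_add: "cycl a x m \<Longrightarrow> cycl a y n \<Longrightarrow> cycl a (x + y) (m + n)"
proof (induction a arbitrary: x y m n)
  case (Suc a)
  then obtain u v m1 m2 u' v' n1 n2 where *: "cycl a u m1" "cycl a v m2" "x = u + zeta (Suc a) * v" "m = m1 + m2"
    "cycl a u' n1" "cycl a v' n2" "y = u' + zeta (Suc a) * v'" "n = n1 + n2"
    unfolding cycl.simps by blast
  have "x + y = (u + u') + zeta (Suc a) * (v + v')" "m + n = (m1 + n1) + (m2 + n2)"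
    unfolding * by (auto simp: distrib_left)
  then show ?case unfolding cycl.simps using Suc(1)[OF *(1,5)] Suc(1)[OF *(2,6)] by blast
qed simp

lemma cycl_minus: "cycl a x m \<Longrightarrow> cycl a (- x) (- m)"
proof (induction a arbitrary: x m)
  case (Suc a)
  then obtain u v m1 m2 where *: "cycl a u m1" "cycl a v m2" "x = u + zeta (Suc a) * v" "m = m1 + m2"
    unfolding cycl.simps by blast
  have "- x = - u + zeta (Suc a) * (- v)" "- m = - m1 + - m2"
    unfolding * by auto
  then show ?case unfolding cycl.simps using Suc(1)[OF *(1)] Suc(1)[OF *(2)] by blast
qed simp

lemma cycl_of_int: "cycl a (of_int m) m"
proof (induction a arbitrary: m)
  case (Suc a)
  have "cycl a (0::'a) 0" using Suc[of 0] by simp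
  moreover have "(of_int m :: 'a) = of_int m + zeta (Suc a) * 0" "m = m + 0" by auto
  ultimately show ?case unfolding cycl.simps using Suc[of m] by blast
qed simp

lemma cycl_zeta: "cycl a (zeta a) 1"
proof (cases a)
  case (Suc b)
  have "cycl b (0::'a) 0" "cycl b (1::'a) 1" using cycl_of_int[of b 0] cycl_of_int[of b 1] by auto
  moreover have "(zeta a :: 'a) = 0 + zeta (Suc b) * 1" using Suc by simp
  moreover have "(1::int) = 0 + 1" by simp
  ultimately show ?thesis unfolding Suc cycl.simps by blast
qed simp

text \<open>The recursion multiplies out because the square of \<open>zeta (Suc a)\<close> is
  \<open>zeta a\<close>, and both sides of this relation take the value 1.\<close>

lemma cycl_mult:
  assumes "sqrt_closed TYPE('k::field_char_0)"
  shows "cycl a (x :: 'k) m \<Longrightarrow> cycl a y n \<Longrightarrow> cycl a (x * y) (m * n)"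
proof (induction a arbitrary: x y m n)
  case (Suc a)
  then obtain u v m1 m2 u' v' n1 n2 where *: "cycl a u m1" "cycl a v m2" "x = u + zeta (Suc a) * v" "m = m1 + m2"
    "cycl a u' n1" "cycl a v' n2" "y = u' + zeta (Suc a) * v'" "n = n1 + n2"
    unfolding cycl.simps by blast
  let ?z = "zeta (Suc a) :: 'k"
  have "x * y = (u * u' + (?z * ?z) * (v * v')) + ?z * (u * v' + v * u')"
    unfolding * by (simp only: algebra_simps)
  then have "x * y = (u * u' + zeta a * (v * v')) + ?z * (u * v' + v * u')"
    unfolding zeta_square[OF assms] .
  moreover have "m * n = (m1 * n1 + 1 * (m2 * n2)) + (m1 * n2 + m2 * n1)"
    unfolding * by (simp add: algebra_simps)
  moreover have "cycl a (u * u' + zeta a * (v * v')) (m1 * n1 + 1 * (m2 * n2))"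
    "cycl a (u * v' + v * u') (m1 * n2 + m2 * n1)"
    by (intro cycl_add Suc(1) * cycl_zeta)+
  ultimately show ?case unfolding cycl.simps by blast
qed simp

text \<open>The polynomial representing a number is not unique, but its value at 1 is well defined
  modulo 2. From 0 = u + zeta v follows u^2 - zeta^2 v^2 = 0, a relation one level down, whose value
  m1^2 - m2^2 has the parity of m1 + m2.\<close>

lemma cycl_zero_even:
  assumes "sqrt_closed TYPE('k::field_char_0)"
  shows "cycl a (0 :: 'k) m \<Longrightarrow> even m"
proof (induction a arbitrary: m)
  case (Suc a)
  then obtain u v m1 m2 where *: "cycl a u m1" "cycl a v m2" "(0::'k) = u + zeta (Suc a) * v" "m = m1 + m2"
    unfolding cycl.simps by blast
  have "u = - (zeta (Suc a) * v)" using *(3) by (metis add_eq_0_iff2)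
  then have "u * u = (zeta (Suc a) * zeta (Suc a)) * (v * v)"
    by (simp only: mult_minus_left mult_minus_right minus_minus mult.assoc mult.left_commute mult.commute)
  then have "u * u + - (zeta a * (v * v)) = 0" unfolding zeta_square[OF assms] by simp
  moreover have "cycl a (u * u + - (zeta a * (v * v))) (m1 * m1 + - (1 * (m2 * m2)))"
    by (intro cycl_add cycl_minus cycl_mult[OF assms] cycl_zeta *)
  ultimately have "cycl a (0::'k) (m1 * m1 + - (1 * (m2 * m2)))" by metis
  then have "even (m1 * m1 + - (1 * (m2 * m2)))" by (rule Suc.IH)
  then show ?case unfolding *(4) by auto
qed simp

lemma funpow_comp_idem:
  assumes EE: "\<And>v. E (E v) = E v" and FE: "\<And>v. F (E v) = E (F v)" and "0 < n"
  shows "((\<lambda>v. F (E v)) ^^ n) v = (F ^^ n) (E v)"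
  using assms(3)
proof (induction n arbitrary: v)
  case (Suc n)
  have EFn: "E ((F ^^ n) w) = (F ^^ n) (E w)" for w n
    by (induction n) (auto simp: FE[symmetric])
  show ?case
  proof (cases "n = 0")
    case False
    then show ?thesis using Suc by (simp add: EFn EE)
  qed simp
qed simp

text \<open>\<open>E\<close> projects onto the subspace on which \<open>F\<close> acts, and
  \<open>m\<close> counts the eigenvalues there, each contributing the value 1. The induction splits
  this space into the eigenspaces of the 2^a-th power of \<open>F\<close> for 1 and -1. On the
  second one \<open>F\<close> is divided by \<open>zeta (Suc a)\<close>, whose 2^a-th power is -1,
  so the induction hypothesis covers both parts, and tr F = tr F1 + zeta tr F2 is the recursion of
  \<open>cycl\<close>.\<close>

lemma two_power_trace:
  fixes F E :: "(nat \<Rightarrow> 'k::field_char_0) \<Rightarrow> nat \<Rightarrow> 'k"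
  assumes sq: "sqrt_closed TYPE('k)"
  shows "lop d E \<Longrightarrow> lop d F \<Longrightarrow> (\<And>v. E (E v) = E v) \<Longrightarrow> (\<And>v. F (E v) = F v) \<Longrightarrow>
    (\<And>v. E (F v) = F v) \<Longrightarrow> (\<And>v. (F ^^ (2 ^ a)) v = E v) \<Longrightarrow>
    \<exists>m. cycl a (tr d F) m \<and> tr d E = of_int m"
proof (induction a arbitrary: E F)
  case 0
  obtain r where "tr d E = of_nat r" using lop_idempotent_trace[OF 0(1,3)] by blast
  moreover have "F = E" using 0(6) by auto
  ultimately have "cycl 0 (tr d F) (int r)" "tr d E = of_int (int r)" by simp_all
  then show ?case by blast
next
  case (Suc a)
  define G where "G = F ^^ (2 ^ a)"
  let ?z = "zeta (Suc a) :: 'k"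
  have zz: "?z ^ (2 ^ a) = - 1" by (rule zeta_power[OF sq])
  then have z0: "?z \<noteq> 0" by (metis neg_equal_0_iff_equal one_neq_zero power_eq_0_iff power_not_zero zero_power zero_less_numeral zero_less_power)
  have G: "lop d G" unfolding G_def by (rule lop_funpow[OF Suc(3)]) simp
  have GG: "G (G v) = E v" for v
    using Suc(7)[of v] unfolding G_def by (simp add: funpow_add comp_def mult_2)
  have FG: "F (G v) = G (F v)" for v unfolding G_def by (metis funpow_swap1)
  have GE: "G (E v) = G v" for v
  proof -
    obtain k where "(2::nat) ^ a = Suc k" by (metis not0_implies_Suc power_not_zero zero_neq_numeral)
    then show ?thesis unfolding G_def by (simp only: funpow_Suc_right comp_apply Suc(5))
  qed
  have EG: "E (G v) = G v" for v
  proof -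
    have "E (G v) = G (G (G v))" by (rule GG[symmetric])
    then show ?thesis by (simp only: GG GE)
  qed
  \<comment> \<open>For s = 1 and s = -1 these are the projections onto the two eigenspaces of
    \<open>G\<close> inside the image of \<open>E\<close>.\<close>
  define P where "P s v = (\<lambda>i. (1/2) * E v i + (s/2) * G v i)" for s v
  have lP: "lop d (P s)" for s unfolding P_def by (rule lop_add[OF Suc(2) G])
  have EP: "E (P s v) = P s v" "P s (E v) = P s v" for s v
    unfolding P_def lmap_lin[OF Suc(2)] by (simp_all add: Suc(4) EG GE)
  have GP: "G (P s v) = (\<lambda>i. s * P s v i)" if "s * s = 1" for s v
    unfolding P_def lmap_lin[OF G] GG GE using that by (auto simp: fun_eq_iff algebra_simps)
  have PP: "P s (P s v) = P s v" if "s * s = 1" for s v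
  proof -
    have "P s (P s v) = (\<lambda>i. (1/2) * E (P s v) i + (s/2) * G (P s v) i)" by (simp add: P_def)
    also have "\<dots> = (\<lambda>i. (1/2 + (s * s) / 2) * P s v i)"
      unfolding EP GP[OF that] by (auto simp: fun_eq_iff algebra_simps)
    finally show ?thesis using that by simp
  qed
  have FP: "F (P s v) = P s (F v)" for s v
    unfolding P_def lmap_lin[OF Suc(3)] by (simp add: FG Suc(5,6))
  define F1 where "F1 v = F (P 1 v)" for v
  \<comment> \<open>The summand with factor 0 only brings the term into the two-summand shape of
    \<open>lop_add\<close> and \<open>lmap_lin\<close>.\<close>
  define F2 where "F2 v = (\<lambda>i. inverse ?z * F (P (-1) v) i + 0 * F v i)" for v
  have l1: "lop d F1" unfolding F1_def by (rule lmap_comp[OF Suc(3) lP])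
  have l2: "lop d F2" unfolding F2_def by (rule lop_add[OF lmap_comp[OF Suc(3) lP] Suc(3)])
  have p1: "(F1 ^^ (2 ^ a)) v = P 1 v" for v
  proof -
    have "(F1 ^^ (2 ^ a)) v = G (P 1 v)"
      unfolding F1_def G_def by (rule funpow_comp_idem) (auto simp: PP FP)
    then show ?thesis using GP[of 1] by simp
  qed
  define Q where "Q v = F (P (-1) v)" for v
  have lQ: "lop d Q" unfolding Q_def by (rule lmap_comp[OF Suc(3) lP])
  have p2': "(F2 ^^ n) v = (\<lambda>i. inverse ?z ^ n * (Q ^^ n) v i + 0 * v i)" for n v
  proof (induction n)
    case (Suc n)
    have "(F2 ^^ Suc n) v = (\<lambda>i. inverse ?z * Q ((F2 ^^ n) v) i)"
      by (simp add: F2_def Q_def)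
    also have "Q ((F2 ^^ n) v) = (\<lambda>i. inverse ?z ^ n * Q ((Q ^^ n) v) i + 0 * Q v i)"
      unfolding Suc by (rule lmap_lin[OF lQ])
    finally show ?case
      by (simp only: mult_zero_left add_0_right power_Suc mult.assoc funpow.simps comp_apply)
  qed simp
  have p2: "(F2 ^^ (2 ^ a)) v = P (-1) v" for v
  proof -
    have Qf: "Q = (\<lambda>v. F (P (-1) v))" by (rule ext) (rule Q_def)
    have "(Q ^^ (2 ^ a)) v = G (P (-1) v)"
      unfolding G_def Qf by (rule funpow_comp_idem) (auto simp: PP FP)
    then show ?thesis unfolding p2' power_inverse zz GP[of "-1", simplified] by simp
  qed
  have s1: "F1 (P 1 v) = F1 v" "P 1 (F1 v) = F1 v" for v
    unfolding F1_def by (simp_all add: PP FP)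
  obtain m1 where m1: "cycl a (tr d F1) m1" "tr d (P 1) = of_int m1"
    using Suc(1)[OF lP l1 _ s1 p1] by (auto simp: PP)
  have s2: "F2 (P (-1) v) = F2 v" "P (-1) (F2 v) = F2 v" for v
    unfolding F2_def lmap_lin[OF lP] by (simp_all add: PP FP)
  obtain m2 where m2: "cycl a (tr d F2) m2" "tr d (P (-1)) = of_int m2"
    using Suc(1)[OF lP l2 _ s2 p2] by (auto simp: PP)
  have sumP: "E v = (\<lambda>i. 1 * P 1 v i + 1 * P (-1) v i)" for v
    unfolding P_def by (auto simp: fun_eq_iff algebra_simps)
  have F12: "F v = (\<lambda>i. 1 * F1 v i + ?z * F2 v i)" for v
  proof -
    have "F v = F (E v)" by (simp add: Suc(5))
    also have "\<dots> = (\<lambda>i. 1 * F (P 1 v) i + 1 * F (P (-1) v) i)"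
      unfolding sumP by (rule lmap_lin[OF Suc(3)])
    finally show ?thesis unfolding F1_def F2_def using z0 by (simp add: mult.assoc[symmetric])
  qed
  have "tr d F = 1 * tr d F1 + ?z * tr d F2" unfolding tr_lin[symmetric] F12[symmetric] ..
  moreover have "tr d E = 1 * tr d (P 1) + 1 * tr d (P (-1))" unfolding tr_lin[symmetric] sumP[symmetric] ..
  ultimately have "cycl (Suc a) (tr d F) (m1 + m2)" "tr d E = of_int (m1 + m2)"
    using m1 m2 by (auto simp del: zeta.simps)
  then show ?case by blast
qed

lemma two_power_trace_nonzero:
  fixes F E :: "(nat \<Rightarrow> 'k::field_char_0) \<Rightarrow> nat \<Rightarrow> 'k"
  assumes "sqrt_closed TYPE('k)" "lop d E" "lop d F" "\<And>v. E (E v) = E v" "\<And>v. F (E v) = F v"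
    "\<And>v. E (F v) = F v" "\<And>v. (F ^^ (2 ^ a)) v = E v" "tr d E = of_nat p" "odd p"
  shows "tr d F \<noteq> 0"
proof
  assume 0: "tr d F = 0"
  obtain m where m: "cycl a (tr d F) m" "tr d E = of_int m"
    using two_power_trace[OF assms(1-7)] by blast
  have "even m" using cycl_zero_even[OF assms(1)] m(1) 0 by simp
  moreover have "m = int p" using m(2) assms(8) by (metis of_int_eq_iff of_int_of_nat_eq)
  ultimately show False using assms(9) by simp
qed

section \<open>Dual families\<close>

text \<open>Lagrange interpolation: \<open>a i x\<close> is the value at the point \<open>i\<close>
  of the function \<open>x\<close>, and the functions form an algebra that separates points. It
  serves twice, with group-like elements as points and functionals as functions, and with characters
  as points and elements of the Hopf algebra as functions.\<close>

lemma interpolation: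
  fixes a :: "'i \<Rightarrow> 'v \<Rightarrow> 'k::field"
  assumes "finite I"
    and mult: "\<And>x y. \<exists>z. \<forall>i\<in>I. a i z = a i x * a i y"
    and affine: "\<And>x c s. \<exists>z. \<forall>i\<in>I. a i z = s * (a i x - c)"
    and unit: "\<exists>z. \<forall>i\<in>I. a i z = 1"
    and sep: "\<And>i j. i \<in> I \<Longrightarrow> j \<in> I \<Longrightarrow> i \<noteq> j \<Longrightarrow> \<exists>x. a i x \<noteq> a j x"
  obtains v where "\<And>i j. i \<in> I \<Longrightarrow> j \<in> I \<Longrightarrow> a i (v j) = (if i = j then 1 else 0)"
proof -
  have step: "\<exists>z. a i z = 1 \<and> (\<forall>j\<in>J. a j z = 0)" if fJ: "finite J" "J \<subseteq> I - {i}" and iI: "i \<in> I" for i J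
    using fJ
  proof (induction J)
    case empty then show ?case using unit iI by blast
  next
    case (insert j J)
    then obtain z where z: "a i z = 1" "\<forall>j\<in>J. a j z = 0" by blast
    obtain x where x: "a i x \<noteq> a j x" using sep[of i j] insert iI by auto
    \<comment> \<open>The factor (x - a j x) / (a i x - a j x), which is 1 at \<open>i\<close> and 0
      at \<open>j\<close>.\<close>
    obtain y where y: "\<forall>k\<in>I. a k y = inverse (a i x - a j x) * (a k x - a j x)"
      using affine by blast
    obtain w where w: "\<forall>k\<in>I. a k w = a k z * a k y" using mult by blast
    have "a i w = 1" using w y z x iI by simp
    moreover have "a k w = 0" if "k \<in> insert j J" for k
      using w y z x that insert by auto
    ultimately show ?case by blast
  qed
  have "\<forall>i\<in>I. \<exists>z. a i z = 1 \<and> (\<forall>j\<in>I - {i}. a j z = 0)" using step[of "I - {_}"] assms(1) by auto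
  then obtain v where "\<forall>i\<in>I. a i (v i) = 1 \<and> (\<forall>j\<in>I - {i}. a j (v i) = 0)" by metis
  then show ?thesis using that[of v] by auto
qed

text \<open>The projection onto the span of a dual family is an idempotent of trace
  \<open>n\<close>, and its rank is at most \<open>d\<close>.\<close>

lemma dual_family_le:
  fixes \<kappa> :: "nat \<Rightarrow> (nat \<Rightarrow> 'k::field_char_0) \<Rightarrow> 'k"
  assumes k: "\<And>i. i < n \<Longrightarrow> flin d (\<kappa> i)" and v: "\<And>i. i < n \<Longrightarrow> v i \<in> vecs d"
    and dual: "\<And>i j. i < n \<Longrightarrow> j < n \<Longrightarrow> \<kappa> i (v j) = (if i = j then 1 else 0)"
  shows "n \<le> d"
proof -
  define P where "P x = (\<lambda>i. \<Sum>j<n. \<kappa> j x * v j i)" for x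
  have l: "lop d P" unfolding P_def
    by (rule lmapI) (auto intro!: vlinI flin_sum flin_mult_right k vecs_sum v)
  have kP: "\<kappa> i (P x) = \<kappa> i x" if "i < n" for i x
  proof -
    have "\<kappa> i (P x) = (\<Sum>j<n. \<kappa> j x * \<kappa> i (v j))"
      by (rule flin_sum_apply[OF k[OF that]]) (simp add: P_def)
    also have "\<dots> = (\<Sum>j<n. if j = i then \<kappa> j x else 0)"
      by (rule sum.cong) (use that dual in auto)
    finally show ?thesis using that by simp
  qed
  have "P (P x) = P x" for x
  proof -
    have "P (P x) = (\<lambda>i. \<Sum>j<n. \<kappa> j (P x) * v j i)" by (rule P_def)
    also have "\<dots> = (\<lambda>i. \<Sum>j<n. \<kappa> j x * v j i)" by (simp add: kP)
    finally show ?thesis unfolding P_def[of x] .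
  qed
  then obtain r where r: "r \<le> d" "tr d P = of_nat r"
    using lop_idempotent_trace[OF l] by blast
  have "tr d P = (\<Sum>j<n. tr d (\<lambda>x i. \<kappa> j x * v j i))" unfolding P_def by (rule tr_sum)
  also have "\<dots> = (\<Sum>j<n. 1)" by (rule sum.cong) (auto simp: tr_rank_one k dual)
  finally show ?thesis using r by simp
qed

text \<open>A dual family of \<open>n\<close> vectors in the image of an idempotent of rank
  \<open>n\<close> is a basis of that image: \<open>E\<close> minus the projection onto the span of
  the family is an idempotent of trace 0.\<close>

lemma dual_family_full:
  fixes \<kappa> :: "nat \<Rightarrow> (nat \<Rightarrow> 'k::field_char_0) \<Rightarrow> 'k"
  assumes k: "\<And>i. i < n \<Longrightarrow> flin d (\<kappa> i)" and Ev: "\<And>i. i < n \<Longrightarrow> E (v i) = v i"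
    and dual: "\<And>i j. i < n \<Longrightarrow> j < n \<Longrightarrow> \<kappa> i (v j) = (if i = j then 1 else 0)"
    and E: "lop d E" "\<And>x. E (E x) = E x" "tr d E = of_nat n"
  shows "E x = (\<lambda>i. \<Sum>j<n. \<kappa> j (E x) * v j i)"
proof -
  define P where "P x = (\<lambda>i. \<Sum>j<n. \<kappa> j (E x) * v j i)" for x
  have v: "i < n \<Longrightarrow> v i \<in> vecs d" for i using Ev lmapD(2)[OF E(1)] by metis
  have fkE: "i < n \<Longrightarrow> flin d (\<lambda>x. \<kappa> i (E x))" for i by (rule flin_comp[OF k lmapD(1)[OF E(1)]])
  have l: "lop d P" unfolding P_def
    by (rule lmapI) (auto intro!: vlinI flin_sum flin_mult_right fkE vecs_sum v)
  have EP: "E (P x) = P x" for x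
    unfolding P_def lmap_sum[OF E(1)] by (auto simp: fun_eq_iff Ev intro!: sum.cong)
  have PE: "P (E x) = P x" for x unfolding P_def E(2) ..
  have kP: "\<kappa> i (P x) = \<kappa> i (E x)" if "i < n" for i x
  proof -
    have "\<kappa> i (P x) = (\<Sum>j<n. \<kappa> j (E x) * \<kappa> i (v j))"
      by (rule flin_sum_apply[OF k[OF that]]) (simp add: P_def)
    also have "\<dots> = (\<Sum>j<n. if j = i then \<kappa> j (E x) else 0)"
      by (rule sum.cong) (use that dual in auto)
    finally show ?thesis using that by simp
  qed
  have PP: "P (P x) = P x" for x 
  proof -
    have "P (P x) = (\<lambda>i. \<Sum>j<n. \<kappa> j (P x) * v j i)" unfolding P_def[of "P x"] EP ..
    also have "\<dots> = (\<lambda>i. \<Sum>j<n. \<kappa> j (E x) * v j i)" by (simp add: kP)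
    finally show ?thesis unfolding P_def[of x] .
  qed
  define Q where "Q x = (\<lambda>i. 1 * E x i + (-1) * P x i)" for x
  have lQ: "lop d Q" unfolding Q_def by (rule lop_add[OF E(1) l])
  have QQ: "Q (Q x) = Q x" for x
    unfolding Q_def lmap_lin[OF E(1)] lmap_lin[OF l] EP PE PP E(2) by simp
  have "tr d P = (\<Sum>j<n. tr d (\<lambda>x i. \<kappa> j (E x) * v j i))" unfolding P_def by (rule tr_sum)
  also have "\<dots> = (\<Sum>j<n. 1)" by (rule sum.cong) (auto simp: tr_rank_one[OF fkE] dual Ev)
  finally have "tr d Q = 0" unfolding Q_def tr_lin E(3) by simp
  then have "Q x = (\<lambda>_. 0)" by (rule lop_idempotent_trace_zero[OF lQ QQ])
  then have "E x = P x" unfolding Q_def by (simp add: fun_eq_iff)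
  then show ?thesis unfolding P_def .
qed

section \<open>Sweedler calculus\<close>

definition heps :: "'k::field hopf_data \<Rightarrow> (nat \<Rightarrow> 'k) \<Rightarrow> 'k" where
  "heps H v = (\<Sum>i<hdim H. v i * hcounit H i)"

text \<open>\<open>Sw H h (\<lambda>x y. B x y)\<close> is the Sweedler sum of \<open>B\<close> over the comultiplication of \<open>h\<close>.\<close>

definition Sw :: "'k::field hopf_data \<Rightarrow> (nat \<Rightarrow> 'k) \<Rightarrow> ((nat \<Rightarrow> 'k) \<Rightarrow> (nat \<Rightarrow> 'k) \<Rightarrow> 'k) \<Rightarrow> 'k" where
  "Sw H h B = (\<Sum>a<hdim H. \<Sum>b<hdim H. hDelta H h a b * B (bs a) (bs b))"

lemma flin_eqI:
  assumes "flin d F" "flin d G" "\<And>i. i < d \<Longrightarrow> F (bs i) = G (bs i)"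
  shows "F v = G v"
  unfolding flinD[OF assms(1), of v] flinD[OF assms(2), of v] by (simp add: assms(3))

lemma vecs_hvecs: "hvecs H = vecs (hdim H)"
  unfolding hvecs_def vecs_def by simp

lemma lop_mul_left: "lop (hdim H) (\<lambda>v. hmul H x v)"
  by (rule lmapI, rule vlinI)
     (auto simp: hmul_def vecs_def intro!: flin_sum flin_mult_right flin_mult_left flin_coord)

lemma lop_mul_right: "lop (hdim H) (\<lambda>v. hmul H v x)"
  by (rule lmapI, rule vlinI)
     (auto simp: hmul_def vecs_def intro!: flin_sum flin_mult_right flin_mult_left flin_coord)

lemma lop_S: "lop (hdim H) (hS H)"
  by (rule lmapI, rule vlinI)
     (auto simp: hS_def vecs_def intro!: flin_sum flin_mult_right flin_mult_left flin_coord)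

lemma flin_eps: "flin (hdim H) (heps H)"
  unfolding heps_def by (auto intro!: flin_sum flin_mult_right flin_mult_left flin_coord)

lemma hmul_vecs [simp, intro]: "hmul H x y \<in> vecs (hdim H)"
  using lmapD(2)[OF lop_mul_left] .

lemma hS_vecs [simp, intro]: "hS H x \<in> vecs (hdim H)"
  using lmapD(2)[OF lop_S] .

lemma hone_vecs [simp, intro]: "hone H \<in> vecs (hdim H)"
  by (simp add: hone_def vecs_def)

lemma vlin_mulR [lin]: "vlin d' (hdim H) f \<Longrightarrow> vlin d' n (\<lambda>v. hmul H x (f v))"
  by (rule lmap_vlin_comp[OF lop_mul_left])

lemma vlin_mulL [lin]: "vlin d' (hdim H) f \<Longrightarrow> vlin d' n (\<lambda>v. hmul H (f v) x)"
  by (rule lmap_vlin_comp[OF lop_mul_right])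

lemma vlin_S [lin]: "vlin d' (hdim H) f \<Longrightarrow> vlin d' n (\<lambda>v. hS H (f v))"
  by (rule lmap_vlin_comp[OF lop_S])

lemma flin_mulR_coord [lin]: "vlin d' (hdim H) f \<Longrightarrow> flin d' (\<lambda>v. hmul H x (f v) i)"
  by (rule flin_comp[OF lmap_flin[OF lop_mul_left]])

lemma flin_mulL_coord [lin]: "vlin d' (hdim H) f \<Longrightarrow> flin d' (\<lambda>v. hmul H (f v) x i)"
  by (rule flin_comp[OF lmap_flin[OF lop_mul_right]])

lemma flin_S_coord [lin]: "vlin d' (hdim H) f \<Longrightarrow> flin d' (\<lambda>v. hS H (f v) i)"
  by (rule flin_comp[OF lmap_flin[OF lop_S]])

lemma flin_heps [lin]: "vlin d' (hdim H) f \<Longrightarrow> flin d' (\<lambda>v. heps H (f v))"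
  by (rule flin_comp[OF flin_eps])

lemma flin_Delta: "flin (hdim H) (\<lambda>v. hDelta H v a b)"
proof (cases "a < hdim H \<and> b < hdim H")
  case True
  then show ?thesis unfolding hDelta_def
    by (auto intro!: flin_sum flin_mult_right flin_coord)
next
  case False
  then have "(\<lambda>v. hDelta H v a b) = (\<lambda>v. 0)" by (auto simp: hDelta_def)
  then show ?thesis by (simp add: flin_const0)
qed

lemma flin_Sw1 [lin]: "vlin d' (hdim H) f \<Longrightarrow> flin d' (\<lambda>v. Sw H (f v) B)"
  unfolding Sw_def by (intro flin_sum flin_mult_right flin_comp[OF flin_Delta])

lemma flin_Sw2 [lin]: "(\<And>a b. flin d' (\<lambda>v. F v a b)) \<Longrightarrow> flin d' (\<lambda>v. Sw H x (\<lambda>a b. F v a b))"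
  unfolding Sw_def by (intro flin_sum flin_mult_left) auto

lemmas [lin] = order_refl

lemma Sw_cong:
  assumes "\<And>x y. x \<in> vecs (hdim H) \<Longrightarrow> y \<in> vecs (hdim H) \<Longrightarrow> B x y = C x y"
  shows "Sw H h B = Sw H h C"
  unfolding Sw_def by (intro sum.cong refl) (auto simp: assms)

lemma Sw_scale: "Sw H x (\<lambda>a b. c * B a b) = c * Sw H x B"
  unfolding Sw_def by (simp add: sum_distrib_left mult.left_commute)

lemma Sw_scale_right: "Sw H x (\<lambda>a b. B a b * c) = Sw H x B * c"
  using Sw_scale[of H x c B] by (simp add: mult.commute)

lemma Sw_sum: "Sw H x (\<lambda>a b. \<Sum>i\<in>I. B i a b) = (\<Sum>i\<in>I. Sw H x (B i))"
proof -
  have "Sw H x (\<lambda>a b. \<Sum>i\<in>I. B i a b)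
      = (\<Sum>a<hdim H. \<Sum>b<hdim H. \<Sum>i\<in>I. hDelta H x a b * B i (bs a) (bs b))"
    unfolding Sw_def by (simp add: sum_distrib_left)
  also have "\<dots> = (\<Sum>a<hdim H. \<Sum>i\<in>I. \<Sum>b<hdim H. hDelta H x a b * B i (bs a) (bs b))"
    by (rule sum.cong[OF refl]) (rule sum.swap)
  also have "\<dots> = (\<Sum>i\<in>I. Sw H x (B i))"
    unfolding Sw_def by (rule sum.swap)
  finally show ?thesis .
qed

lemma Sw_diff: "Sw H x (\<lambda>a b. B a b - C a b) = Sw H x B - Sw H x C"
  unfolding Sw_def by (simp add: right_diff_distrib sum_subtractf)

lemma Sw_zero: "Sw H x (\<lambda>a b. 0) = 0"
  unfolding Sw_def by simp

lemma Sw_swap: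
  "Sw H x (\<lambda>a b. Sw G y (\<lambda>u v. B a b u v)) = Sw G y (\<lambda>u v. Sw H x (\<lambda>a b. B a b u v))"
proof -
  have "Sw H x (\<lambda>a b. Sw G y (\<lambda>u v. B a b u v))
     = (\<Sum>u<hdim G. \<Sum>v<hdim G. Sw H x (\<lambda>a b. hDelta G y u v * B a b (bs u) (bs v)))"
    unfolding Sw_def[of G] Sw_sum ..
  also have "\<dots> = Sw G y (\<lambda>u v. Sw H x (\<lambda>a b. B a b u v))"
    unfolding Sw_scale Sw_def[of G] ..
  finally show ?thesis .
qed

lemma hDelta_bs: "i < hdim H \<Longrightarrow> a < hdim H \<Longrightarrow> b < hdim H \<Longrightarrow> hDelta H (bs i) a b = hcomult H i a b"
  by (simp add: hDelta_def)

lemma Sw_bs: "i < hdim H \<Longrightarrow>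
  Sw H (bs i) B = (\<Sum>a<hdim H. \<Sum>b<hdim H. hcomult H i a b * B (bs a) (bs b))"
  unfolding Sw_def by (intro sum.cong refl) (simp add: hDelta_bs)

lemma hmul_bs: "i < hdim H \<Longrightarrow> j < hdim H \<Longrightarrow> k < hdim H \<Longrightarrow> hmul H (bs i) (bs j) k = hmult H i j k"
  by (simp add: hmul_def mult.assoc sum_distrib_left[symmetric])

lemma hmul_bs_right: "j < hdim H \<Longrightarrow> k < hdim H \<Longrightarrow> hmul H x (bs j) k = (\<Sum>r<hdim H. x r * hmult H r j k)"
  by (simp add: hmul_def mult.assoc sum_distrib_left[symmetric])

lemma hmul_bs_left: "i < hdim H \<Longrightarrow> k < hdim H \<Longrightarrow> hmul H (bs i) y k = (\<Sum>r<hdim H. y r * hmult H i r k)"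
  by (simp add: hmul_def mult.assoc sum_distrib_left[symmetric])

lemma hS_bs: "i < hdim H \<Longrightarrow> j < hdim H \<Longrightarrow> hS H (bs i) j = hanti H i j"
  by (simp add: hS_def)

lemma heps_bs: "i < hdim H \<Longrightarrow> heps H (bs i) = hcounit H i"
  by (simp add: heps_def)

lemma bilin_expand:
  assumes "\<And>y. flin d (\<lambda>x. B x y)" "\<And>x. flin d (B x)"
  shows "B x y = (\<Sum>a<d. \<Sum>b<d. x a * y b * B (bs a) (bs b))"
proof -
  have "B x y = (\<Sum>a<d. x a * B (bs a) y)" by (rule flinD[OF assms(1)])
  also have "\<dots> = (\<Sum>a<d. x a * (\<Sum>b<d. y b * B (bs a) (bs b)))"
    by (intro sum.cong refl arg_cong2[where f="(*)"] flinD[OF assms(2)])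
  finally show ?thesis by (simp add: sum_distrib_left mult.assoc)
qed

section \<open>The dual Hopf algebra and the axioms in Sweedler form\<close>

definition hdual :: "'k::field hopf_data \<Rightarrow> 'k hopf_data" where
  "hdual H = \<lparr>hdim = hdim H, hmult = (\<lambda>i j r. hcomult H r i j), hunit = hcounit H,
     hcomult = (\<lambda>r i j. hmult H i j r), hcounit = hunit H, hanti = (\<lambda>i j. hanti H j i)\<rparr>"

lemma hdual_sel [simp]: "hdim (hdual H) = hdim H" "hmult (hdual H) i j r = hcomult H r i j"
  "hunit (hdual H) = hcounit H" "hcomult (hdual H) r i j = hmult H i j r"
  "hcounit (hdual H) = hunit H" "hanti (hdual H) i j = hanti H j i"
  by (simp_all add: hdual_def)

locale hopf =
  fixes H :: "'k::field_char_0 hopf_data"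
  assumes hopf: "is_hopf_algebra H"
begin

abbreviation "d \<equiv> hdim H"
abbreviation mul (infixl "\<odot>" 70) where "x \<odot> y \<equiv> hmul H x y"
abbreviation "S \<equiv> hS H"
abbreviation "eps \<equiv> heps H"
abbreviation "one \<equiv> hone H"
abbreviation "SW \<equiv> Sw H"

lemmas hopf_conditions = hopf[unfolded is_hopf_algebra_def Let_def]

lemma ax_assoc: "i<d \<Longrightarrow> j<d \<Longrightarrow> k<d \<Longrightarrow> l<d \<Longrightarrow>
   (\<Sum>r<d. hmult H i j r * hmult H r k l) = (\<Sum>r<d. hmult H j k r * hmult H i r l)"
  using hopf_conditions[THEN conjunct1] by blast

lemma ax_unit:
  "i<d \<Longrightarrow> l<d \<Longrightarrow> (\<Sum>r<d. hunit H r * hmult H r i l) = (if i = l then 1 else 0)"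
  "i<d \<Longrightarrow> l<d \<Longrightarrow> (\<Sum>r<d. hunit H r * hmult H i r l) = (if i = l then 1 else 0)"
  using hopf_conditions[THEN conjunct2, THEN conjunct1] by blast+

lemma ax_coassoc: "i<d \<Longrightarrow> a<d \<Longrightarrow> b<d \<Longrightarrow> k<d \<Longrightarrow>
    (\<Sum>r<d. hcomult H i r k * hcomult H r a b) = (\<Sum>r<d. hcomult H i a r * hcomult H r b k)"
  using hopf_conditions[THEN conjunct2, THEN conjunct2, THEN conjunct1] by blast

lemma ax_counit:
  "i<d \<Longrightarrow> k<d \<Longrightarrow> (\<Sum>r<d. hcounit H r * hcomult H i r k) = (if i = k then 1 else 0)"
  "i<d \<Longrightarrow> k<d \<Longrightarrow> (\<Sum>r<d. hcounit H r * hcomult H i k r) = (if i = k then 1 else 0)"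
  using hopf_conditions[THEN conjunct2, THEN conjunct2, THEN conjunct2, THEN conjunct1] by blast+

lemma ax_bialg: "i<d \<Longrightarrow> j<d \<Longrightarrow> a<d \<Longrightarrow> b<d \<Longrightarrow> (\<Sum>r<d. hmult H i j r * hcomult H r a b) =
        (\<Sum>a1<d. \<Sum>b1<d. \<Sum>a2<d. \<Sum>b2<d.
            hcomult H i a1 b1 * hcomult H j a2 b2 * hmult H a1 a2 a * hmult H b1 b2 b)"
  using hopf_conditions[THEN conjunct2, THEN conjunct2, THEN conjunct2, THEN conjunct2, THEN conjunct1] by blast

lemma ax_counit_one: "a<d \<Longrightarrow> b<d \<Longrightarrow> (\<Sum>r<d. hunit H r * hcomult H r a b) = hunit H a * hunit H b"
  using hopf_conditions[THEN conjunct2, THEN conjunct2, THEN conjunct2, THEN conjunct2, THEN conjunct2, THEN conjunct1] by blast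

lemma ax_eps_mult: "i<d \<Longrightarrow> j<d \<Longrightarrow> (\<Sum>r<d. hmult H i j r * hcounit H r) = hcounit H i * hcounit H j"
  using hopf_conditions[THEN conjunct2, THEN conjunct2, THEN conjunct2, THEN conjunct2, THEN conjunct2, THEN conjunct2, THEN conjunct1] by blast

lemma ax_eps_one: "(\<Sum>r<d. hunit H r * hcounit H r) = 1"
  using hopf_conditions[THEN conjunct2, THEN conjunct2, THEN conjunct2, THEN conjunct2, THEN conjunct2, THEN conjunct2, THEN conjunct2, THEN conjunct1] by blast

lemma ax_antipode:
  "i<d \<Longrightarrow> l<d \<Longrightarrow> (\<Sum>a<d. \<Sum>b<d. hcomult H i a b * (\<Sum>r<d. hanti H a r * hmult H r b l)) = hcounit H i * hunit H l"
  "i<d \<Longrightarrow> l<d \<Longrightarrow> (\<Sum>a<d. \<Sum>b<d. hcomult H i a b * (\<Sum>r<d. hanti H b r * hmult H a r l)) = hcounit H i * hunit H l"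
  using hopf_conditions[THEN conjunct2, THEN conjunct2, THEN conjunct2, THEN conjunct2, THEN conjunct2, THEN conjunct2, THEN conjunct2, THEN conjunct2] by blast+

text \<open>The axioms are self-dual: transposing the structure constants exchanges associativity
  with coassociativity and unit with counit. Every lemma of the locale thereby becomes available for
  the dual.\<close>

lemma dual_hopf: "is_hopf_algebra (hdual H)"
proof -
  have b: "(\<Sum>r<d. hcomult H r i j * hmult H a b r) = (\<Sum>a1<d. \<Sum>b1<d. \<Sum>a2<d. \<Sum>b2<d.
     hmult H a1 b1 i * hmult H a2 b2 j * hcomult H a a1 a2 * hcomult H b b1 b2)"
    if "i<d" "j<d" "a<d" "b<d" for i j a b
  proof -
    have "(\<Sum>r<d. hcomult H r i j * hmult H a b r) = (\<Sum>r<d. hmult H a b r * hcomult H r i j)"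
      by (simp add: mult.commute)
    also have "\<dots> = (\<Sum>a1<d. \<Sum>b1<d. \<Sum>a2<d. \<Sum>b2<d.
       hcomult H a a1 b1 * hcomult H b a2 b2 * hmult H a1 a2 i * hmult H b1 b2 j)"
      by (rule ax_bialg) (use that in auto)
    also have "\<dots> = (\<Sum>a1<d. \<Sum>a2<d. \<Sum>b1<d. \<Sum>b2<d.
       hcomult H a a1 b1 * hcomult H b a2 b2 * hmult H a1 a2 i * hmult H b1 b2 j)"
      by (rule sum.cong[OF refl]) (rule sum.swap)
    finally show ?thesis by (simp add: ac_simps)
  qed
  show ?thesis
    unfolding is_hopf_algebra_def Let_def hdual_sel
  proof (intro conjI allI impI)
    fix i j k l assume "i<d" "j<d" "k<d" "l<d"
    then show "(\<Sum>r<d. hcomult H r i j * hcomult H l r k) = (\<Sum>r<d. hcomult H r j k * hcomult H l i r)"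
      using ax_coassoc[of l i j k] by (simp add: mult.commute)
  next
    fix i a b k assume "i<d" "a<d" "b<d" "k<d"
    then show "(\<Sum>r<d. hmult H r k i * hmult H a b r) = (\<Sum>r<d. hmult H a r i * hmult H b k r)"
      using ax_assoc[of a b k i] by (simp add: mult.commute)
  next
    fix i j a b assume "i<d" "j<d" "a<d" "b<d"
    then show "(\<Sum>r<d. hcomult H r i j * hmult H a b r) = (\<Sum>a1<d. \<Sum>b1<d. \<Sum>a2<d. \<Sum>b2<d.
     hmult H a1 b1 i * hmult H a2 b2 j * hcomult H a a1 a2 * hcomult H b b1 b2)" by (rule b)
  next
    fix i l assume il: "i<d" "l<d"
    have "(\<Sum>a<d. \<Sum>b<d. hmult H a b i * (\<Sum>r<d. hanti H r a * hcomult H l r b))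
       = (\<Sum>b<d. \<Sum>a<d. \<Sum>r<d. hcomult H l r b * (hanti H r a * hmult H a b i))"
      by (subst sum.swap) (simp add: sum_distrib_left ac_simps)
    also have "\<dots> = (\<Sum>b<d. \<Sum>r<d. \<Sum>a<d. hcomult H l r b * (hanti H r a * hmult H a b i))"
      by (rule sum.cong[OF refl]) (rule sum.swap)
    also have "\<dots> = (\<Sum>r<d. \<Sum>b<d. hcomult H l r b * (\<Sum>a<d. hanti H r a * hmult H a b i))"
      by (subst sum.swap) (simp add: sum_distrib_left)
    also have "\<dots> = hunit H i * hcounit H l" using ax_antipode(1)[OF il(2,1)] by simp
    finally show "(\<Sum>a<d. \<Sum>b<d. hmult H a b i * (\<Sum>r<d. hanti H r a * hcomult H l r b)) = hunit H i * hcounit H l" .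
    have "(\<Sum>a<d. \<Sum>b<d. hmult H a b i * (\<Sum>r<d. hanti H r b * hcomult H l a r))
       = (\<Sum>a<d. \<Sum>b<d. \<Sum>r<d. hcomult H l a r * (hanti H r b * hmult H a b i))"
      by (simp add: sum_distrib_left ac_simps)
    also have "\<dots> = (\<Sum>a<d. \<Sum>r<d. \<Sum>b<d. hcomult H l a r * (hanti H r b * hmult H a b i))"
      by (rule sum.cong[OF refl]) (rule sum.swap)
    also have "\<dots> = hunit H i * hcounit H l" using ax_antipode(2)[OF il(2,1)] by (simp add: sum_distrib_left)
    finally show "(\<Sum>a<d. \<Sum>b<d. hmult H a b i * (\<Sum>r<d. hanti H r b * hcomult H l a r)) = hunit H i * hcounit H l" .
  next
    fix i l assume il: "i<d" "l<d"
    show "(\<Sum>r<d. hcounit H r * hcomult H l r i) = (if i = l then 1 else 0)"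
      "(\<Sum>r<d. hcounit H r * hcomult H l i r) = (if i = l then 1 else 0)"
      using ax_counit[OF il(2,1)] by (simp_all add: eq_commute)
    show "(\<Sum>r<d. hunit H r * hmult H r l i) = (if i = l then 1 else 0)"
      "(\<Sum>r<d. hunit H r * hmult H l r i) = (if i = l then 1 else 0)"
      using ax_unit[OF il(2,1)] by (simp_all add: eq_commute)
    show "(\<Sum>r<d. hcounit H r * hmult H i l r) = hcounit H i * hcounit H l"
      using ax_eps_mult[OF il] by (simp add: mult.commute)
    show "(\<Sum>r<d. hcomult H r i l * hunit H r) = hunit H i * hunit H l"
      using ax_counit_one[OF il] by (simp add: mult.commute)
  next
    show "(\<Sum>r<d. hcounit H r * hunit H r) = 1"
      using ax_eps_one by (simp add: mult.commute)
  qed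
qed

lemma assoc: "(x \<odot> y) \<odot> z = x \<odot> (y \<odot> z)"
proof (rule vecs_eqI[of _ d])
  fix l assume l: "l < d"
  show "((x \<odot> y) \<odot> z) l = (x \<odot> (y \<odot> z)) l"
  proof (rule flin_eqI[where v=x and d=d])
    fix i assume i: "i < d"
    show "((bs i \<odot> y) \<odot> z) l = (bs i \<odot> (y \<odot> z)) l"
    proof (rule flin_eqI[where v=y and d=d])
      fix j assume j: "j < d"
      show "((bs i \<odot> bs j) \<odot> z) l = (bs i \<odot> (bs j \<odot> z)) l"
      proof (rule flin_eqI[where v=z and d=d])
        fix k assume k: "k < d"
        show "((bs i \<odot> bs j) \<odot> bs k) l = (bs i \<odot> (bs j \<odot> bs k)) l"
          using ax_assoc[OF i j k l] by (simp add: hmul_bs_right hmul_bs_left i j k l)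
      qed (intro lin)+
    qed (intro lin)+
  qed (intro lin)+
qed auto

lemma one_left:
  assumes x: "x \<in> vecs d" shows "one \<odot> x = x"
proof (rule vecs_eqI[of _ d])
  fix l assume l: "l < d"
  show "(one \<odot> x) l = x l"
  proof (rule flin_eqI[where v=x and d=d])
    fix i assume i: "i < d"
    have "(one \<odot> bs i) l = (\<Sum>r<d. hunit H r * hmult H r i l)"
      unfolding hmul_bs_right[OF i l] by (intro sum.cong refl) (simp add: hone_def)
    then show "(one \<odot> bs i) l = bs i l" using i l by (simp add: ax_unit bs_def)
  qed (intro lin l)+
qed (use x in auto)

lemma one_right:
  assumes x: "x \<in> vecs d" shows "x \<odot> one = x"
proof (rule vecs_eqI[of _ d])
  fix l assume l: "l < d"
  show "(x \<odot> one) l = x l"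
  proof (rule flin_eqI[where v=x and d=d])
    fix i assume i: "i < d"
    have "(bs i \<odot> one) l = (\<Sum>r<d. hunit H r * hmult H i r l)"
      unfolding hmul_bs_left[OF i l] by (intro sum.cong refl) (simp add: hone_def)
    then show "(bs i \<odot> one) l = bs i l" using i l by (simp add: ax_unit bs_def)
  qed (intro lin l)+
qed (use x in auto)

lemma coassoc: "SW h (\<lambda>x y. SW x (\<lambda>u v. B u v y)) = SW h (\<lambda>x y. SW y (\<lambda>u v. B x u v))"
proof (rule flin_eqI[where v=h and d=d])
  fix i assume i: "i < d"
  have "SW (bs i) (\<lambda>x y. SW x (\<lambda>u v. B u v y))
     = (\<Sum>a<d. \<Sum>b<d. \<Sum>u<d. \<Sum>v<d. hcomult H i a b * hcomult H a u v * B (bs u) (bs v) (bs b))"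
    by (simp add: Sw_bs i sum_distrib_left mult.assoc)
  also have "\<dots> = (\<Sum>b<d. \<Sum>a<d. \<Sum>u<d. \<Sum>v<d. hcomult H i a b * hcomult H a u v * B (bs u) (bs v) (bs b))"
    by (rule sum.swap)
  also have "\<dots> = (\<Sum>b<d. \<Sum>u<d. \<Sum>a<d. \<Sum>v<d. hcomult H i a b * hcomult H a u v * B (bs u) (bs v) (bs b))"
    by (rule sum.cong[OF refl]) (rule sum.swap)
  also have "\<dots> = (\<Sum>b<d. \<Sum>u<d. \<Sum>v<d. \<Sum>a<d. hcomult H i a b * hcomult H a u v * B (bs u) (bs v) (bs b))"
    by (rule sum.cong[OF refl], rule sum.cong[OF refl], rule sum.swap)
  also have "\<dots> = (\<Sum>b<d. \<Sum>u<d. \<Sum>v<d. \<Sum>a<d. hcomult H i u a * hcomult H a v b * B (bs u) (bs v) (bs b))"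
    by (rule sum.cong[OF refl], rule sum.cong[OF refl], rule sum.cong[OF refl])
       (use i in \<open>simp add: sum_distrib_right[symmetric] ax_coassoc\<close>)
  also have "\<dots> = (\<Sum>u<d. \<Sum>b<d. \<Sum>v<d. \<Sum>a<d. hcomult H i u a * hcomult H a v b * B (bs u) (bs v) (bs b))"
    by (rule sum.swap)
  also have "\<dots> = (\<Sum>u<d. \<Sum>v<d. \<Sum>b<d. \<Sum>a<d. hcomult H i u a * hcomult H a v b * B (bs u) (bs v) (bs b))"
    by (rule sum.cong[OF refl]) (rule sum.swap)
  also have "\<dots> = (\<Sum>u<d. \<Sum>v<d. \<Sum>a<d. \<Sum>b<d. hcomult H i u a * hcomult H a v b * B (bs u) (bs v) (bs b))"
    by (rule sum.cong[OF refl], rule sum.cong[OF refl], rule sum.swap)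
  also have "\<dots> = (\<Sum>u<d. \<Sum>a<d. \<Sum>v<d. \<Sum>b<d. hcomult H i u a * hcomult H a v b * B (bs u) (bs v) (bs b))"
    by (rule sum.cong[OF refl]) (rule sum.swap)
  also have "\<dots> = SW (bs i) (\<lambda>x y. SW y (\<lambda>u v. B x u v))"
    by (simp add: Sw_bs i sum_distrib_left mult.assoc)
  finally show "SW (bs i) (\<lambda>x y. SW x (\<lambda>u v. B u v y)) = SW (bs i) (\<lambda>x y. SW y (\<lambda>u v. B x u v))" .
qed (intro lin)+

lemma counit_left:
  assumes F: "flin d F" shows "SW h (\<lambda>x y. eps x * F y) = F h"
proof (rule flin_eqI[where v=h and d=d])
  fix i assume i: "i < d"
  have "SW (bs i) (\<lambda>x y. eps x * F y) = (\<Sum>a<d. \<Sum>b<d. hcounit H a * hcomult H i a b * F (bs b))"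
    by (simp add: Sw_bs i heps_bs ac_simps)
  also have "\<dots> = (\<Sum>b<d. (\<Sum>a<d. hcounit H a * hcomult H i a b) * F (bs b))"
    unfolding sum_distrib_right by (rule sum.swap)
  also have "\<dots> = (\<Sum>b<d. bs i b * F (bs b))"
    using i by (intro sum.cong refl) (simp add: ax_counit bs_def)
  finally show "SW (bs i) (\<lambda>x y. eps x * F y) = F (bs i)" using i by simp
qed (intro lin F)+

lemma counit_right:
  assumes F: "flin d F" shows "SW h (\<lambda>x y. eps y * F x) = F h"
proof (rule flin_eqI[where v=h and d=d])
  fix i assume i: "i < d"
  have "SW (bs i) (\<lambda>x y. eps y * F x) = (\<Sum>b<d. \<Sum>a<d. hcounit H a * hcomult H i b a * F (bs b))"
    by (simp add: Sw_bs i heps_bs ac_simps)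
  also have "\<dots> = (\<Sum>b<d. (\<Sum>a<d. hcounit H a * hcomult H i b a) * F (bs b))"
    unfolding sum_distrib_right ..
  also have "\<dots> = (\<Sum>b<d. bs i b * F (bs b))"
    using i by (intro sum.cong refl) (simp add: ax_counit bs_def)
  finally show "SW (bs i) (\<lambda>x y. eps y * F x) = F (bs i)" using i by simp
qed (intro lin F)+

lemma counit_right': "flin d F \<Longrightarrow> SW h (\<lambda>x y. F x * eps y) = F h"
  using counit_right[of F h] by (simp add: mult.commute)

lemma Sw_mul_coord: 
  assumes a: "a < d" "b < d"
  shows "hDelta H (x \<odot> y) a b = SW x (\<lambda>p q. SW y (\<lambda>u v. (p \<odot> u) a * (q \<odot> v) b))"
proof (rule flin_eqI[where v=x and d=d])
  fix i assume i: "i < d"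
  show "hDelta H (bs i \<odot> y) a b = SW (bs i) (\<lambda>p q. SW y (\<lambda>u v. (p \<odot> u) a * (q \<odot> v) b))"
  proof (rule flin_eqI[where v=y and d=d])
    fix j assume j: "j < d"
    have "hDelta H (bs i \<odot> bs j) a b = (\<Sum>r<d. hmult H i j r * hcomult H r a b)"
      using a i j by (simp add: hDelta_def hmul_bs)
    also have "\<dots> = SW (bs i) (\<lambda>p q. SW (bs j) (\<lambda>u v. (p \<odot> u) a * (q \<odot> v) b))"
      unfolding ax_bialg[OF i j a] using a
      by (simp add: Sw_bs i j hmul_bs sum_distrib_left mult.assoc)
    finally show "hDelta H (bs i \<odot> bs j) a b = SW (bs i) (\<lambda>p q. SW (bs j) (\<lambda>u v. (p \<odot> u) a * (q \<odot> v) b))" .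
  qed (intro lin flin_comp[OF flin_Delta])+
qed (intro lin flin_comp[OF flin_Delta])+

lemma Sw_mul:
  assumes B: "\<And>y. flin d (\<lambda>x. B x y)" "\<And>x. flin d (B x)"
  shows "SW (x \<odot> y) B = SW x (\<lambda>p q. SW y (\<lambda>u v. B (p \<odot> u) (q \<odot> v)))"
proof -
  have "SW (x \<odot> y) B = (\<Sum>a<d. \<Sum>b<d. SW x (\<lambda>p q. SW y (\<lambda>u v. (p \<odot> u) a * (q \<odot> v) b)) * B (bs a) (bs b))"
    unfolding Sw_def[of H "x \<odot> y" B] by (intro sum.cong refl) (simp add: Sw_mul_coord)
  also have "\<dots> = SW x (\<lambda>p q. SW y (\<lambda>u v. \<Sum>a<d. \<Sum>b<d. (p \<odot> u) a * (q \<odot> v) b * B (bs a) (bs b)))"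
    by (simp only: Sw_sum Sw_scale_right)
  also have "\<dots> = SW x (\<lambda>p q. SW y (\<lambda>u v. B (p \<odot> u) (q \<odot> v)))"
    by (simp only: bilin_expand[OF B, symmetric])
  finally show ?thesis .
qed

lemma Sw_one:
  assumes B: "\<And>y. flin d (\<lambda>x. B x y)" "\<And>x. flin d (B x)"
  shows "SW one B = B one one"
proof -
  have "SW one B = (\<Sum>a<d. \<Sum>b<d. one a * one b * B (bs a) (bs b))"
    unfolding Sw_def by (intro sum.cong refl) (simp add: hDelta_def hone_def ax_counit_one)
  also have "\<dots> = B one one" by (rule bilin_expand[OF B, symmetric])
  finally show ?thesis .
qed

lemma eps_mul: "eps (x \<odot> y) = eps x * eps y"
proof (rule flin_eqI[where v=x and d=d])
  fix i assume i: "i < d"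
  show "eps (bs i \<odot> y) = eps (bs i) * eps y"
    by (rule flin_eqI[where v=y and d=d], intro lin, intro lin)
       (use i in \<open>simp add: heps_bs heps_def[of H "bs i \<odot> bs j" for j] hmul_bs ax_eps_mult\<close>)
qed (intro lin)+

lemma eps_one: "eps one = 1"
  using ax_eps_one by (simp add: heps_def hone_def)

lemma antipode_left:
  assumes F: "flin d F" shows "SW h (\<lambda>x y. F (S x \<odot> y)) = eps h * F one"
proof (rule flin_eqI[where v=h and d=d])
  fix i assume i: "i < d"
  have "SW (bs i) (\<lambda>x y. F (S x \<odot> y)) = (\<Sum>a<d. \<Sum>b<d. hcomult H i a b * (\<Sum>l<d. (S (bs a) \<odot> bs b) l * F (bs l)))"
    unfolding Sw_bs[OF i] by (intro sum.cong refl arg_cong2[where f="(*)"] flinD[OF F])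
  also have "\<dots> = (\<Sum>a<d. \<Sum>b<d. \<Sum>l<d. hcomult H i a b * (\<Sum>r<d. hanti H a r * hmult H r b l) * F (bs l))"
    by (rule sum.cong[OF refl], rule sum.cong[OF refl], subst sum_distrib_left, rule sum.cong[OF refl])
       (simp add: hmul_bs_right hS_bs mult.assoc)
  also have "\<dots> = (\<Sum>a<d. \<Sum>l<d. \<Sum>b<d. hcomult H i a b * (\<Sum>r<d. hanti H a r * hmult H r b l) * F (bs l))"
    by (rule sum.cong[OF refl]) (rule sum.swap)
  also have "\<dots> = (\<Sum>l<d. (\<Sum>a<d. \<Sum>b<d. hcomult H i a b * (\<Sum>r<d. hanti H a r * hmult H r b l)) * F (bs l))"
    unfolding sum_distrib_right by (rule sum.swap)
  also have "\<dots> = (\<Sum>l<d. hcounit H i * hunit H l * F (bs l))"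
    using i by (intro sum.cong refl) (simp add: ax_antipode)
  also have "\<dots> = hcounit H i * (\<Sum>l<d. one l * F (bs l))"
    by (simp add: hone_def sum_distrib_left mult.assoc)
  finally show "SW (bs i) (\<lambda>x y. F (S x \<odot> y)) = eps (bs i) * F one"
    using flinD[OF F, of one] i by (simp add: heps_bs)
qed (intro lin F)+

lemma antipode_right:
  assumes F: "flin d F" shows "SW h (\<lambda>x y. F (x \<odot> S y)) = eps h * F one"
proof (rule flin_eqI[where v=h and d=d])
  fix i assume i: "i < d"
  have "SW (bs i) (\<lambda>x y. F (x \<odot> S y)) = (\<Sum>a<d. \<Sum>b<d. hcomult H i a b * (\<Sum>l<d. (bs a \<odot> S (bs b)) l * F (bs l)))"
    unfolding Sw_bs[OF i] by (intro sum.cong refl arg_cong2[where f="(*)"] flinD[OF F])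
  also have "\<dots> = (\<Sum>a<d. \<Sum>b<d. \<Sum>l<d. hcomult H i a b * (\<Sum>r<d. hanti H b r * hmult H a r l) * F (bs l))"
    by (rule sum.cong[OF refl], rule sum.cong[OF refl], subst sum_distrib_left, rule sum.cong[OF refl])
       (simp add: hmul_bs_left hS_bs mult.assoc)
  also have "\<dots> = (\<Sum>a<d. \<Sum>l<d. \<Sum>b<d. hcomult H i a b * (\<Sum>r<d. hanti H b r * hmult H a r l) * F (bs l))"
    by (rule sum.cong[OF refl]) (rule sum.swap)
  also have "\<dots> = (\<Sum>l<d. (\<Sum>a<d. \<Sum>b<d. hcomult H i a b * (\<Sum>r<d. hanti H b r * hmult H a r l)) * F (bs l))"
    unfolding sum_distrib_right by (rule sum.swap)
  also have "\<dots> = (\<Sum>l<d. hcounit H i * hunit H l * F (bs l))"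
    using i by (intro sum.cong refl) (simp add: ax_antipode)
  also have "\<dots> = hcounit H i * (\<Sum>l<d. one l * F (bs l))"
    by (simp add: hone_def sum_distrib_left mult.assoc)
  finally show "SW (bs i) (\<lambda>x y. F (x \<odot> S y)) = eps (bs i) * F one"
    using flinD[OF F, of one] i by (simp add: heps_bs)
qed (intro lin F)+

end

section \<open>Inverses of injective linear maps\<close>

definition trunc :: "nat \<Rightarrow> (nat \<Rightarrow> 'k::zero) \<Rightarrow> nat \<Rightarrow> 'k" where
  "trunc d v = (\<lambda>i. if i < d then v i else 0)"

lemma trunc_vecs [simp]: "trunc d v \<in> vecs d"
  by (simp add: trunc_def vecs_def)

lemma trunc_id: "v \<in> vecs d \<Longrightarrow> trunc d v = v"
  by (rule vecs_eqI[of _ d]) (auto simp: trunc_def vecs_def)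

lemma lop_trunc: "lop d (trunc d)"
  by (rule lmapI, rule vlinI, simp add: trunc_def flin_coord, rule trunc_vecs)

lemma lmap_trunc: "lmap d d' F \<Longrightarrow> F (trunc d v) = F v"
  by (rule ext, rule flin_cong, rule lmap_flin) (auto simp: trunc_def)

lemma linear_left_inverse:
  assumes F: "lmap d d' F" and inj: "\<And>v. v \<in> vecs d \<Longrightarrow> F v = (\<lambda>_. 0) \<Longrightarrow> v = (\<lambda>_. 0)"
  shows "\<exists>G. lmap d' d G \<and> (\<forall>v\<in>vecs d. G (F v) = v)"
proof -
  obtain r b \<kappa> where "r \<le> d'" and fr: "\<And>i. i < r \<Longrightarrow> b i \<in> range F"
    "\<And>i. i < r \<Longrightarrow> flin d' (\<kappa> i)"
    "\<And>i j. i < r \<Longrightarrow> j < r \<Longrightarrow> \<kappa> i (b j) = (if i = j then 1 else 0)"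
    "\<And>x i. x \<in> range F \<Longrightarrow> x i = (\<Sum>j<r. \<kappa> j x * b j i)"
    using frame_exists[OF subsp_lmap_range[OF F]] by blast
  have "\<forall>i. \<exists>c. i < r \<longrightarrow> c \<in> vecs d \<and> b i = F c"
  proof
    fix i
    show "\<exists>c. i < r \<longrightarrow> c \<in> vecs d \<and> b i = F c"
    proof (cases "i < r")
      case True
      then obtain v where "b i = F v" using fr(1) by blast
      then have "b i = F (trunc d v)" by (simp only: lmap_trunc[OF F])
      then show ?thesis using trunc_vecs by blast
    qed blast
  qed
  then obtain c where c: "\<And>i. i < r \<Longrightarrow> c i \<in> vecs d" "\<And>i. i < r \<Longrightarrow> b i = F (c i)"
    by metis
  define G where "G y = (\<lambda>k. \<Sum>j<r. \<kappa> j y * c j k)" for y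
  have G: "lmap d' d G" unfolding G_def
    by (rule lmapI, rule vlinI) (auto intro!: flin_sum flin_mult_right fr(2) vecs_sum c)
  have "G (F v) = v" if v: "v \<in> vecs d" for v
  proof -
    have "F (G (F v)) = (\<lambda>i. \<Sum>j<r. \<kappa> j (F v) * F (c j) i)"
      unfolding G_def by (rule lmap_sum[OF F])
    also have "\<dots> = F v"
      by (rule ext) (use fr(4)[of "F v" i for i] c(2) in simp)
    finally have FG: "F (G (F v)) = F v" .
    have "F (\<lambda>i. G (F v) i + (-1) * v i) = (\<lambda>i. F (G (F v)) i + F (\<lambda>i. (-1) * v i) i)"
      by (rule lmap_add[OF F])
    also have "\<dots> = (\<lambda>_. 0)" unfolding lmap_scale[OF F] FG by simp
    finally have "F (\<lambda>i. G (F v) i + (-1) * v i) = (\<lambda>_. 0)" .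
    moreover have "(\<lambda>i. G (F v) i + (-1) * v i) \<in> vecs d"
      using vecs_lin[OF lmapD(2)[OF G] v, of 1 "F v" "-1"] by simp
    ultimately have "(\<lambda>i. G (F v) i + (-1) * v i) = (\<lambda>_. 0)" using inj by blast
    then show ?thesis by (simp add: fun_eq_iff)
  qed
  then show ?thesis using G by blast
qed

text \<open>A left inverse \<open>G\<close> is also a right inverse: the identity minus FG is
  idempotent, and its trace is 0 because tr FG = tr GF.\<close>

lemma linear_inverse:
  fixes F :: "(nat \<Rightarrow> 'k::field_char_0) \<Rightarrow> nat \<Rightarrow> 'k"
  assumes F: "lop d F" and inj: "\<And>v. v \<in> vecs d \<Longrightarrow> F v = (\<lambda>_. 0) \<Longrightarrow> v = (\<lambda>_. 0)"
  shows "\<exists>G. lop d G \<and> (\<forall>v\<in>vecs d. G (F v) = v) \<and> (\<forall>v\<in>vecs d. F (G v) = v)"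
proof -
  obtain G where G: "lop d G" "\<And>v. v \<in> vecs d \<Longrightarrow> G (F v) = v"
    using linear_left_inverse[OF F inj] by blast
  \<comment> \<open>Arguments may have nonzero coordinates beyond \<open>d\<close>, so
    \<open>trunc d\<close> takes the place of the identity operator.\<close>
  define Q where "Q v = (\<lambda>i. 1 * trunc d v i + (-1) * F (G v) i)" for v
  have lQ: "lop d Q" unfolding Q_def by (rule lop_add[OF lop_trunc lmap_comp[OF F G(1)]])
  have FGt: "F (G (trunc d v)) = F (G v)" for v
    using lmap_trunc[of d d G v] G(1) by simp
  have tF: "trunc d (F v) = F v" for v by (rule trunc_id[OF lmapD(2)[OF F]])
  have QQ: "Q (Q v) = Q v" for v
    unfolding Q_def lmap_lin[OF lop_trunc] lmap_lin[OF lmap_comp[OF F G(1)]] FGt tF G(2)[OF lmapD(2)[OF G(1)]]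
    by (simp add: trunc_id)
  have "tr d (\<lambda>v. F (G v)) = tr d (\<lambda>v. G (F v))"
    by (rule tr_cyclic) (use F G lmapD in blast)+
  also have "\<dots> = tr d (trunc d)"
    by (rule tr_cong) (simp add: G(2) trunc_id)
  finally have "tr d Q = 0" unfolding Q_def tr_lin by simp
  then have Q0: "Q v = (\<lambda>_. 0)" for v by (rule lop_idempotent_trace_zero[OF lQ QQ])
  have "F (G v) = v" if "v \<in> vecs d" for v
    using Q0[of v] that unfolding Q_def by (simp add: trunc_id fun_eq_iff)
  then show ?thesis using G by blast
qed

lemma flin_Sw_vec:
  assumes F: "flin d F"
  shows "F (\<lambda>i. Sw H h (\<lambda>a b. V a b i)) = Sw H h (\<lambda>a b. F (V a b))"
proof -
  have "F (\<lambda>i. Sw H h (\<lambda>a b. V a b i)) = (\<Sum>i<d. Sw H h (\<lambda>a b. V a b i) * F (bs i))"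
    by (rule flinD[OF F])
  also have "\<dots> = Sw H h (\<lambda>a b. \<Sum>i<d. V a b i * F (bs i))"
    by (simp only: Sw_sum Sw_scale_right)
  also have "\<dots> = Sw H h (\<lambda>a b. F (V a b))"
    by (simp only: flinD[OF F, symmetric])
  finally show ?thesis .
qed

lemma vecs_eq_flinI:
  assumes "x \<in> vecs d" "y \<in> vecs d" "\<And>F. flin d F \<Longrightarrow> F x = F y"
  shows "x = y"
  by (rule vecs_eqI[OF assms(1,2)]) (rule assms(3)[OF flin_coord])

lemma vecs_Sw: "(\<And>a b. V a b \<in> vecs d) \<Longrightarrow> (\<lambda>i. Sw H h (\<lambda>a b. V a b i)) \<in> vecs d"
  unfolding vecs_def by (simp add: Sw_def)

section \<open>The antipode reverses products and coproducts\<close>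

context hopf
begin

lemma S_one: "S one = one"
proof (rule vecs_eq_flinI[of _ d])
  fix F :: "(nat \<Rightarrow> 'k) \<Rightarrow> 'k" assume F: "flin d F"
  have "F (S one \<odot> one) = SW one (\<lambda>x y. F (S x \<odot> y))"
    by (rule Sw_one[symmetric]) (intro lin flin_comp[OF F])+
  also have "\<dots> = eps one * F one" by (rule antipode_left[OF F])
  finally show "F (S one) = F one" by (simp add: one_right eps_one)
qed auto

lemma eps_S: "eps (S x) = eps x"
proof -
  have "eps (S x) = SW x (\<lambda>a b. eps (S a) * eps b)"
    by (rule counit_right'[symmetric]) (intro lin)
  also have "\<dots> = SW x (\<lambda>a b. eps (S a \<odot> b))" by (simp only: eps_mul)
  also have "\<dots> = eps x" by (subst antipode_left[of eps]) (simp_all add: flin_eps eps_one)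
  finally show ?thesis .
qed

text \<open>Both sides are convolution inverses of the multiplication map. \<open>?W\<close> is the
  triple convolution of S(h k), the product h k and S(k) S(h); collapsing its last two factors gives
  the left side, collapsing its first two the right side.\<close>

lemma S_mul: "S (h \<odot> k) = S k \<odot> S h"
proof (rule vecs_eq_flinI[of _ d])
  fix F :: "(nat \<Rightarrow> 'k) \<Rightarrow> 'k" assume F: "flin d F"
  let ?T = "\<lambda>x y1 y2 u v1 v2. F (S (x \<odot> u) \<odot> ((y1 \<odot> v1) \<odot> (S v2 \<odot> S y2)))"
  let ?W = "SW h (\<lambda>x y. SW y (\<lambda>y1 y2. SW k (\<lambda>u v. SW v (\<lambda>v1 v2. ?T x y1 y2 u v1 v2))))"
  have "SW v (\<lambda>v1 v2. ?T x y1 y2 u v1 v2) = F (S (x \<odot> u) \<odot> (y1 \<odot> S y2)) * eps v" for v x y1 y2 u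
    using antipode_right[of "\<lambda>z. F (S (x \<odot> u) \<odot> (y1 \<odot> (z \<odot> S y2)))" v]
    by (simp add: assoc one_left mult.commute lin flin_comp[OF F])
  then have "?W = SW h (\<lambda>x y. SW y (\<lambda>y1 y2. SW k (\<lambda>u v. F (S (x \<odot> u) \<odot> (y1 \<odot> S y2)) * eps v)))"
    by simp
  also have "\<dots> = SW h (\<lambda>x y. SW y (\<lambda>y1 y2. F (S (x \<odot> k) \<odot> (y1 \<odot> S y2))))"
    by (subst counit_right') (intro lin flin_comp[OF F], rule refl)
  also have "\<dots> = SW h (\<lambda>x y. F (S (x \<odot> k)) * eps y)"
  proof -
    have "SW y (\<lambda>y1 y2. F (S (x \<odot> k) \<odot> (y1 \<odot> S y2))) = F (S (x \<odot> k)) * eps y" for x y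
      using antipode_right[of "\<lambda>z. F (S (x \<odot> k) \<odot> z)" y]
      by (simp add: one_right mult.commute lin flin_comp[OF F])
    then show ?thesis by simp
  qed
  also have "\<dots> = F (S (h \<odot> k))"
    by (rule counit_right') (intro lin flin_comp[OF F])
  finally have 1: "?W = F (S (h \<odot> k))" .
  have "?W = SW h (\<lambda>x y2. SW x (\<lambda>x1 y1. SW k (\<lambda>u v. SW v (\<lambda>v1 v2. ?T x1 y1 y2 u v1 v2))))"
    by (rule coassoc[symmetric])
  also have "\<dots> = SW h (\<lambda>x y2. SW x (\<lambda>x1 y1. SW k (\<lambda>u v2. SW u (\<lambda>u1 v1. ?T x1 y1 y2 u1 v1 v2))))"
    by (simp only: coassoc)
  also have "\<dots> = SW h (\<lambda>x y2. SW k (\<lambda>u v2. SW x (\<lambda>x1 y1. SW u (\<lambda>u1 v1. ?T x1 y1 y2 u1 v1 v2))))"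
    by (subst Sw_swap) (rule refl)
  also have "\<dots> = SW h (\<lambda>x y2. SW k (\<lambda>u v2. (eps x * eps u) * F (S v2 \<odot> S y2)))"
  proof -
    have "SW x (\<lambda>x1 y1. SW u (\<lambda>u1 v1. ?T x1 y1 y2 u1 v1 v2)) = (eps x * eps u) * F (S v2 \<odot> S y2)" for x u y2 v2
    proof -
      have "SW x (\<lambda>x1 y1. SW u (\<lambda>u1 v1. ?T x1 y1 y2 u1 v1 v2)) = SW (x \<odot> u) (\<lambda>p q. F (S p \<odot> (q \<odot> (S v2 \<odot> S y2))))"
        by (rule Sw_mul[symmetric]) (intro lin flin_comp[OF F])+
      also have "\<dots> = eps (x \<odot> u) * F (one \<odot> (S v2 \<odot> S y2))"
        using antipode_left[of "\<lambda>z. F (z \<odot> (S v2 \<odot> S y2))" "x \<odot> u"]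
        by (simp add: assoc lin flin_comp[OF F])
      finally show ?thesis by (simp add: one_left eps_mul)
    qed
    then show ?thesis by simp
  qed
  also have "\<dots> = SW h (\<lambda>x y2. eps x * SW k (\<lambda>u v2. eps u * F (S v2 \<odot> S y2)))"
    by (simp only: Sw_scale mult.assoc)
  also have "\<dots> = SW h (\<lambda>x y2. eps x * F (S k \<odot> S y2))"
    by (subst counit_left) (intro lin flin_comp[OF F], rule refl)
  also have "\<dots> = F (S k \<odot> S h)"
    by (rule counit_left) (intro lin flin_comp[OF F])
  finally show "F (S (h \<odot> k)) = F (S k \<odot> S h)" using 1 by simp
qed auto

text \<open>This is \<open>S_mul\<close> for the dual Hopf algebra, read through the structure
  constants.\<close>

lemma Sw_S:
  assumes B: "\<And>y. flin d (\<lambda>x. B x y)" "\<And>x. flin d (B x)"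
  shows "SW (S h) B = SW h (\<lambda>x y. B (S y) (S x))"
proof -
  interpret D: hopf "hdual H" by unfold_locales (rule dual_hopf)
  have coord: "hDelta H (S h) a b = SW h (\<lambda>x y. S y a * S x b)" if ab: "a < d" "b < d" for a b
  proof (rule flin_eqI[where v=h and d=d])
    fix i assume i: "i < d"
    have "hDelta H (S (bs i)) a b = hS (hdual H) (hmul (hdual H) (bs a) (bs b)) i"
      using ab i by (simp add: hDelta_def hS_bs) (simp add: hS_def hmul_bs mult.commute)
    also have "\<dots> = hmul (hdual H) (hS (hdual H) (bs b)) (hS (hdual H) (bs a)) i"
      by (simp add: D.S_mul)
    also have "\<dots> = SW (bs i) (\<lambda>x y. S y a * S x b)"
      using ab i by (simp add: hmul_def Sw_bs hS_bs ac_simps)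
    finally show "hDelta H (S (bs i)) a b = SW (bs i) (\<lambda>x y. S y a * S x b)" .
  qed (intro lin flin_comp[OF flin_Delta])+
  have "SW (S h) B = (\<Sum>a<d. \<Sum>b<d. SW h (\<lambda>x y. S y a * S x b) * B (bs a) (bs b))"
    unfolding Sw_def[of H "S h" B] by (intro sum.cong refl) (simp add: coord)
  also have "\<dots> = SW h (\<lambda>x y. \<Sum>a<d. \<Sum>b<d. S y a * S x b * B (bs a) (bs b))"
    by (simp only: Sw_sum Sw_scale_right)
  also have "\<dots> = SW h (\<lambda>x y. B (S y) (S x))"
    by (simp only: bilin_expand[OF B, symmetric])
  finally show ?thesis .
qed

section \<open>Integrals\<close>

text \<open>Left integrals of the dual, characterised by x_1 lam(x_2) = lam(x) 1; this equation
  between vectors is tested with all functionals \<open>F\<close>.\<close>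

definition lint :: "((nat \<Rightarrow> 'k) \<Rightarrow> 'k) \<Rightarrow> bool" where
  "lint lam \<longleftrightarrow> flin d lam \<and> (\<forall>F x. flin d F \<longrightarrow> SW x (\<lambda>a b. F a * lam b) = lam x * F one)"

lemma lint_flin: "lint lam \<Longrightarrow> flin d lam" unfolding lint_def by blast

lemma lintD: "lint lam \<Longrightarrow> flin d F \<Longrightarrow> SW x (\<lambda>a b. F a * lam b) = lam x * F one"
  unfolding lint_def by blast

text \<open>The dual is a right Hopf module under (m h)(x) = m(x S(h)), and this is the
  compatibility of action and coaction. It holds because S(h_2) h_3 cancels on the right
  side.\<close>

lemma hopf_module_identity:
  assumes F: "flin d F" and m: "flin d m"
  shows "SW x (\<lambda>a b. F a * m (b \<odot> S h)) = SW h (\<lambda>h1 h2. SW (x \<odot> S h1) (\<lambda>p q. F (p \<odot> h2) * m q))"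
proof -
  note c = lin flin_comp[OF F] flin_comp[OF m]
  have "SW (x \<odot> S h1) (\<lambda>p q. F (p \<odot> h2) * m q)
     = SW x (\<lambda>a b. SW h1 (\<lambda>c1 c2. F ((a \<odot> S c2) \<odot> h2) * m (b \<odot> S c1)))" for h1 h2
  proof -
    have "SW (x \<odot> S h1) (\<lambda>p q. F (p \<odot> h2) * m q)
       = SW x (\<lambda>a b. SW (S h1) (\<lambda>u v. F ((a \<odot> u) \<odot> h2) * m (b \<odot> v)))"
      by (rule Sw_mul) (intro c)+
    also have "\<dots> = SW x (\<lambda>a b. SW h1 (\<lambda>c1 c2. F ((a \<odot> S c2) \<odot> h2) * m (b \<odot> S c1)))"
      by (rule Sw_cong, rule Sw_S) (intro c)+
    finally show ?thesis .
  qed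
  then have "SW h (\<lambda>h1 h2. SW (x \<odot> S h1) (\<lambda>p q. F (p \<odot> h2) * m q))
     = SW h (\<lambda>h1 h2. SW x (\<lambda>a b. SW h1 (\<lambda>c1 c2. F ((a \<odot> S c2) \<odot> h2) * m (b \<odot> S c1))))"
    by simp
  also have "\<dots> = SW x (\<lambda>a b. SW h (\<lambda>h1 h2. SW h1 (\<lambda>c1 c2. F ((a \<odot> S c2) \<odot> h2) * m (b \<odot> S c1))))"
    by (rule Sw_swap)
  also have "\<dots> = SW x (\<lambda>a b. SW h (\<lambda>c1 r. SW r (\<lambda>c2 h2. F (a \<odot> (S c2 \<odot> h2)) * m (b \<odot> S c1))))"
    by (simp only: coassoc assoc)
  also have "\<dots> = SW x (\<lambda>a b. SW h (\<lambda>c1 r. (F (a \<odot> one) * m (b \<odot> S c1)) * eps r))"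
  proof -
    have "SW r (\<lambda>c2 h2. F (a \<odot> (S c2 \<odot> h2)) * m (b \<odot> S c1)) = (F (a \<odot> one) * m (b \<odot> S c1)) * eps r" for a b c1 r
      using antipode_left[of "\<lambda>z. F (a \<odot> z) * m (b \<odot> S c1)" r] by (simp add: mult.commute c)
    then show ?thesis by simp
  qed
  also have "\<dots> = SW x (\<lambda>a b. F (a \<odot> one) * m (b \<odot> S h))"
    by (rule Sw_cong, rule counit_right') (intro c)
  also have "\<dots> = SW x (\<lambda>a b. F a * m (b \<odot> S h))"
    by (rule Sw_cong) (simp add: one_right)
  finally show ?thesis ..
qed

text \<open>The projection \<open>\<phi> \<mapsto> \<phi>\<^sub>0 \<cdot> S(\<phi>\<^sub>1)\<close> of the Hopf module \<open>H\<^sup>*\<close> onto its coinvariants.\<close>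

definition trint :: "((nat \<Rightarrow> 'k) \<Rightarrow> 'k) \<Rightarrow> (nat \<Rightarrow> 'k) \<Rightarrow> 'k" where
  "trint \<phi> x = (\<Sum>i<d. SW (x \<odot> S (S (bs i))) (\<lambda>p q. p i * \<phi> q))"

text \<open>In this Hopf module the coinvariants are the left integrals. The main move is to
  exchange the basis sum with the comultiplication: the sum over \<open>i\<close> of q_i Delta(bs i)
  is Delta(q). Afterwards the antipode axiom applies to neighbouring legs.\<close>

lemma trint_lint:
  assumes p: "flin d \<phi>" shows "lint (trint \<phi>)"
  unfolding lint_def
proof (intro conjI allI impI)
  show "flin d (trint \<phi>)" unfolding trint_def by (intro lin)
  fix F :: "(nat \<Rightarrow> 'k) \<Rightarrow> 'k" and x assume F: "flin d F"
  note c = lin flin_comp[OF F] flin_comp[OF p]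
  \<comment> \<open>Here \<open>p\<close>, \<open>s\<close>, \<open>t\<close>, \<open>q2\<close> are
    the four legs of the iterated coproduct of \<open>y\<close>, and the product y_1 S(y_2)
    cancels.\<close>
  have four: "SW y (\<lambda>p q. SW q (\<lambda>q1 q2. SW q1 (\<lambda>s t. F (p \<odot> S s) * t j * \<phi> q2))) = F one * SW y (\<lambda>t q2. t j * \<phi> q2)"
    if j: "j < d" for y j
  proof -
    have "SW y (\<lambda>p q. SW q (\<lambda>q1 q2. SW q1 (\<lambda>s t. F (p \<odot> S s) * t j * \<phi> q2)))
       = SW y (\<lambda>p q. SW q (\<lambda>s w. SW w (\<lambda>t q2. F (p \<odot> S s) * t j * \<phi> q2)))"
      by (simp only: coassoc)
    also have "\<dots> = SW y (\<lambda>r w. SW r (\<lambda>p s. SW w (\<lambda>t q2. F (p \<odot> S s) * t j * \<phi> q2)))"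
      by (rule coassoc[symmetric])
    also have "\<dots> = SW y (\<lambda>r w. SW r (\<lambda>p s. F (p \<odot> S s)) * SW w (\<lambda>t q2. t j * \<phi> q2))"
      by (simp only: Sw_scale Sw_scale_right mult.assoc)
    also have "\<dots> = SW y (\<lambda>r w. eps r * (F one * SW w (\<lambda>t q2. t j * \<phi> q2)))"
      by (simp only: antipode_right[OF F] mult.assoc)
    also have "\<dots> = F one * SW y (\<lambda>t q2. t j * \<phi> q2)"
      by (rule counit_left) (intro c)
    finally show ?thesis .
  qed
  have "SW x (\<lambda>a b. F a * trint \<phi> b) = (\<Sum>i<d. SW x (\<lambda>a b. F a * SW (b \<odot> S (S (bs i))) (\<lambda>p q. p i * \<phi> q)))"
    unfolding trint_def by (simp only: sum_distrib_left Sw_sum)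
  also have "\<dots> = (\<Sum>i<d. SW (bs i) (\<lambda>s t. SW (x \<odot> S (S t)) (\<lambda>p q. F (p \<odot> S s) * SW q (\<lambda>q1 q2. q1 i * \<phi> q2))))"
  proof (rule sum.cong[OF refl])
    fix i assume i: "i \<in> {..<d}"
    have "SW x (\<lambda>a b. F a * SW (b \<odot> S (S (bs i))) (\<lambda>p q. p i * \<phi> q))
       = SW (S (bs i)) (\<lambda>h1 h2. SW (x \<odot> S h1) (\<lambda>p q. F (p \<odot> h2) * SW q (\<lambda>p q. p i * \<phi> q)))"
      by (rule hopf_module_identity[OF F]) (intro c)
    also have "\<dots> = SW (bs i) (\<lambda>s t. SW (x \<odot> S (S t)) (\<lambda>p q. F (p \<odot> S s) * SW q (\<lambda>q1 q2. q1 i * \<phi> q2)))"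
      by (rule Sw_S) (intro c)+
    finally show "SW x (\<lambda>a b. F a * SW (b \<odot> S (S (bs i))) (\<lambda>p q. p i * \<phi> q)) =
       SW (bs i) (\<lambda>s t. SW (x \<odot> S (S t)) (\<lambda>p q. F (p \<odot> S s) * SW q (\<lambda>q1 q2. q1 i * \<phi> q2)))" .
  qed
  also have "\<dots> = (\<Sum>i<d. \<Sum>s<d. \<Sum>t<d. hcomult H i s t * SW (x \<odot> S (S (bs t))) (\<lambda>p q. F (p \<odot> S (bs s)) * SW q (\<lambda>q1 q2. q1 i * \<phi> q2)))"
    by (rule sum.cong[OF refl], rule Sw_bs) simp
  also have "\<dots> = (\<Sum>i<d. \<Sum>t<d. \<Sum>s<d. hcomult H i s t * SW (x \<odot> S (S (bs t))) (\<lambda>p q. F (p \<odot> S (bs s)) * SW q (\<lambda>q1 q2. q1 i * \<phi> q2)))"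
    by (rule sum.cong[OF refl], rule sum.swap)
  also have "\<dots> = (\<Sum>t<d. \<Sum>i<d. \<Sum>s<d. hcomult H i s t * SW (x \<odot> S (S (bs t))) (\<lambda>p q. F (p \<odot> S (bs s)) * SW q (\<lambda>q1 q2. q1 i * \<phi> q2)))"
    by (rule sum.swap)
  also have "\<dots> = (\<Sum>t<d. SW (x \<odot> S (S (bs t))) (\<lambda>p q. SW q (\<lambda>q1 q2. \<Sum>i<d. \<Sum>s<d. q1 i * hcomult H i s t * F (p \<odot> S (bs s)) * \<phi> q2)))"
    by (simp add: Sw_sum Sw_scale[symmetric] ac_simps)
  also have "\<dots> = (\<Sum>t<d. SW (x \<odot> S (S (bs t))) (\<lambda>p q. SW q (\<lambda>q1 q2. SW q1 (\<lambda>s t'. F (p \<odot> S s) * t' t * \<phi> q2))))"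
  proof (rule sum.cong[OF refl])
    fix t assume t: "t \<in> {..<d}"
    have "(\<Sum>i<d. \<Sum>s<d. q1 i * hcomult H i s t * F (p \<odot> S (bs s)) * \<phi> q2)
       = SW q1 (\<lambda>s t'. F (p \<odot> S s) * t' t * \<phi> q2)" for p q1 q2
    proof -
      have "(\<Sum>i<d. \<Sum>s<d. q1 i * hcomult H i s t * F (p \<odot> S (bs s)) * \<phi> q2)
         = (\<Sum>s<d. hDelta H q1 s t * (F (p \<odot> S (bs s)) * \<phi> q2))"
        using t by (subst sum.swap) (simp add: hDelta_def sum_distrib_right mult.assoc)
      also have "\<dots> = SW q1 (\<lambda>s t'. F (p \<odot> S s) * t' t * \<phi> q2)"
        unfolding Sw_def
      proof (rule sum.cong[OF refl])
        fix s
        show "hDelta H q1 s t * (F (p \<odot> S (bs s)) * \<phi> q2)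
            = (\<Sum>b<d. hDelta H q1 s b * (F (p \<odot> S (bs s)) * bs b t * \<phi> q2))"
          using t sum_bs2[where f="\<lambda>b. hDelta H q1 s b * (F (p \<odot> S (bs s)) * \<phi> q2)" and i=t and d=d]
          by (simp add: ac_simps)
      qed
      finally show ?thesis .
    qed
    then show "SW (x \<odot> S (S (bs t))) (\<lambda>p q. SW q (\<lambda>q1 q2. \<Sum>i<d. \<Sum>s<d. q1 i * hcomult H i s t * F (p \<odot> S (bs s)) * \<phi> q2)) = 
      SW (x \<odot> S (S (bs t))) (\<lambda>p q. SW q (\<lambda>q1 q2. SW q1 (\<lambda>s t'. F (p \<odot> S s) * t' t * \<phi> q2)))"
      by simp
  qed
  also have "\<dots> = (\<Sum>t<d. F one * SW (x \<odot> S (S (bs t))) (\<lambda>p q. p t * \<phi> q))"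
    by (rule sum.cong[OF refl], rule four) simp
  also have "\<dots> = trint \<phi> x * F one"
    unfolding trint_def by (simp add: sum_distrib_left mult.commute)
  finally show "SW x (\<lambda>a b. F a * trint \<phi> b) = trint \<phi> x * F one" .
qed

text \<open>The other half of the fundamental theorem of Hopf modules: a functional is recovered by
  letting the algebra act on projected coinvariants. If 0 were the only integral, every functional
  would vanish, in particular the counit.\<close>

lemma trint_reproduce:
  assumes p: "flin d \<phi>" and x: "x \<in> vecs d"
  shows "(\<Sum>i<d. trint (\<lambda>y. SW y (\<lambda>a b. a i * \<phi> b)) (x \<odot> S (bs i))) = \<phi> x"
proof -
  note c = lin flin_comp[OF p]
  define L where "L z j i = SW (x \<odot> S z) (\<lambda>p q. p j * SW q (\<lambda>q1 q2. q1 i * \<phi> q2))" for z j i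
  have fL: "flin d (\<lambda>z. L z j i)" for j i unfolding L_def by (intro c)
  have "(\<Sum>i<d. trint (\<lambda>y. SW y (\<lambda>a b. a i * \<phi> b)) (x \<odot> S (bs i))) = (\<Sum>i<d. \<Sum>j<d. L (S (bs j) \<odot> bs i) j i)"
    unfolding trint_def L_def by (simp add: assoc S_mul)
  also have "\<dots> = (\<Sum>i<d. \<Sum>j<d. \<Sum>r<d. (S (bs j) \<odot> bs i) r * L (bs r) j i)"
    by (rule sum.cong[OF refl], rule sum.cong[OF refl], rule flinD[OF fL])
  also have "\<dots> = (\<Sum>i<d. \<Sum>r<d. \<Sum>j<d. (S (bs j) \<odot> bs i) r * L (bs r) j i)"
    by (rule sum.cong[OF refl], rule sum.swap)
  also have "\<dots> = (\<Sum>r<d. \<Sum>i<d. \<Sum>j<d. (S (bs j) \<odot> bs i) r * L (bs r) j i)"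
    by (rule sum.swap)
  also have "\<dots> = (\<Sum>r<d. one r * \<phi> (x \<odot> S (bs r)))"
  proof (rule sum.cong[OF refl])
    fix r assume r: "r \<in> {..<d}"
    let ?y = "x \<odot> S (bs r)"
    have "(\<Sum>i<d. \<Sum>j<d. (S (bs j) \<odot> bs i) r * L (bs r) j i)
       = (\<Sum>j<d. \<Sum>i<d. (S (bs j) \<odot> bs i) r * L (bs r) j i)" by (rule sum.swap)
    also have "\<dots> = SW ?y (\<lambda>p q. SW q (\<lambda>q1 q2. (\<Sum>j<d. \<Sum>i<d. p j * q1 i * (S (bs j) \<odot> bs i) r) * \<phi> q2))"
      unfolding L_def sum_distrib_right Sw_sum
      by (rule sum.cong[OF refl], rule sum.cong[OF refl]) (simp add: Sw_scale[symmetric] ac_simps)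
    also have "\<dots> = SW ?y (\<lambda>p q. SW q (\<lambda>q1 q2. (S p \<odot> q1) r * \<phi> q2))"
      by (subst bilin_expand[where B="\<lambda>x y. (S x \<odot> y) r" and d=d]) (intro lin, intro lin, rule refl)
    also have "\<dots> = SW ?y (\<lambda>w q2. SW w (\<lambda>p q1. (S p \<odot> q1) r * \<phi> q2))"
      by (rule coassoc[symmetric])
    also have "\<dots> = SW ?y (\<lambda>w q2. eps w * (one r * \<phi> q2))"
      using antipode_left[of "\<lambda>z. z r"] r by (simp add: Sw_scale_right flin_coord mult.assoc)
    also have "\<dots> = one r * \<phi> ?y"
      by (rule counit_left) (intro lin p)
    finally show "(\<Sum>i<d. \<Sum>j<d. (S (bs j) \<odot> bs i) r * L (bs r) j i) = one r * \<phi> ?y" .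
  qed
  also have "\<dots> = \<phi> (x \<odot> S one)"
    by (rule flinD[symmetric, where F="\<lambda>z. \<phi> (x \<odot> S z)"]) (intro c)
  also have "\<dots> = \<phi> x" using x by (simp add: S_one one_right)
  finally show ?thesis .
qed

lemma lint_exists: "\<exists>lam x. lint lam \<and> lam x \<noteq> 0"
proof (rule ccontr)
  assume "\<not> ?thesis"
  then have z: "lint lam \<Longrightarrow> lam x = 0" for lam x by blast
  have "eps one = (\<Sum>i<d. trint (\<lambda>y. SW y (\<lambda>a b. a i * eps b)) (one \<odot> S (bs i)))"
    by (rule trint_reproduce[symmetric]) (auto intro: flin_eps)
  also have "\<dots> = 0"
    by (rule sum.neutral, rule ballI, rule z, rule trint_lint) (auto intro!: lin)
  finally show False using eps_one by simp
qed

end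

lemma zero_vecs [simp, intro]: "(\<lambda>_. 0) \<in> vecs d"
  by (simp add: vecs_def)

section \<open>Nondegeneracy of integrals and the Frobenius property\<close>

context hopf
begin

lemma flin_one_right:
  assumes F: "flin d F" shows "F (x \<odot> one) = F x"
proof (rule flin_cong[OF F])
  fix i assume "i < d"
  have "x \<odot> one = trunc d x \<odot> one"
    by (rule lmap_trunc[OF lop_mul_right, symmetric])
  also have "\<dots> = trunc d x" by (simp add: one_right)
  finally show "(x \<odot> one) i = x i" using \<open>i < d\<close> by (simp add: trunc_def)
qed

lemma lint_translate:
  assumes l: "lint lam" and F: "flin d F"
  shows "SW x (\<lambda>a b. F a * lam (b \<odot> S h)) = SW h (\<lambda>h1 h2. lam (x \<odot> S h1) * F h2)"
proof -
  have "SW (x \<odot> S h1) (\<lambda>p q. F (p \<odot> h2) * lam q) = lam (x \<odot> S h1) * F (one \<odot> h2)" for h1 h2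
    by (rule lintD[OF l]) (intro lin flin_comp[OF F])
  then have "SW x (\<lambda>a b. F a * lam (b \<odot> S h)) = SW h (\<lambda>h1 h2. lam (x \<odot> S h1) * F (one \<odot> h2))"
    unfolding hopf_module_identity[OF F lint_flin[OF l]] by simp
  also have "\<dots> = SW h (\<lambda>h1 h2. lam (x \<odot> S h1) * F h2)"
    by (rule Sw_cong) (simp add: one_left)
  finally show ?thesis .
qed

text \<open>By \<open>lint_translate\<close> the vectors \<open>h\<close> annihilated in this way
  are closed under h -> h_1 F(h_2). The counit vanishes on them: with x = x0 S(S(h_2)) the product
  h_1 S(h_2) appears inside \<open>S\<close> and leaves eps(h) lam(x0). Hence F(h) = eps(h_1) F(h_2)
  = 0.\<close>

lemma lint_nondeg_S:
  assumes l: "lint lam" and nz: "lam x0 \<noteq> 0" and h: "h \<in> vecs d" "\<And>x. lam (x \<odot> S h) = 0"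
  shows "h = (\<lambda>_. 0)"
proof -
  note c = lin flin_comp[OF lint_flin[OF l]]
  have shift: "SW h (\<lambda>h1 h2. lam (x \<odot> S h1) * F h2) = 0"
    if "\<And>x. lam (x \<odot> S h) = 0" "flin d F" for F h x
    using lint_translate[OF l that(2), of x h] that(1) by (simp add: Sw_zero)
  have eps0: "eps h = 0" if z: "\<And>x. lam (x \<odot> S h) = 0" for h
  proof -
    have "SW h (\<lambda>h1 h2. lam ((x0 \<odot> S (S h2)) \<odot> S h1)) = SW h (\<lambda>h1 h2. \<Sum>i<d. lam ((x0 \<odot> S (S (bs i))) \<odot> S h1) * h2 i)"
    proof (rule Sw_cong)
      fix h1 h2 :: "nat \<Rightarrow> 'k"
      show "lam ((x0 \<odot> S (S h2)) \<odot> S h1) = (\<Sum>i<d. lam ((x0 \<odot> S (S (bs i))) \<odot> S h1) * h2 i)"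
        unfolding mult.commute[of _ "h2 _"]
        by (rule flinD[where F="\<lambda>h2. lam ((x0 \<odot> S (S h2)) \<odot> S h1)"]) (intro c)
    qed
    also have "\<dots> = (\<Sum>i<d. SW h (\<lambda>h1 h2. lam ((x0 \<odot> S (S (bs i))) \<odot> S h1) * h2 i))"
      by (rule Sw_sum)
    also have "\<dots> = 0" by (rule sum.neutral, rule ballI, rule shift[OF z]) (simp add: flin_coord)
    finally have "SW h (\<lambda>h1 h2. lam (x0 \<odot> S (h1 \<odot> S h2))) = 0" by (simp only: S_mul assoc)
    moreover have "SW h (\<lambda>h1 h2. lam (x0 \<odot> S (h1 \<odot> S h2))) = eps h * lam (x0 \<odot> S one)"
      by (rule antipode_right) (intro c)
    moreover have "lam (x0 \<odot> S one) = lam x0"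
      unfolding S_one by (rule flin_one_right[OF lint_flin[OF l]])
    ultimately show ?thesis using nz by simp
  qed
  show ?thesis
  proof (rule vecs_eq_flinI[OF h(1)])
    show "(\<lambda>_. 0) \<in> vecs d" by (simp add: vecs_def)
    fix F :: "(nat \<Rightarrow> 'k) \<Rightarrow> 'k" assume F: "flin d F"
    let ?h = "\<lambda>i. SW h (\<lambda>a b. a i * F b)"
    have sc: "G (\<lambda>i. a i * c) = G a * c" if "flin d G" for G :: "(nat \<Rightarrow> 'k) \<Rightarrow> 'k" and a c
      using flin_scale[OF that, of c a] by (simp add: mult.commute)
    have app: "G ?h = SW h (\<lambda>a b. G a * F b)" if G: "flin d G" for G
      using flin_Sw_vec[OF G, of H h "\<lambda>a b i. a i * F b"] by (simp add: sc[OF G])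
    have "lam (x \<odot> S ?h) = 0" for x
    proof -
      have "lam (x \<odot> S ?h) = SW h (\<lambda>a b. lam (x \<odot> S a) * F b)"
        by (rule app) (intro c)
      then show ?thesis using shift[OF h(2) F] by simp
    qed
    then have "eps ?h = 0" by (rule eps0)
    then have "SW h (\<lambda>a b. eps a * F b) = 0" using app[OF flin_eps] by simp
    then show "F h = F (\<lambda>_. 0)" using counit_left[OF F] flin_zero[OF F] by simp
  qed
qed

lemma S_injective: "x \<in> vecs d \<Longrightarrow> S x = (\<lambda>_. 0) \<Longrightarrow> x = (\<lambda>_. 0)"
proof -
  assume x: "x \<in> vecs d" "S x = (\<lambda>_. 0)"
  obtain lam x0 where l: "lint lam" "lam x0 \<noteq> 0" using lint_exists by blast
  have "lam (y \<odot> S x) = 0" for y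
    unfolding x(2) by (rule flin_zero[of d "\<lambda>z. lam (y \<odot> z)"]) (intro lin flin_comp[OF lint_flin[OF l(1)]])
  then show ?thesis by (rule lint_nondeg_S[OF l x(1)])
qed

lemma S_inverse_exists:
  "\<exists>Si. lop d Si \<and> (\<forall>x\<in>vecs d. Si (S x) = x \<and> S (Si x) = x)"
  using linear_inverse[OF lop_S S_injective] by blast

text \<open>As \<open>S\<close> is bijective, nondegeneracy passes from the form lam(x S(h)) to
  lam(x h). An injective operator is surjective, so every functional is represented by some
  \<open>h\<close>; \<open>Lam\<close> is the vector representing the counit.\<close>

lemma integrals_exist:
  "\<exists>lam Lam. lint lam \<and> Lam \<in> vecs d \<and> (\<forall>x. lam (x \<odot> Lam) = eps x) \<and>
     (\<forall>h\<in>vecs d. (\<forall>x. lam (x \<odot> h) = 0) \<longrightarrow> h = (\<lambda>_. 0)) \<and>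
     (\<forall>F. flin d F \<longrightarrow> (\<exists>h\<in>vecs d. \<forall>x. F x = lam (x \<odot> h)))"
proof -
  obtain lam x0 where l: "lint lam" "lam x0 \<noteq> 0" using lint_exists by blast
  note c = lin flin_comp[OF lint_flin[OF l(1)]]
  obtain Si where Si: "lop d Si" "\<And>x. x \<in> vecs d \<Longrightarrow> Si (S x) = x" "\<And>x. x \<in> vecs d \<Longrightarrow> S (Si x) = x"
    using S_inverse_exists by blast
  have nd: "h = (\<lambda>_. 0)" if h: "h \<in> vecs d" "\<And>x. lam (x \<odot> h) = 0" for h
  proof -
    have "Si h = (\<lambda>_. 0)"
      by (rule lint_nondeg_S[OF l lmapD(2)[OF Si(1)]]) (simp add: Si(3) h)
    then have "S (Si h) = (\<lambda>_. 0)" using lmap_zero[OF lop_S] by simp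
    then show ?thesis using Si(3)[OF h(1)] by simp
  qed
  define B where "B h = (\<lambda>i. if i < d then lam (bs i \<odot> h) else 0)" for h
  have expand: "lam (x \<odot> h) = (\<Sum>i<d. x i * lam (bs i \<odot> h))" for x h
    by (rule flinD[where F="\<lambda>x. lam (x \<odot> h)"]) (intro c)
  have lB: "lop d B"
  proof (rule lmapI, rule vlinI)
    fix i assume "i < d"
    then show "flin d (\<lambda>v. B v i)" unfolding B_def by simp (intro c)
  qed (simp add: B_def vecs_def)
  have "h = (\<lambda>_. 0)" if "h \<in> vecs d" "B h = (\<lambda>_. 0)" for h
  proof (rule nd[OF that(1)])
    have "lam (bs i \<odot> h) = 0" if "i < d" for i
      using fun_cong[OF \<open>B h = (\<lambda>_. 0)\<close>, of i] that by (simp add: B_def)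
    then show "lam (x \<odot> h) = 0" for x unfolding expand[of x h] by simp
  qed
  from linear_inverse[OF lB this]
  obtain C where C: "lop d C" "\<And>v. v \<in> vecs d \<Longrightarrow> B (C v) = v" by blast
  have riesz: "\<exists>h\<in>vecs d. \<forall>x. F x = lam (x \<odot> h)" if F: "flin d F" for F
  proof -
    let ?v = "\<lambda>i. if i < d then F (bs i) else 0"
    have v: "?v \<in> vecs d" by (simp add: vecs_def)
    have "F x = lam (x \<odot> C ?v)" for x
    proof -
      have "lam (bs i \<odot> C ?v) = F (bs i)" if "i < d" for i
        using fun_cong[OF C(2)[OF v], of i] that unfolding B_def by simp
      then show ?thesis unfolding expand[of x "C ?v"] flinD[OF F, of x] by simp
    qed
    then show ?thesis using lmapD(2)[OF C(1)] by blast
  qed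
  obtain Lam where "Lam \<in> vecs d" "\<And>x. eps x = lam (x \<odot> Lam)" using riesz[OF flin_eps] by blast
  then have "\<forall>x. lam (x \<odot> Lam) = eps x" by simp
  moreover have "\<forall>h\<in>vecs d. (\<forall>x. lam (x \<odot> h) = 0) \<longrightarrow> h = (\<lambda>_. 0)" using nd by simp
  moreover have "\<forall>F. flin d F \<longrightarrow> (\<exists>h\<in>vecs d. \<forall>x. F x = lam (x \<odot> h))" by (intro allI impI riesz)
  ultimately show ?thesis using l(1) \<open>Lam \<in> vecs d\<close> by (intro exI[of _ lam] exI[of _ Lam] conjI)
qed

end

text \<open>\<open>lam\<close> makes the algebra a Frobenius algebra. Taking for \<open>Lam\<close>
  the vector that represents the counit turns it into a left integral with lam(Lam) = 1.\<close>

locale hopf_int = hopf H for H :: "'k::field_char_0 hopf_data" +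
  fixes lam :: "(nat \<Rightarrow> 'k) \<Rightarrow> 'k" and Lam :: "nat \<Rightarrow> 'k"
  assumes lam: "lint lam"
    and Lam_vecs: "Lam \<in> vecs d"
    and lam_Lam: "lam (x \<odot> Lam) = eps x"
    and nondeg: "h \<in> vecs d \<Longrightarrow> (\<And>x. lam (x \<odot> h) = 0) \<Longrightarrow> h = (\<lambda>_. 0)"
    and riesz: "flin d F \<Longrightarrow> \<exists>h\<in>vecs d. \<forall>x. F x = lam (x \<odot> h)"

context hopf
begin

lemma hopf_int_exists: "\<exists>lam Lam. hopf_int H lam Lam"
proof -
  obtain lam Lam where *: "lint lam" "Lam \<in> vecs d" "\<forall>x. lam (x \<odot> Lam) = eps x"
     "\<forall>h\<in>vecs d. (\<forall>x. lam (x \<odot> h) = 0) \<longrightarrow> h = (\<lambda>_. 0)"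
     "\<forall>F. flin d F \<longrightarrow> (\<exists>h\<in>vecs d. \<forall>x. F x = lam (x \<odot> h))"
    using integrals_exist by (elim exE conjE)
  have "hopf_int H lam Lam"
    by unfold_locales (use * in simp_all)
  then show ?thesis by blast
qed

end

context hopf_int
begin

lemma flam: "flin d lam" by (rule lint_flin[OF lam])

lemmas lc = lin flin_comp[OF flam]

lemma nondeg_eq:
  assumes "x \<in> vecs d" "y \<in> vecs d" "\<And>z. lam (z \<odot> x) = lam (z \<odot> y)"
  shows "x = y"
proof -
  have "(\<lambda>i. 1 * x i + (-1) * y i) = (\<lambda>_. 0)"
  proof (rule nondeg[OF vecs_lin[OF assms(1,2)]])
    fix z
    have f: "flin d (\<lambda>x. lam (z \<odot> x))" by (intro lc)
    show "lam (z \<odot> (\<lambda>i. 1 * x i + (-1) * y i)) = 0"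
      using flin_add[OF f, of "\<lambda>i. 1 * x i" "\<lambda>i. (-1) * y i"] flin_scale[OF f, of 1 x] flin_scale[OF f, of "-1" y]
      assms(3)[of z] by simp
  qed
  then show ?thesis by (simp add: fun_eq_iff)
qed

lemma mul_scale_right: "x \<odot> (\<lambda>i. c * y i) = (\<lambda>i. c * (x \<odot> y) i)"
  by (rule lmap_scale[OF lop_mul_left])

lemma mul_scale_left: "(\<lambda>i. c * x i) \<odot> y = (\<lambda>i. c * (x \<odot> y) i)"
  by (rule lmap_scale[OF lop_mul_right])

lemma lam_scale: "lam (\<lambda>i. c * y i) = c * lam y"
  by (rule flin_scale[OF flam])

lemma Lam_left: "x \<odot> Lam = (\<lambda>i. eps x * Lam i)"
proof (rule nondeg_eq)
  show "(\<lambda>i. eps x * Lam i) \<in> vecs d" using Lam_vecs by (simp add: vecs_def)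
  show "lam (z \<odot> (x \<odot> Lam)) = lam (z \<odot> (\<lambda>i. eps x * Lam i))" for z
    unfolding mul_scale_right lam_scale assoc[symmetric] lam_Lam eps_mul by simp
qed simp

lemma lam_one: "lam Lam = 1"
  using lam_Lam[of one] Lam_vecs by (simp add: one_left eps_one)

lemma left_integral_unique:
  assumes "L \<in> vecs d" "\<And>x. x \<odot> L = (\<lambda>i. eps x * L i)"
  shows "L = (\<lambda>i. lam L * Lam i)"
proof (rule nondeg_eq[OF assms(1)])
  show "(\<lambda>i. lam L * Lam i) \<in> vecs d" using Lam_vecs by (simp add: vecs_def)
  show "lam (z \<odot> L) = lam (z \<odot> (\<lambda>i. lam L * Lam i))" for z
    unfolding assms(2) mul_scale_right lam_scale lam_Lam by simp
qed

text \<open>The distinguished character: Lam x is again a left integral, hence a multiple of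
  \<open>Lam\<close>, and \<open>lam\<close> reads off the factor.\<close>

definition alpha :: "(nat \<Rightarrow> 'k) \<Rightarrow> 'k" where "alpha x = lam (Lam \<odot> x)"

lemma flin_alpha: "flin d alpha"
  unfolding alpha_def by (intro lc)

lemma Lam_right: "Lam \<odot> x = (\<lambda>i. alpha x * Lam i)"
  unfolding alpha_def
  by (rule left_integral_unique) (simp_all add: assoc[symmetric] Lam_left mul_scale_left)

lemma alpha_mul: "alpha (x \<odot> y) = alpha x * alpha y"
proof -
  have "alpha (x \<odot> y) = lam ((Lam \<odot> x) \<odot> y)" by (simp add: alpha_def assoc)
  also have "\<dots> = alpha x * alpha y" by (simp add: Lam_right mul_scale_left lam_scale lam_one)
  finally show ?thesis .
qed

lemma alpha_one: "alpha one = 1"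
  by (simp add: alpha_def one_right Lam_vecs lam_one)

text \<open>The integral property of a product gives y_1 b_1 l(y_2 b_2) = l(y b) 1. With x and y the
  two legs of \<open>a\<close>, multiplication by S(x) from the left cancels S(a_1) a_2 and leaves
  b_1 l(a b_2).\<close>

lemma lint_exchange:
  assumes l: "lint l" and F: "flin d F"
  shows "SW b (\<lambda>x y. F x * l (a \<odot> y)) = SW a (\<lambda>x y. F (S x) * l (y \<odot> b))"
proof -
  note c = lin flin_comp[OF F] flin_comp[OF lint_flin[OF l]]
  have i: "F (S x) * l (y \<odot> b) = SW y (\<lambda>y1 y2. SW b (\<lambda>b1 b2. F (S x \<odot> (y1 \<odot> b1)) * l (y2 \<odot> b2)))" for x y
  proof -
    have "SW (y \<odot> b) (\<lambda>p q. F (S x \<odot> p) * l q) = l (y \<odot> b) * F (S x \<odot> one)"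
      by (rule lintD[OF l]) (intro c)
    then have "F (S x) * l (y \<odot> b) = SW (y \<odot> b) (\<lambda>p q. F (S x \<odot> p) * l q)"
      by (simp add: one_right mult.commute)
    also have "\<dots> = SW y (\<lambda>y1 y2. SW b (\<lambda>b1 b2. F (S x \<odot> (y1 \<odot> b1)) * l (y2 \<odot> b2)))"
      by (rule Sw_mul) (intro c)+
    finally show ?thesis .
  qed
  have "SW a (\<lambda>x y. F (S x) * l (y \<odot> b))
     = SW a (\<lambda>x y. SW y (\<lambda>y1 y2. SW b (\<lambda>b1 b2. F (S x \<odot> (y1 \<odot> b1)) * l (y2 \<odot> b2))))"
    by (rule Sw_cong) (rule i)
  also have "\<dots> = SW a (\<lambda>w y2. SW w (\<lambda>x y1. SW b (\<lambda>b1 b2. F (S x \<odot> (y1 \<odot> b1)) * l (y2 \<odot> b2))))"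
    by (rule coassoc[symmetric])
  also have "\<dots> = SW a (\<lambda>w y2. SW b (\<lambda>b1 b2. SW w (\<lambda>x y1. F (S x \<odot> (y1 \<odot> b1)) * l (y2 \<odot> b2))))"
    by (rule Sw_cong) (rule Sw_swap)
  also have "\<dots> = SW a (\<lambda>w y2. SW b (\<lambda>b1 b2. eps w * (F b1 * l (y2 \<odot> b2))))"
  proof (rule Sw_cong, rule Sw_cong)
    fix w y2 b1 b2 :: "nat \<Rightarrow> 'k" assume b1: "b1 \<in> vecs d"
    have "SW w (\<lambda>x y1. F ((S x \<odot> y1) \<odot> b1) * l (y2 \<odot> b2)) = eps w * (F (one \<odot> b1) * l (y2 \<odot> b2))"
      by (rule antipode_left) (intro c)
    then show "SW w (\<lambda>x y1. F (S x \<odot> (y1 \<odot> b1)) * l (y2 \<odot> b2)) = eps w * (F b1 * l (y2 \<odot> b2))"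
      using b1 by (simp add: assoc one_left)
  qed
  also have "\<dots> = SW a (\<lambda>w y2. eps w * SW b (\<lambda>b1 b2. F b1 * l (y2 \<odot> b2)))"
    by (simp only: Sw_scale)
  also have "\<dots> = SW b (\<lambda>x y. F x * l (a \<odot> y))"
    by (rule counit_left) (intro c)
  finally show ?thesis ..
qed

lemma lint_Lam:
  assumes l: "lint l" and F: "flin d F"
  shows "SW Lam (\<lambda>x y. F x * l (a \<odot> y)) = l Lam * F (S a)"
proof -
  have "SW Lam (\<lambda>x y. F x * l (a \<odot> y)) = SW a (\<lambda>x y. F (S x) * l (y \<odot> Lam))"
    by (rule lint_exchange[OF l F])
  also have "\<dots> = SW a (\<lambda>x y. (l Lam * F (S x)) * eps y)"
    by (rule Sw_cong) (simp add: Lam_left flin_scale[OF lint_flin[OF l]])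
  also have "\<dots> = l Lam * F (S a)"
    by (rule counit_right') (intro lin flin_comp[OF F])
  finally show ?thesis .
qed

text \<open>The antipode as S(a) = Lam_1 lam(a Lam_2), a dual-basis formula that gives access to
  traces of operators containing \<open>S\<close>.\<close>

lemma S_via_Lam: "flin d F \<Longrightarrow> F (S a) = SW Lam (\<lambda>x y. F x * lam (a \<odot> y))"
  using lint_Lam[OF lam, of F a] lam_one by simp

lemma riesz_left:
  assumes F: "flin d F" shows "\<exists>h\<in>vecs d. \<forall>x. F x = lam (h \<odot> x)"
proof -
  define B where "B h = (\<lambda>i. if i < d then lam (h \<odot> bs i) else 0)" for h
  have expand: "lam (h \<odot> x) = (\<Sum>i<d. x i * lam (h \<odot> bs i))" for x h
    by (rule flinD[where F="\<lambda>x. lam (h \<odot> x)"]) (intro lc)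
  have lB: "lop d B"
  proof (rule lmapI, rule vlinI)
    fix i assume "i < d"
    then show "flin d (\<lambda>v. B v i)" unfolding B_def by simp (intro lc)
  qed (simp add: B_def vecs_def)
  have "h = (\<lambda>_. 0)" if "h \<in> vecs d" "B h = (\<lambda>_. 0)" for h
  proof (rule vecs_eq_flinI[OF that(1)])
    have "lam (h \<odot> bs i) = 0" if "i < d" for i
      using fun_cong[OF \<open>B h = (\<lambda>_. 0)\<close>, of i] that by (simp add: B_def)
    then have 0: "lam (h \<odot> x) = 0" for x unfolding expand[of h x] by simp
    fix G :: "(nat \<Rightarrow> 'k) \<Rightarrow> 'k" assume G: "flin d G"
    then obtain y where "\<And>x. G x = lam (x \<odot> y)" using riesz by blast
    then show "G h = G (\<lambda>_. 0)" using 0 flin_zero[OF G] by simp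
  qed (simp add: vecs_def)
  from linear_inverse[OF lB this]
  obtain C where C: "lop d C" "\<And>v. v \<in> vecs d \<Longrightarrow> B (C v) = v" by blast
  let ?v = "\<lambda>i. if i < d then F (bs i) else 0"
  have v: "?v \<in> vecs d" by (simp add: vecs_def)
  have "F x = lam (C ?v \<odot> x)" for x
  proof -
    have "lam (C ?v \<odot> bs i) = F (bs i)" if "i < d" for i
      using fun_cong[OF C(2)[OF v], of i] that unfolding B_def by simp
    then show ?thesis unfolding expand[of "C ?v" x] flinD[OF F, of x] by simp
  qed
  then show ?thesis using lmapD(2)[OF C(1)] by blast
qed

text \<open>The difference \<open>N\<close> of the two sides is an integral that kills
  \<open>Lam\<close>. Written as lam(h x), it forces S(h) = 0 by \<open>S_via_Lam\<close> and
  \<open>lint_Lam\<close>, and \<open>S\<close> is injective.\<close>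

lemma lint_unique:
  assumes l: "lint l" shows "l x = l Lam * lam x"
proof -
  define N where "N x = l x - l Lam * lam x" for x
  have fN: "flin d N" unfolding N_def by (intro lin lint_flin[OF l] flam)
  obtain h where h: "h \<in> vecs d" "\<And>x. N x = lam (h \<odot> x)" using riesz_left[OF fN] by blast
  have "S h = (\<lambda>_. 0)"
  proof (rule vecs_eq_flinI[of _ d])
    fix F :: "(nat \<Rightarrow> 'k) \<Rightarrow> 'k" assume F: "flin d F"
    have "F (S h) = SW Lam (\<lambda>x y. F x * lam (h \<odot> y))" by (rule S_via_Lam[OF F])
    also have "\<dots> = SW Lam (\<lambda>x y. F x * l (one \<odot> y) - l Lam * (F x * lam (one \<odot> y)))"
      unfolding h(2)[symmetric] N_def by (rule Sw_cong) (simp add: one_left algebra_simps)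
    also have "\<dots> = 0"
      unfolding Sw_diff Sw_scale lint_Lam[OF l F] lint_Lam[OF lam F] by (simp add: lam_one)
    finally show "F (S h) = F (\<lambda>_. 0)" using flin_zero[OF F] by simp
  qed auto
  then have "h = (\<lambda>_. 0)" using S_injective h(1) by blast
  then have "N x = 0" unfolding h(2)
    by (simp add: flin_zero[of d "\<lambda>h. lam (h \<odot> x)"] lc)
  then show ?thesis unfolding N_def by simp
qed

text \<open>The distinguished group-like element, determined by lam(x_1) x_2 = lam(x) gr (see
  \<open>lint_right\<close>); the choice x = Lam isolates it, since lam(Lam) = 1.\<close>

definition gr :: "nat \<Rightarrow> 'k" where "gr = (\<lambda>i. SW Lam (\<lambda>x y. lam x * y i))"

lemma flin_gr: 
  assumes F: "flin d F" shows "F gr = SW Lam (\<lambda>x y. lam x * F y)"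
  using flin_Sw_vec[OF F, of H Lam "\<lambda>x y i. lam x * y i"] by (simp add: gr_def flin_scale[OF F])

text \<open>The functional x -> lam(x_1) F(x_2) is again a left integral, so it is a multiple of
  \<open>lam\<close>.\<close>

lemma lint_right:
  assumes F: "flin d F"
  shows "SW x (\<lambda>a b. lam a * F b) = lam x * F gr"
proof -
  note c = lin flin_comp[OF F] flam F
  define l where "l x = SW x (\<lambda>a b. lam a * F b)" for x
  have "lint l"
    unfolding lint_def
  proof (intro conjI allI impI)
    show "flin d l" unfolding l_def by (intro lin)
    fix G :: "(nat \<Rightarrow> 'k) \<Rightarrow> 'k" and x assume G: "flin d G"
    have "SW x (\<lambda>a b. G a * l b) = SW x (\<lambda>a b. SW b (\<lambda>b1 b2. G a * lam b1 * F b2))"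
      unfolding l_def by (simp only: Sw_scale mult.assoc)
    also have "\<dots> = SW x (\<lambda>w b2. SW w (\<lambda>a b1. G a * lam b1 * F b2))"
      by (rule coassoc[symmetric])
    also have "\<dots> = SW x (\<lambda>w b2. (lam w * G one) * F b2)"
      by (simp only: Sw_scale_right lintD[OF lam G])
    also have "\<dots> = l x * G one"
      unfolding l_def Sw_scale_right[symmetric] by (simp add: ac_simps)
    finally show "SW x (\<lambda>a b. G a * l b) = l x * G one" .
  qed
  then have "l x = l Lam * lam x" by (rule lint_unique)
  then show ?thesis unfolding l_def flin_gr[OF F] by simp
qed

lemma gr_vecs: "gr \<in> vecs d"
  by (auto simp: gr_def vecs_def Sw_def bs_def intro!: sum.neutral)

end

section \<open>Group-like elements: inverses, products and powers\<close>

definition grouplike :: "'k::field hopf_data \<Rightarrow> (nat \<Rightarrow> 'k) \<Rightarrow> bool" where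
  "grouplike H g \<longleftrightarrow> g \<in> vecs (hdim H) \<and> heps H g = 1 \<and>
     (\<forall>a<hdim H. \<forall>b<hdim H. hDelta H g a b = g a * g b)"

definition gpow :: "'k::field hopf_data \<Rightarrow> (nat \<Rightarrow> 'k) \<Rightarrow> nat \<Rightarrow> nat \<Rightarrow> 'k" where
  "gpow H g n = (hmul H g ^^ n) (hone H)"

context hopf
begin

lemma grouplikeD: "grouplike H g \<Longrightarrow> g \<in> vecs d" "grouplike H g \<Longrightarrow> eps g = 1"
  unfolding grouplike_def by auto

lemma Sw_grouplike:
  assumes g: "grouplike H g" and B: "\<And>y. flin d (\<lambda>x. B x y)" "\<And>x. flin d (B x)"
  shows "SW g B = B g g"
proof -
  have "SW g B = (\<Sum>a<d. \<Sum>b<d. g a * g b * B (bs a) (bs b))"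
    unfolding Sw_def by (intro sum.cong refl) (use g in \<open>simp add: grouplike_def\<close>)
  also have "\<dots> = B g g" by (rule bilin_expand[OF B, symmetric])
  finally show ?thesis .
qed

lemma hDelta_Sw: "a < d \<Longrightarrow> b < d \<Longrightarrow> hDelta H y a b = SW y (\<lambda>u v. u a * v b)"
  unfolding Sw_def by (simp add: mult.assoc[symmetric])

lemma grouplikeI:
  assumes "g \<in> vecs d" "eps g = 1" "\<And>a b. a < d \<Longrightarrow> b < d \<Longrightarrow> SW g (\<lambda>u v. u a * v b) = g a * g b"
  shows "grouplike H g"
  unfolding grouplike_def using assms by (auto simp: hDelta_Sw)

lemma grouplike_inv:
  assumes g: "grouplike H g"
  shows "g \<odot> S g = one" "S g \<odot> g = one"
proof -
  show "g \<odot> S g = one"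
  proof (rule vecs_eq_flinI[of _ d])
    fix F :: "(nat \<Rightarrow> 'k) \<Rightarrow> 'k" assume F: "flin d F"
    have "F (g \<odot> S g) = SW g (\<lambda>x y. F (x \<odot> S y))"
      by (rule Sw_grouplike[OF g, symmetric]) (intro lin flin_comp[OF F])+
    then show "F (g \<odot> S g) = F one" using antipode_right[OF F, of g] grouplikeD[OF g] by simp
  qed auto
  show "S g \<odot> g = one"
  proof (rule vecs_eq_flinI[of _ d])
    fix F :: "(nat \<Rightarrow> 'k) \<Rightarrow> 'k" assume F: "flin d F"
    have "F (S g \<odot> g) = SW g (\<lambda>x y. F (S x \<odot> y))"
      by (rule Sw_grouplike[OF g, symmetric]) (intro lin flin_comp[OF F])+
    then show "F (S g \<odot> g) = F one" using antipode_left[OF F, of g] grouplikeD[OF g] by simp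
  qed auto
qed

lemma grouplike_S:
  assumes g: "grouplike H g" shows "grouplike H (S g)"
proof (rule grouplikeI)
  fix a b assume ab: "a < d" "b < d"
  have "SW (S g) (\<lambda>u v. u a * v b) = SW g (\<lambda>u v. S v a * S u b)"
    by (rule Sw_S) (intro lin ab)+
  also have "\<dots> = S g a * S g b"
    by (rule Sw_grouplike[OF g]) (intro lin ab)+
  finally show "SW (S g) (\<lambda>u v. u a * v b) = S g a * S g b" .
qed (simp_all add: eps_S grouplikeD[OF g])

lemma grouplike_mul:
  assumes g: "grouplike H g" and h: "grouplike H h" shows "grouplike H (g \<odot> h)"
proof (rule grouplikeI)
  fix a b assume ab: "a < d" "b < d"
  have "SW (g \<odot> h) (\<lambda>u v. u a * v b) = SW g (\<lambda>p q. SW h (\<lambda>u v. (p \<odot> u) a * (q \<odot> v) b))"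
    by (rule Sw_mul) (intro lin ab)+
  also have "\<dots> = SW h (\<lambda>u v. (g \<odot> u) a * (g \<odot> v) b)"
    by (rule Sw_grouplike[OF g]) (intro lin ab)+
  also have "\<dots> = (g \<odot> h) a * (g \<odot> h) b"
    by (rule Sw_grouplike[OF h]) (intro lin ab)+
  finally show "SW (g \<odot> h) (\<lambda>u v. u a * v b) = (g \<odot> h) a * (g \<odot> h) b" .
qed (simp_all add: eps_mul grouplikeD[OF g] grouplikeD[OF h])

lemma grouplike_one: "grouplike H one"
proof (rule grouplikeI)
  fix a b assume ab: "a < d" "b < d"
  show "SW one (\<lambda>u v. u a * v b) = one a * one b"
    by (rule Sw_one) (intro lin ab)+
qed (simp_all add: eps_one)

lemma gpow_0 [simp]: "gpow H g 0 = one" and gpow_Suc: "gpow H g (Suc n) = g \<odot> gpow H g n"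
  by (simp_all add: gpow_def)

lemma gpow_vecs [simp]: "gpow H g n \<in> vecs d"
  by (cases n) (simp_all add: gpow_Suc)

lemma gpow_add: "gpow H g (m + n) = gpow H g m \<odot> gpow H g n"
  by (induction m) (simp_all add: gpow_Suc assoc one_left)

lemma gpow_1: "g \<in> vecs d \<Longrightarrow> gpow H g 1 = g"
  by (simp add: gpow_Suc one_right)

lemma gpow_Suc2: "g \<in> vecs d \<Longrightarrow> gpow H g (Suc n) = gpow H g n \<odot> g"
  using gpow_add[of g n 1] gpow_1[of g] by simp

lemma gpow_mult: "gpow H g (m * n) = gpow H (gpow H g m) n"
  by (induction n) (simp_all add: gpow_add gpow_Suc)

lemma gpow_one [simp]: "gpow H one n = one"
  by (induction n) (simp_all add: gpow_Suc one_left)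

lemma grouplike_gpow: "grouplike H g \<Longrightarrow> grouplike H (gpow H g n)"
  by (induction n) (simp_all add: gpow_Suc grouplike_one grouplike_mul)

lemma S_S_grouplike:
  assumes g: "grouplike H g" shows "S (S g) = g"
proof -
  have "S (S g) = (g \<odot> S g) \<odot> S (S g)" by (simp add: grouplike_inv[OF g] one_left)
  also have "\<dots> = g" by (simp add: assoc grouplike_inv[OF grouplike_S[OF g]] one_right grouplikeD[OF g])
  finally show ?thesis .
qed

lemma Sw_S_S:
  assumes B: "\<And>y. flin d (\<lambda>x. B x y)" "\<And>x. flin d (B x)"
  shows "SW (S (S h)) B = SW h (\<lambda>x y. B (S (S x)) (S (S y)))"
proof -
  have "SW (S (S h)) B = SW (S h) (\<lambda>x y. B (S y) (S x))" by (rule Sw_S[OF B])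
  also have "\<dots> = SW h (\<lambda>x y. B (S (S x)) (S (S y)))"
    by (rule Sw_S) (intro lin flin_comp[OF B(1)] flin_comp[OF B(2)])+
  finally show ?thesis .
qed

end

section \<open>Radford's formula for the fourth power of the antipode\<close>

context hopf_int
begin

lemma gr_grouplike: "grouplike H gr"
proof (rule grouplikeI[OF gr_vecs])
  have "eps gr = SW Lam (\<lambda>x y. lam x * eps y)" by (rule flin_gr[OF flin_eps])
  also have "\<dots> = 1" using counit_right'[OF flam] lam_one by simp
  finally show "eps gr = 1" .
  fix a b assume ab: "a < d" "b < d"
  have "SW gr (\<lambda>u v. u a * v b) = SW Lam (\<lambda>x y. lam x * SW y (\<lambda>u v. u a * v b))"
    by (rule flin_gr[where F="\<lambda>z. SW z (\<lambda>u v. u a * v b)"]) (intro lin)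
  also have "\<dots> = SW Lam (\<lambda>x y. SW y (\<lambda>u v. lam x * u a * v b))"
    by (simp only: Sw_scale mult.assoc)
  also have "\<dots> = SW Lam (\<lambda>w v. SW w (\<lambda>x u. lam x * u a * v b))"
    by (rule coassoc[symmetric])
  also have "\<dots> = SW Lam (\<lambda>w v. (lam w * gr a) * v b)"
    by (simp only: Sw_scale_right lint_right[OF flin_coord[OF ab(1)]])
  also have "\<dots> = gr a * SW Lam (\<lambda>w v. lam w * v b)"
    by (simp only: Sw_scale[symmetric] mult.assoc mult.left_commute)
  also have "\<dots> = gr a * gr b" by (simp add: gr_def)
  finally show "SW gr (\<lambda>u v. u a * v b) = gr a * gr b" .
qed

text \<open>The mirror image of \<open>lint_exchange\<close>: now \<open>lint_right\<close> is
  applied to the product, which brings in \<open>gr\<close>, and b_2 S(b_3) cancels.\<close>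

lemma lint_exchange':
  assumes F: "flin d F"
  shows "SW a (\<lambda>x y. lam (x \<odot> b) * F y) = SW b (\<lambda>x y. lam (a \<odot> x) * F (gr \<odot> S y))"
proof -
  note c = lc flin_comp[OF F] F
  have i: "lam (a \<odot> x) * F (gr \<odot> S y) = SW a (\<lambda>a1 a2. SW x (\<lambda>x1 x2. lam (a1 \<odot> x1) * F ((a2 \<odot> x2) \<odot> S y)))" for x y
  proof -
    have "SW (a \<odot> x) (\<lambda>p q. lam p * F (q \<odot> S y)) = lam (a \<odot> x) * F (gr \<odot> S y)"
      by (rule lint_right) (intro c)
    moreover have "SW (a \<odot> x) (\<lambda>p q. lam p * F (q \<odot> S y)) = SW a (\<lambda>a1 a2. SW x (\<lambda>x1 x2. lam (a1 \<odot> x1) * F ((a2 \<odot> x2) \<odot> S y)))"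
      by (rule Sw_mul) (intro c)+
    ultimately show ?thesis by simp
  qed
  have "SW b (\<lambda>x y. lam (a \<odot> x) * F (gr \<odot> S y))
     = SW b (\<lambda>x y. SW a (\<lambda>a1 a2. SW x (\<lambda>x1 x2. lam (a1 \<odot> x1) * F ((a2 \<odot> x2) \<odot> S y))))"
    by (simp only: i)
  also have "\<dots> = SW a (\<lambda>a1 a2. SW b (\<lambda>x y. SW x (\<lambda>x1 x2. lam (a1 \<odot> x1) * F (a2 \<odot> (x2 \<odot> S y)))))"
    unfolding assoc by (rule Sw_swap)
  also have "\<dots> = SW a (\<lambda>a1 a2. SW b (\<lambda>x1 w. SW w (\<lambda>x2 y. lam (a1 \<odot> x1) * F (a2 \<odot> (x2 \<odot> S y)))))"
    by (simp only: coassoc)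
  also have "\<dots> = SW a (\<lambda>a1 a2. SW b (\<lambda>x1 w. eps w * (lam (a1 \<odot> x1) * F a2)))"
  proof (rule Sw_cong, rule Sw_cong)
    fix a1 a2 x1 w :: "nat \<Rightarrow> 'k" assume a2: "a2 \<in> vecs d"
    have "SW w (\<lambda>x2 y. lam (a1 \<odot> x1) * F (a2 \<odot> (x2 \<odot> S y))) = eps w * (lam (a1 \<odot> x1) * F (a2 \<odot> one))"
      by (rule antipode_right) (intro c)
    then show "SW w (\<lambda>x2 y. lam (a1 \<odot> x1) * F (a2 \<odot> (x2 \<odot> S y))) = eps w * (lam (a1 \<odot> x1) * F a2)"
      using a2 by (simp add: one_right)
  qed
  also have "\<dots> = SW a (\<lambda>a1 a2. lam (a1 \<odot> b) * F a2)"
    by (rule Sw_cong) (rule counit_right, intro c)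
  finally show ?thesis ..
qed

text \<open>\<open>X\<close> and \<open>Z\<close> are the two actions of the distinguished character
  on the algebra, transposes of the multiplications by it in the dual; \<open>C\<close> is
  conjugation by \<open>gr\<close>, whose inverse is S(gr). In these terms Radford's formula is an
  identity of operators, and orders can be compared.\<close>

definition T where "T x = S (S x)" for x
definition X where "X h = (\<lambda>i. SW h (\<lambda>a b. alpha a * b i))" for h
definition Z where "Z h = (\<lambda>i. SW h (\<lambda>a b. alpha b * a i))" for h
definition C where "C a = S gr \<odot> (a \<odot> gr)" for a

lemma flin_X: "flin d F \<Longrightarrow> F (X h) = SW h (\<lambda>a b. alpha a * F b)"
  using flin_Sw_vec[of d F H h "\<lambda>a b i. alpha a * b i"] by (simp add: X_def flin_scale)

lemma flin_Z: "flin d F \<Longrightarrow> F (Z h) = SW h (\<lambda>a b. alpha b * F a)"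
  using flin_Sw_vec[of d F H h "\<lambda>a b i. alpha b * a i"] by (simp add: Z_def flin_scale)

lemma X_vecs [simp]: "X h \<in> vecs d"
  by (auto simp: X_def vecs_def Sw_def bs_def intro!: sum.neutral)

lemma Z_vecs [simp]: "Z h \<in> vecs d"
  by (auto simp: Z_def vecs_def Sw_def bs_def intro!: sum.neutral)

lemma T_vecs [simp]: "T h \<in> vecs d" and C_vecs [simp]: "C h \<in> vecs d"
  by (simp_all add: T_def C_def)

text \<open>Both \<open>alpha\<close> and its composite with the squared antipode are convolution
  inverse to the composite of \<open>alpha\<close> with \<open>S\<close>.\<close>

lemma alpha_S_S: "alpha (S (S x)) = alpha x"
proof -
  note c = lin flin_comp[OF flin_alpha]
  have "alpha (S (S x)) = SW x (\<lambda>p q. alpha (S (S p)) * eps q)"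
    by (rule counit_right'[symmetric]) (intro c)
  also have "\<dots> = SW x (\<lambda>p q. SW q (\<lambda>u v. alpha (S (S p)) * alpha (S u) * alpha v))"
  proof (rule Sw_cong)
    fix p q :: "nat \<Rightarrow> 'k"
    have "SW q (\<lambda>u v. alpha (S u \<odot> v)) = eps q"
      using antipode_left[OF flin_alpha] by (simp add: alpha_one)
    then show "alpha (S (S p)) * eps q = SW q (\<lambda>u v. alpha (S (S p)) * alpha (S u) * alpha v)"
      by (simp add: alpha_mul Sw_scale mult.assoc)
  qed
  also have "\<dots> = SW x (\<lambda>q v. SW q (\<lambda>p u. alpha (S (S p)) * alpha (S u) * alpha v))"
    by (rule coassoc[symmetric])
  also have "\<dots> = SW x (\<lambda>q v. SW q (\<lambda>p u. alpha (S (S p \<odot> u))) * alpha v)"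
  proof -
    have "alpha (S (S p)) * alpha (S u) = alpha (S (S p \<odot> u))" for p u
      by (simp add: S_mul alpha_mul mult.commute)
    then show ?thesis by (simp only: Sw_scale_right)
  qed
  also have "\<dots> = SW x (\<lambda>q v. eps q * alpha v)"
    using antipode_left[of "\<lambda>z. alpha (S z)"] by (simp add: c S_one alpha_one)
  also have "\<dots> = alpha x" by (rule counit_left[OF flin_alpha])
  finally show ?thesis .
qed

lemma X_T: "X (T h) = T (X h)"
proof (rule vecs_eq_flinI[of _ d])
  fix F :: "(nat \<Rightarrow> 'k) \<Rightarrow> 'k" assume F: "flin d F"
  note c = lin flin_comp[OF F] flin_comp[OF flin_alpha] flin_alpha F
  have "F (X (T h)) = SW (T h) (\<lambda>a b. alpha a * F b)" by (rule flin_X[OF F])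
  also have "\<dots> = SW h (\<lambda>a b. alpha (S (S a)) * F (S (S b)))"
    unfolding T_def by (rule Sw_S_S) (intro c)+
  also have "\<dots> = SW h (\<lambda>a b. alpha a * F (T b))" by (simp only: alpha_S_S T_def)
  also have "\<dots> = F (T (X h))"
    by (rule flin_X[symmetric, where F="\<lambda>z. F (T z)"]) (unfold T_def, intro c)
  finally show "F (X (T h)) = F (T (X h))" .
qed simp_all

lemma Z_T: "Z (T h) = T (Z h)"
proof (rule vecs_eq_flinI[of _ d])
  fix F :: "(nat \<Rightarrow> 'k) \<Rightarrow> 'k" assume F: "flin d F"
  note c = lin flin_comp[OF F] flin_comp[OF flin_alpha] flin_alpha F
  have "F (Z (T h)) = SW (T h) (\<lambda>a b. alpha b * F a)" by (rule flin_Z[OF F])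
  also have "\<dots> = SW h (\<lambda>a b. alpha (S (S b)) * F (S (S a)))"
    unfolding T_def by (rule Sw_S_S) (intro c)+
  also have "\<dots> = SW h (\<lambda>a b. alpha b * F (T a))" by (simp only: alpha_S_S T_def)
  also have "\<dots> = F (T (Z h))"
    by (rule flin_Z[symmetric, where F="\<lambda>z. F (T z)"]) (unfold T_def, intro c)
  finally show "F (Z (T h)) = F (T (Z h))" .
qed simp_all

lemma X_Z: "X (Z h) = Z (X h)"
proof (rule vecs_eq_flinI[of _ d])
  fix F :: "(nat \<Rightarrow> 'k) \<Rightarrow> 'k" assume F: "flin d F"
  note c = lin flin_comp[OF F] flin_comp[OF flin_alpha] flin_alpha F
  have "F (X (Z h)) = SW h (\<lambda>a b. alpha b * SW a (\<lambda>u v. alpha u * F v))"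
    unfolding flin_X[OF F] by (rule flin_Z) (intro c)
  also have "\<dots> = SW h (\<lambda>a b. SW a (\<lambda>u v. alpha u * (alpha b * F v)))"
    by (simp only: Sw_scale[symmetric] mult.left_commute)
  also have "\<dots> = SW h (\<lambda>u w. SW w (\<lambda>v b. alpha u * (alpha b * F v)))" by (rule coassoc)
  also have "\<dots> = SW h (\<lambda>u w. alpha u * SW w (\<lambda>v b. alpha b * F v))" by (simp only: Sw_scale)
  also have "\<dots> = F (Z (X h))"
    unfolding flin_Z[OF F] by (rule flin_X[symmetric]) (intro c)
  finally show "F (X (Z h)) = F (Z (X h))" .
qed simp_all

lemma Z_C: "Z (C a) = C (Z a)"
proof (rule vecs_eq_flinI[of _ d])
  fix F :: "(nat \<Rightarrow> 'k) \<Rightarrow> 'k" assume F: "flin d F"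
  note c = lin flin_comp[OF F] flin_comp[OF flin_alpha] flin_alpha F
  note g = gr_grouplike
  have "F (Z (C a)) = SW (S gr \<odot> (a \<odot> gr)) (\<lambda>x y. alpha y * F x)" unfolding C_def by (rule flin_Z[OF F])
  also have "\<dots> = SW (S gr) (\<lambda>p q. SW (a \<odot> gr) (\<lambda>x y. alpha (q \<odot> y) * F (p \<odot> x)))"
    by (rule Sw_mul) (intro c)+
  also have "\<dots> = SW (a \<odot> gr) (\<lambda>x y. alpha (S gr \<odot> y) * F (S gr \<odot> x))"
    by (rule Sw_grouplike[OF grouplike_S[OF g]]) (intro c)+
  also have "\<dots> = SW a (\<lambda>p q. SW gr (\<lambda>x y. alpha (S gr \<odot> (q \<odot> y)) * F (S gr \<odot> (p \<odot> x))))"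
    by (rule Sw_mul) (intro c)+
  also have "\<dots> = SW a (\<lambda>p q. alpha (S gr \<odot> (q \<odot> gr)) * F (S gr \<odot> (p \<odot> gr)))"
    by (rule Sw_cong, rule Sw_grouplike[OF g]) (intro c)+
  also have "\<dots> = SW a (\<lambda>p q. alpha q * F (C p))"
  proof -
    have "alpha (S gr) * alpha gr = 1"
      using alpha_mul[of "S gr" gr] grouplike_inv(2)[OF g] alpha_one by simp
    then have "alpha (S gr \<odot> (q \<odot> gr)) = alpha q" for q
      by (simp add: alpha_mul mult.left_commute[of _ "alpha q"])
    then show ?thesis unfolding C_def by simp
  qed
  also have "\<dots> = F (C (Z a))"
    by (rule flin_Z[symmetric, where F="\<lambda>z. F (C z)"]) (unfold C_def, intro c)
  finally show "F (Z (C a)) = F (C (Z a))" .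
qed simp_all

text \<open>Comparing two expressions for the Nakayama automorphism of the Frobenius form \<open>lam\<close>.\<close>

lemma radford: "X (T (T a)) = Z (C a)"
proof -
  have "flin d (\<lambda>b. lam (a \<odot> b))" by (intro lc)
  \<comment> \<open>\<open>n\<close> is the value at \<open>a\<close> of the Nakayama automorphism;
    claim 1 relates it to \<open>a\<close> by \<open>lint_exchange\<close>, claim 2 by
    \<open>lint_exchange'\<close>.\<close>
  then obtain n where n: "n \<in> vecs d" "\<And>b. lam (a \<odot> b) = lam (b \<odot> n)" using riesz by blast
  have 1: "T a = Z n"
  proof (rule vecs_eq_flinI[of _ d])
    fix F :: "(nat \<Rightarrow> 'k) \<Rightarrow> 'k" assume F: "flin d F"
    have FS: "flin d (\<lambda>x. F (S x))" by (intro lin flin_comp[OF F])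
    have "F (T a) = SW Lam (\<lambda>x y. F (S x) * lam (y \<odot> n))"
      unfolding T_def using S_via_Lam[OF FS, of a] by (simp add: n(2))
    also have "\<dots> = SW n (\<lambda>x y. F x * lam (Lam \<odot> y))"
      by (rule lint_exchange[OF lam F, symmetric])
    also have "\<dots> = F (Z n)" unfolding flin_Z[OF F] by (simp add: alpha_def mult.commute)
    finally show "F (T a) = F (Z n)" .
  qed simp_all
  have 2: "C a = T (X n)"
  proof (rule vecs_eq_flinI[of _ d])
    fix F :: "(nat \<Rightarrow> 'k) \<Rightarrow> 'k" assume F: "flin d F"
    note c = lin flin_comp[OF F]
    have fl: "flin d (\<lambda>z. F (S gr \<odot> ((gr \<odot> S z) \<odot> gr)))" by (intro c)
    have e: "SW a (\<lambda>x y. eps x * F (C y)) = F (C a)"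
      unfolding C_def by (rule counit_left) (intro c)
    have "F (C a) = SW Lam (\<lambda>x y. lam (a \<odot> x) * F (C (gr \<odot> S y)))"
      using lint_exchange'[of "\<lambda>z. F (C z)" a Lam] e unfolding lam_Lam
      by (simp add: C_def c)
    also have "\<dots> = SW Lam (\<lambda>x y. lam (x \<odot> n) * F (C (gr \<odot> S y)))" by (simp only: n(2))
    also have "\<dots> = SW n (\<lambda>x y. lam (Lam \<odot> x) * F (C (gr \<odot> S (gr \<odot> S y))))"
      by (rule lint_exchange'[where F="\<lambda>y. F (C (gr \<odot> S y))"]) (unfold C_def, intro c)
    also have "\<dots> = SW n (\<lambda>x y. alpha x * F (T y))"
    proof -
      have "C (gr \<odot> S (gr \<odot> S y)) = T y" for y
      proof -
        have "C (gr \<odot> S (gr \<odot> S y)) = (S gr \<odot> gr) \<odot> (T y \<odot> (S gr \<odot> gr))"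
          by (simp only: C_def S_mul T_def assoc)
        then show ?thesis by (simp add: grouplike_inv[OF gr_grouplike] one_left one_right)
      qed
      then show ?thesis by (simp add: alpha_def)
    qed
    also have "\<dots> = F (T (X n))"
      by (rule flin_X[symmetric, where F="\<lambda>z. F (T z)"]) (unfold T_def, intro c)
    finally show "F (C a) = F (T (X n))" .
  qed simp_all
  \<comment> \<open>\<open>X\<close>, \<open>Z\<close> and \<open>T\<close> commute, so applying X T
    to claim 1 produces Z T X of \<open>n\<close>, and claim 2 eliminates \<open>n\<close>.\<close>
  have "X (T (T a)) = X (Z (T n))" by (simp add: 1 Z_T)
  also have "\<dots> = Z (C a)" by (simp add: X_Z X_T 2)
  finally show ?thesis .
qed

text \<open>\<open>X\<close> commutes with \<open>T\<close> and \<open>Z\<close> with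
  \<open>C\<close>, so iterating \<open>radford\<close> gives X^n T^(2n) = Z^n C^n. The factor 2
  comes from the square of \<open>T\<close> in the formula.\<close>

lemma radford_order:
  assumes X: "\<And>a. a \<in> vecs d \<Longrightarrow> (X ^^ N) a = a" and Z: "\<And>a. a \<in> vecs d \<Longrightarrow> (Z ^^ N) a = a"
    and C: "\<And>a. a \<in> vecs d \<Longrightarrow> (C ^^ N) a = a" and a: "a \<in> vecs d"
  shows "(T ^^ (2 * N)) a = a"
proof -
  have v: "(T ^^ n) a \<in> vecs d" "(C ^^ n) a \<in> vecs d" for n using a by (cases n; simp)+
  have XT: "X ((T ^^ n) b) = (T ^^ n) (X b)" for n b by (induction n) (simp_all add: X_T)
  have CZ: "Z ((C ^^ n) b) = (C ^^ n) (Z b)" for n b by (induction n) (simp_all add: Z_C)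
  have CZZ: "(Z ^^ m) ((C ^^ n) b) = (C ^^ n) ((Z ^^ m) b)" for m n b by (induction m) (simp_all add: CZ)
  have "(X ^^ n) ((T ^^ (2 * n)) a) = (Z ^^ n) ((C ^^ n) a)" for n
  proof (induction n)
    case (Suc n)
    have XTn: "(X ^^ n) ((T ^^ m) b) = (T ^^ m) ((X ^^ n) b)" for m b
      by (induction n) (simp_all add: XT)
    have "(X ^^ Suc n) ((T ^^ (2 * Suc n)) a) = X (T (T ((X ^^ n) ((T ^^ (2 * n)) a))))"
      using XTn[of 1] by simp
    also have "\<dots> = Z (C ((Z ^^ n) ((C ^^ n) a)))" by (simp only: Suc radford)
    also have "\<dots> = (Z ^^ Suc n) ((C ^^ Suc n) a)"
      using CZZ[of n 1 "(C ^^ n) a"] by simp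
    finally show ?case .
  qed simp
  from this[of N] show ?thesis using X[OF v(1)] Z[OF a] C[OF a] by simp
qed

text \<open>From gr C(a) = a gr follows gr^n C^n(a) = a gr^n.\<close>

lemma C_power:
  assumes g: "gpow H gr N = one" and a: "a \<in> vecs d"
  shows "(C ^^ N) a = a"
proof -
  have gC: "gr \<odot> C b = b \<odot> gr" for b
    unfolding C_def by (simp add: assoc[symmetric] grouplike_inv[OF gr_grouplike]) (simp add: assoc one_left)
  have "gpow H gr n \<odot> (C ^^ n) a = a \<odot> gpow H gr n" for n
  proof (induction n)
    case 0 then show ?case using a by (simp add: one_left one_right)
  next
    case (Suc n)
    have "gpow H gr (Suc n) \<odot> (C ^^ Suc n) a = gpow H gr n \<odot> (gr \<odot> C ((C ^^ n) a))"
      by (simp add: gpow_Suc2 gr_vecs assoc)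
    also have "\<dots> = (gpow H gr n \<odot> (C ^^ n) a) \<odot> gr" by (simp only: gC assoc)
    also have "\<dots> = a \<odot> gpow H gr (Suc n)" by (simp only: Suc assoc gpow_Suc2[OF gr_vecs])
    finally show ?case .
  qed
  from this[of N] show ?thesis using a g by (cases N) (simp_all add: one_left one_right)
qed

text \<open>Insert \<open>S_via_Lam\<close> at the basis vectors; summing the diagonal entries
  reassembles the vector F(x) inside \<open>lam\<close>.\<close>

lemma trace_S:
  assumes F: "lop d F"
  shows "tr d (\<lambda>v. F (S v)) = SW Lam (\<lambda>x y. lam (F x \<odot> y))"
proof -
  have "tr d (\<lambda>v. F (S v)) = (\<Sum>i<d. SW Lam (\<lambda>x y. F x i * lam (bs i \<odot> y)))"
    unfolding tr_def by (rule sum.cong[OF refl], rule S_via_Lam, rule lmap_flin[OF F])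
  also have "\<dots> = SW Lam (\<lambda>x y. \<Sum>i<d. F x i * lam (bs i \<odot> y))"
    by (rule Sw_sum[symmetric])
  also have "\<dots> = SW Lam (\<lambda>x y. lam (F x \<odot> y))"
    by (rule Sw_cong, rule flinD[symmetric, where F="\<lambda>z. lam (z \<odot> y)" for y]) (intro lc)
  finally show ?thesis .
qed

text \<open>Radford's trace formula: in \<open>trace_S\<close> the product S(Lam_1) Lam_2 collapses
  to eps(Lam).\<close>

lemma trace_mul_S_S: "tr d (\<lambda>v. x \<odot> S (S v)) = eps Lam * lam x"
proof -
  have "tr d (\<lambda>v. x \<odot> S (S v)) = SW Lam (\<lambda>p q. lam ((x \<odot> S p) \<odot> q))"
    by (rule trace_S[where F="\<lambda>z. x \<odot> S z"]) (rule lmap_comp[OF lop_mul_left lop_S])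
  also have "\<dots> = SW Lam (\<lambda>p q. lam (x \<odot> (S p \<odot> q)))" by (simp only: assoc)
  also have "\<dots> = eps Lam * lam (x \<odot> one)" by (rule antipode_left) (intro lc)
  finally show ?thesis by (simp add: flin_one_right[OF flam])
qed

end

section \<open>Semisimplicity and normalised integrals\<close>

context hopf
begin

definition nint :: "(nat \<Rightarrow> 'k) \<Rightarrow> bool" where
  "nint e \<longleftrightarrow> e \<in> vecs d \<and> eps e = 1 \<and> (\<forall>x. x \<odot> e = (\<lambda>i. eps x * e i) \<and> e \<odot> x = (\<lambda>i. eps x * e i))"

lemma nintD: assumes "nint e"
  shows "e \<in> vecs d" "eps e = 1" "x \<odot> e = (\<lambda>i. eps x * e i)" "e \<odot> x = (\<lambda>i. eps x * e i)"
  using assms unfolding nint_def by blast+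

lemma Sw_arg_scale: "SW (\<lambda>i. c * x i) B = c * SW x B"
  by (rule flin_scale[of d]) (intro lin)

text \<open>S(e_1) tensor e_2 is a Casimir element: \<open>x\<close> can be moved from the left of
  one leg to the right of the other. Replace \<open>e\<close> times a counit by e x_2, expand the
  coproduct, and cancel x_1 S(x_2).\<close>

lemma nint_move_right:
  assumes e: "nint e" and B: "\<And>y. flin d (\<lambda>x. B x y)" "\<And>x. flin d (B x)"
  shows "SW e (\<lambda>a b. B (x \<odot> S a) b) = SW e (\<lambda>a b. B (S a) (b \<odot> x))"
proof -
  note c = lin flin_comp[OF B(1)] flin_comp[OF B(2)] B
  have "SW e (\<lambda>a b. B (x \<odot> S a) b) = SW x (\<lambda>x1 w. SW e (\<lambda>a b. B (x1 \<odot> S a) b) * eps w)"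
    by (rule counit_right'[symmetric]) (intro c)
  also have "\<dots> = SW x (\<lambda>x1 w. SW (e \<odot> w) (\<lambda>p q. B (x1 \<odot> S p) q))"
    by (rule Sw_cong) (simp add: nintD(4)[OF e] Sw_arg_scale)
  also have "\<dots> = SW x (\<lambda>x1 w. SW e (\<lambda>a b. SW w (\<lambda>x2 x3. B (x1 \<odot> S (a \<odot> x2)) (b \<odot> x3))))"
    by (rule Sw_cong, rule Sw_mul) (intro c)+
  also have "\<dots> = SW e (\<lambda>a b. SW x (\<lambda>x1 w. SW w (\<lambda>x2 x3. B (x1 \<odot> (S x2 \<odot> S a)) (b \<odot> x3))))"
    unfolding S_mul by (rule Sw_swap)
  also have "\<dots> = SW e (\<lambda>a b. SW x (\<lambda>r x3. SW r (\<lambda>x1 x2. B ((x1 \<odot> S x2) \<odot> S a) (b \<odot> x3))))"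
    by (simp only: coassoc assoc)
  also have "\<dots> = SW e (\<lambda>a b. SW x (\<lambda>r x3. eps r * B (S a) (b \<odot> x3)))"
  proof -
    have "SW r (\<lambda>x1 x2. B ((x1 \<odot> S x2) \<odot> S a) (b \<odot> x3)) = eps r * B (S a) (b \<odot> x3)" for r a b x3
      using antipode_right[of "\<lambda>z. B (z \<odot> S a) (b \<odot> x3)" r] by (simp add: c one_left)
    then show ?thesis by simp
  qed
  also have "\<dots> = SW e (\<lambda>a b. B (S a) (b \<odot> x))"
    by (rule Sw_cong, rule counit_left) (intro c)
  finally show ?thesis .
qed

lemma nint_move_left:
  assumes e: "nint e" and B: "\<And>y. flin d (\<lambda>x. B x y)" "\<And>x. flin d (B x)"
  shows "SW e (\<lambda>a b. B a (S b \<odot> x)) = SW e (\<lambda>a b. B (x \<odot> a) (S b))"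
proof -
  note c = lin flin_comp[OF B(1)] flin_comp[OF B(2)] B
  have "SW e (\<lambda>a b. B a (S b \<odot> x)) = SW x (\<lambda>w x3. eps w * SW e (\<lambda>a b. B a (S b \<odot> x3)))"
    by (rule counit_left[symmetric]) (intro c)
  also have "\<dots> = SW x (\<lambda>w x3. SW (w \<odot> e) (\<lambda>p q. B p (S q \<odot> x3)))"
    by (simp only: nintD(3)[OF e] Sw_arg_scale)
  also have "\<dots> = SW x (\<lambda>w x3. SW w (\<lambda>x1 x2. SW e (\<lambda>a b. B (x1 \<odot> a) (S (x2 \<odot> b) \<odot> x3))))"
    by (rule Sw_cong, rule Sw_mul) (intro c)+
  also have "\<dots> = SW x (\<lambda>x1 w. SW w (\<lambda>x2 x3. SW e (\<lambda>a b. B (x1 \<odot> a) (S b \<odot> (S x2 \<odot> x3)))))"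
    unfolding S_mul assoc by (rule coassoc)
  also have "\<dots> = SW x (\<lambda>x1 w. eps w * SW e (\<lambda>a b. B (x1 \<odot> a) (S b)))"
  proof -
    have "SW w (\<lambda>x2 x3. SW e (\<lambda>a b. B (x1 \<odot> a) (S b \<odot> (S x2 \<odot> x3)))) = eps w * SW e (\<lambda>a b. B (x1 \<odot> a) (S b))" for w x1
      using antipode_left[of "\<lambda>z. SW e (\<lambda>a b. B (x1 \<odot> a) (S b \<odot> z))" w] by (simp add: c one_right)
    then show ?thesis by simp
  qed
  also have "\<dots> = SW e (\<lambda>a b. B (x \<odot> a) (S b))"
    by (rule counit_right) (intro c)
  finally show ?thesis .
qed

text \<open>Maschke's argument: a linear projection \<open>P\<close> onto the right ideal
  \<open>J\<close>, averaged over \<open>e\<close>, becomes a module map onto \<open>J\<close>, and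
  \<open>q\<close> is its value at the unit. That a right ideal is generated by an idempotent is the
  form of semisimplicity used later on.\<close>

lemma maschke_right:
  assumes e: "nint e" and J: "subsp d J" and id: "\<And>x y. x \<in> J \<Longrightarrow> x \<odot> y \<in> J"
  shows "\<exists>q\<in>J. \<forall>x\<in>J. q \<odot> x = x"
proof -
  obtain r b \<kappa> where "r \<le> d" and fr: "\<And>i. i < r \<Longrightarrow> b i \<in> J"
    "\<And>i. i < r \<Longrightarrow> flin d (\<kappa> i)"
    "\<And>i j. i < r \<Longrightarrow> j < r \<Longrightarrow> \<kappa> i (b j) = (if i = j then 1 else 0)"
    "\<And>x i. x \<in> J \<Longrightarrow> x i = (\<Sum>j<r. \<kappa> j x * b j i)"
    using frame_exists[OF J] by blast
  define P where "P x = (\<lambda>i. \<Sum>j<r. \<kappa> j x * b j i)" for x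
  have PJ: "P x \<in> J" for x unfolding P_def by (rule subsp_sum[OF J]) (use fr in simp)
  have lP: "lop d P"
  proof (rule lmapI, rule vlinI)
    show "flin d (\<lambda>v. P v i)" for i unfolding P_def by (intro flin_sum flin_mult_right) (use fr in simp)
  qed (use subspD(1)[OF J PJ] in simp)
  have Px: "x \<in> J \<Longrightarrow> P x = x" for x using fr(4)[of x] unfolding P_def by (simp add: fun_eq_iff)
  have vP: "vlin d' d f \<Longrightarrow> vlin d' n (\<lambda>v. P (f v))" for d' n f by (rule lmap_vlin_comp[OF lP])
  define q where "q = (\<lambda>i. SW e (\<lambda>a b. (P (S a) \<odot> b) i))"
  have qJ: "q \<in> J"
  proof -
    have "q = (\<lambda>i. \<Sum>a<d. 1 * (\<Sum>b<d. hDelta H e a b * (P (S (bs a)) \<odot> bs b) i))"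
      unfolding q_def Sw_def by simp
    also have "\<dots> \<in> J" by (rule subsp_sum[OF J], rule subsp_sum[OF J], rule id[OF PJ])
    finally show ?thesis .
  qed
  have "q \<odot> x = x" if x: "x \<in> J" for x
  proof (rule vecs_eq_flinI[of _ d])
    show "x \<in> vecs d" by (rule subspD(1)[OF J x])
    fix F :: "(nat \<Rightarrow> 'k) \<Rightarrow> 'k" assume F: "flin d F"
    note c = lin flin_comp[OF F] vP
    have "F (q \<odot> x) = SW e (\<lambda>a b. F ((P (S a) \<odot> b) \<odot> x))"
      unfolding q_def by (rule flin_Sw_vec[where F="\<lambda>z. F (z \<odot> x)" and d=d]) (intro c)
    also have "\<dots> = SW e (\<lambda>a b. F (P (S a) \<odot> (b \<odot> x)))" by (simp only: assoc)
    also have "\<dots> = SW e (\<lambda>a b. F (P (x \<odot> S a) \<odot> b))"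
      by (rule nint_move_right[OF e, symmetric, where B="\<lambda>p q. F (P p \<odot> q)"]) (intro c)+
    also have "\<dots> = SW e (\<lambda>a b. F (x \<odot> (S a \<odot> b)))" by (simp only: Px[OF id[OF x]] assoc)
    also have "\<dots> = F (x \<odot> one)"
      using antipode_left[of "\<lambda>z. F (x \<odot> z)" e] by (simp add: c nintD(2)[OF e])
    finally show "F (q \<odot> x) = F x" by (simp add: flin_one_right[OF F])
  qed simp
  then show ?thesis using qJ by blast
qed

lemma subsp_is_subspace: "is_subspace H J \<longleftrightarrow> subsp d J"
  unfolding is_subspace_def subsp_def vecs_hvecs ..

text \<open>By \<open>maschke_right\<close> an ideal contains a left identity \<open>q\<close>. All
  powers of \<open>q\<close> equal \<open>q\<close>, so nilpotency forces q = 0 and the ideal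
  vanishes.\<close>

lemma nint_semisimple:
  assumes e: "nint e" shows "semisimple_hopf H"
  unfolding semisimple_hopf_def semisimple_subalg_def
proof (intro allI impI)
  fix I assume I: "is_ideal_in H (hvecs H) I \<and> is_nilpotent_set H I"
  then have J: "subsp d I" and id: "\<And>x y. x \<in> I \<Longrightarrow> y \<in> vecs d \<Longrightarrow> x \<odot> y \<in> I"
    unfolding is_ideal_in_def subsp_is_subspace vecs_hvecs by blast+
  have id': "x \<odot> y \<in> I" if "x \<in> I" for x y
  proof -
    have "x \<odot> trunc d y = x \<odot> y" by (rule lmap_trunc[OF lop_mul_left])
    then show ?thesis using id[OF that trunc_vecs[of d y]] by simp
  qed
  obtain q where q: "q \<in> I" "\<And>x. x \<in> I \<Longrightarrow> q \<odot> x = x" using maschke_right[OF e J id'] by blast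
  obtain N where N: "N \<ge> 1" "\<And>xs. length xs = N \<Longrightarrow> set xs \<subseteq> I \<Longrightarrow> foldr (hmul H) (butlast xs) (last xs) = (\<lambda>_. 0)"
    using I unfolding is_nilpotent_set_def by blast
  have fold: "foldr (hmul H) (replicate n q) q = q" for n
    by (induction n) (simp_all add: q)
  obtain m where m: "N = Suc m" using N(1) by (cases N) auto
  have bl: "butlast (replicate N q) = replicate m q" "last (replicate N q) = q"
    unfolding m by (simp_all add: replicate_append_same[symmetric])
  have "q = (\<lambda>_. 0)" using N(2)[of "replicate N q"] q(1) unfolding bl fold
    by (simp add: set_replicate_conv_if)
  then have "x = (\<lambda>_. 0)" if "x \<in> I" for x
  proof -
    have "(\<lambda>_. 0) \<odot> x = (\<lambda>_. 0)" by (rule lmap_zero[OF lop_mul_right])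
    then show ?thesis using q(2)[OF that] \<open>q = (\<lambda>_. 0)\<close> by simp
  qed
  then show "I = {\<lambda>_. 0}" using subspD(2)[OF J] by blast
qed

end

context hopf_int
begin

text \<open>Applying the counit to Lam x = alpha(x) Lam gives alpha = eps as soon as eps(Lam) is
  nonzero; then \<open>Lam\<close> is a two-sided integral and can be normalised.\<close>

lemma nint_Lam:
  assumes nz: "eps Lam \<noteq> 0" shows "nint (\<lambda>i. inverse (eps Lam) * Lam i)"
proof -
  have "alpha x = eps x" for x
    using Lam_right[of x] eps_mul[of Lam x] nz by (simp add: flin_scale[OF flin_eps])
  then show ?thesis
    unfolding nint_def mul_scale_left mul_scale_right Lam_left Lam_right flin_scale[OF flin_eps]
    using nz Lam_vecs by (simp add: vecs_def ac_simps)
qed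

end

section \<open>Freeness over a semisimple Hopf subalgebra\<close>

lemma lmap_minus: "lmap d d' F \<Longrightarrow> F (x - y) = F x - F y"
  by (rule ext) (simp add: fun_diff_def flin_diff[OF lmap_flin])

lemma lmap_sumf: "lmap d d' F \<Longrightarrow> F (\<Sum>j\<in>I. w j) = (\<Sum>j\<in>I. F (w j))"
  using lmap_sum[where c="\<lambda>_. 1" and F=F and w=w and I=I and d=d and d'=d'] by (simp add: sum_fun)

lemma flin_sumf: "flin d F \<Longrightarrow> F (\<Sum>j\<in>I. w j) = (\<Sum>j\<in>I. F (w j))"
  using flin_sum_apply[where c="\<lambda>_. 1" and F=F and w=w and X=I and d=d and v="\<Sum>j\<in>I. w j"] by (simp add: sum_fun)

lemma flin_minus_fun: "flin d F \<Longrightarrow> F (x - y) = F x - F y"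
  using flin_diff[of d F x y] by (simp add: fun_diff_def)

lemma vecs_minus: "x \<in> vecs d \<Longrightarrow> y \<in> vecs d \<Longrightarrow> (x - y :: nat \<Rightarrow> 'k::field) \<in> vecs d"
  by (simp add: vecs_def)

lemma vecs_sumf: "(\<And>j. j \<in> I \<Longrightarrow> w j \<in> vecs d) \<Longrightarrow> (\<Sum>j\<in>I. w j :: nat \<Rightarrow> 'k::field) \<in> vecs d"
  by (simp add: vecs_def sum_fun)

lemma hmul_minus_right: "hmul H x (y - z) = hmul H x y - hmul H x z"
  by (rule lmap_minus[OF lop_mul_left])

lemma hmul_minus_left: "hmul H (y - z) x = hmul H y x - hmul H z x"
  by (rule lmap_minus[OF lop_mul_right])

lemma hmul_sum_right: "hmul H x (\<Sum>j\<in>I. w j) = (\<Sum>j\<in>I. hmul H x (w j))"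
  by (rule lmap_sumf[OF lop_mul_left])

lemma hmul_sum_left: "hmul H (\<Sum>j\<in>I. w j) x = (\<Sum>j\<in>I. hmul H (w j) x)"
  by (rule lmap_sumf[OF lop_mul_right])

lemma hmul_zero_right: "hmul H x (\<lambda>_. 0) = (\<lambda>_. 0)"
  by (rule lmap_zero[OF lop_mul_left])

lemma hmul_0_right: "hmul H x 0 = 0"
  using hmul_zero_right[of H x] by (simp add: zero_fun_def)

text \<open>Representations need not be unital: the projection of \<open>H\<close> onto a complement of \<open>A\<close> is used to
  cut down the left regular representation.\<close>

definition mrep :: "'k::field hopf_data \<Rightarrow> nat \<Rightarrow> ((nat \<Rightarrow> 'k) \<Rightarrow> nat \<Rightarrow> nat \<Rightarrow> 'k) \<Rightarrow> bool" where
  "mrep H w \<rho> \<longleftrightarrow> (\<forall>i j. flin (hdim H) (\<lambda>x. \<rho> x i j)) \<and>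
     (\<forall>x y. \<forall>i j. \<rho> (hmul H x y) i j = (\<Sum>l<w. \<rho> x i l * \<rho> y l j))"

lemma mrepD: assumes "mrep H w \<rho>"
  shows "flin (hdim H) (\<lambda>x. \<rho> x i j)"
    "\<rho> (hmul H x y) i j = (\<Sum>l<w. \<rho> x i l * \<rho> y l j)"
  using assms unfolding mrep_def by blast+

lemma mrep_regular: 
  assumes "is_hopf_algebra (H :: 'k::field_char_0 hopf_data)"
  shows "mrep H (hdim H) (\<lambda>x i j. hmul H x (bs j) i)"
  unfolding mrep_def
proof (intro conjI allI)
  interpret hopf H by unfold_locales fact
  show "flin d (\<lambda>x. hmul H x (bs j) i)" for i j by (intro lin)
  fix x y i j
  have "hmul H (hmul H x y) (bs j) i = hmul H x (hmul H y (bs j)) i" by (simp add: assoc)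
  also have "\<dots> = (\<Sum>l<d. hmul H y (bs j) l * hmul H x (bs l) i)"
    by (rule flinD[OF lmap_flin[OF lop_mul_left]])
  finally show "hmul H (hmul H x y) (bs j) i = (\<Sum>l<d. hmul H x (bs l) i * hmul H y (bs j) l)"
    by (simp add: mult.commute)
qed

section \<open>Characters of tensor products with the regular representation\<close>

context hopf
begin

text \<open>The character of the regular representation. Modules enter through traces like this one,
  whose value at an idempotent \<open>q\<close> is the dimension of the image of left multiplication
  by \<open>q\<close>.\<close>

definition chi where "chi x = tr d (\<lambda>v. x \<odot> v)" for x

lemma flin_chi: "flin d chi"
  unfolding chi_def tr_def by (intro lin)

lemma chi_commute: "chi (x \<odot> y) = chi (y \<odot> x)"
proof -
  have "chi (x \<odot> y) = tr d (\<lambda>v. x \<odot> (y \<odot> v))" by (simp add: chi_def assoc)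
  also have "\<dots> = tr d (\<lambda>v. y \<odot> (x \<odot> v))"
    by (rule tr_cyclic) (rule lmapD[OF lop_mul_left])+
  finally show ?thesis by (simp add: chi_def assoc)
qed

lemma chi_one: "chi one = of_nat d"
proof -
  have "chi one = tr d (\<lambda>v. v)" unfolding chi_def by (rule tr_cong) (simp add: one_left)
  then show ?thesis by (simp add: tr_id)
qed

lemma chi_nint: "nint e \<Longrightarrow> chi e = 1"
proof -
  assume e: "nint e"
  have "chi e = tr d (\<lambda>v i. eps v * e i)" unfolding chi_def by (rule tr_cong) (simp add: nintD(4)[OF e])
  also have "\<dots> = 1" by (simp add: tr_rank_one[OF flin_eps] nintD(2)[OF e])
  finally show ?thesis .
qed

lemma chi_idempotent:
  assumes q: "q \<in> vecs d" "q \<odot> q = q"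
  shows "\<exists>n\<le>d. chi q = of_nat n \<and> (n = 0 \<longrightarrow> q = (\<lambda>_. 0))"
proof -
  have "q \<odot> (q \<odot> v) = q \<odot> v" for v by (simp add: assoc[symmetric] q)
  from lop_idempotent_trace[OF lop_mul_left this]
  obtain r where r: "r \<le> d" "chi q = of_nat r" "r = 0 \<longrightarrow> (\<forall>v. q \<odot> v = (\<lambda>_. 0))"
    unfolding chi_def by blast
  then have "q = (\<lambda>_. 0)" if "r = 0" using that one_right[OF q(1)] by metis
  then show ?thesis using r by blast
qed

text \<open>\<open>A \<otimes> V\<close> is a free \<open>A\<close>-module: conjugate the diagonal action by \<open>a \<otimes> v \<mapsto> a\<^sub>1 \<otimes> a\<^sub>2 v\<close>.\<close>

lemma chi_conv_left:
  assumes r: "mrep H w \<rho>"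
  shows "SW x (\<lambda>a b. chi a * (\<Sum>j<w. \<rho> b j j)) = chi x * (\<Sum>j<w. \<rho> one j j)"
proof -
  have fr: "flin d (\<lambda>x. \<rho> x i j)" for i j by (rule mrepD(1)[OF r])
  \<comment> \<open>Matrix blocks of the conjugating map a tensor v -> a_1 tensor a_2 v and of its
    inverse, which has S(a_2) instead of a_2. Claim A identifies the trace of the conjugate with
    that of the diagonal action, and cyclicity of the trace brings the two maps together for claim
    B.\<close>
  define \<Phi> where "\<Phi> j k z = (\<lambda>i. SW z (\<lambda>u v. \<rho> v j k * u i))" for j k z
  define \<Psi> where "\<Psi> k j z = (\<lambda>i. SW z (\<lambda>u v. \<rho> (S v) k j * u i))" for j k z
  have aP: "F (\<Phi> j k z) = SW z (\<lambda>u v. \<rho> v j k * F u)" if "flin d F" for F j k z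
    using flin_Sw_vec[OF that, of H z "\<lambda>u v i. \<rho> v j k * u i"] by (simp add: \<Phi>_def flin_scale[OF that])
  have aQ: "F (\<Psi> k j z) = SW z (\<lambda>u v. \<rho> (S v) k j * F u)" if "flin d F" for F j k z
    using flin_Sw_vec[OF that, of H z "\<lambda>u v i. \<rho> (S v) k j * u i"] by (simp add: \<Psi>_def flin_scale[OF that])
  have vP: "vlin d d (\<Phi> j k)" for j k unfolding \<Phi>_def by (rule vlinI) (intro lin)
  have vQ: "vlin d d (\<Psi> j k)" for j k unfolding \<Psi>_def by (rule vlinI) (intro lin)
  have A: "(\<Sum>j<w. \<Sum>k<w. F (\<Phi> j k (x \<odot> \<Psi> k j a))) = SW x (\<lambda>x1 x2. F (x1 \<odot> a) * (\<Sum>j<w. \<rho> x2 j j))"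
    if F: "flin d F" for F a
  proof -
    note c = lin flin_comp[OF F] flin_comp[OF fr]
    have "F (\<Phi> j k (x \<odot> \<Psi> k j a)) = SW a (\<lambda>u v. \<rho> (S v) k j * SW (x \<odot> u) (\<lambda>p q. \<rho> q j k * F p))" for j k
      unfolding aP[OF F] by (rule aQ[where F="\<lambda>z. SW (x \<odot> z) (\<lambda>p q. \<rho> q j k * F p)"]) (intro c)
    then have "(\<Sum>j<w. \<Sum>k<w. F (\<Phi> j k (x \<odot> \<Psi> k j a)))
       = SW a (\<lambda>u v. SW (x \<odot> u) (\<lambda>p q. (\<Sum>j<w. \<Sum>k<w. \<rho> q j k * \<rho> (S v) k j) * F p))"
      unfolding sum_distrib_right Sw_sum
      by (intro sum.cong refl) (simp add: Sw_scale[symmetric] ac_simps)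
    also have "\<dots> = SW a (\<lambda>u v. SW (x \<odot> u) (\<lambda>p q. (\<Sum>j<w. \<rho> (q \<odot> S v) j j) * F p))"
      by (simp only: mrepD(2)[OF r])
    also have "\<dots> = SW a (\<lambda>u v. SW x (\<lambda>x1 x2. SW u (\<lambda>u1 u2. (\<Sum>j<w. \<rho> ((x2 \<odot> u2) \<odot> S v) j j) * F (x1 \<odot> u1))))"
      by (rule Sw_cong, rule Sw_mul) (intro c)+
    also have "\<dots> = SW x (\<lambda>x1 x2. SW a (\<lambda>u v. SW u (\<lambda>u1 u2. (\<Sum>j<w. \<rho> (x2 \<odot> (u2 \<odot> S v)) j j) * F (x1 \<odot> u1))))"
      unfolding assoc by (rule Sw_swap)
    also have "\<dots> = SW x (\<lambda>x1 x2. SW a (\<lambda>u1 y. SW y (\<lambda>u2 v. (\<Sum>j<w. \<rho> (x2 \<odot> (u2 \<odot> S v)) j j) * F (x1 \<odot> u1))))"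
      by (simp only: coassoc)
    also have "\<dots> = SW x (\<lambda>x1 x2. SW a (\<lambda>u1 y. eps y * ((\<Sum>j<w. \<rho> x2 j j) * F (x1 \<odot> u1))))"
    proof (rule Sw_cong, rule Sw_cong)
      fix x1 x2 u1 y :: "nat \<Rightarrow> 'k" assume x2: "x2 \<in> vecs d"
      have "SW y (\<lambda>u2 v. (\<Sum>j<w. \<rho> (x2 \<odot> (u2 \<odot> S v)) j j) * F (x1 \<odot> u1)) = eps y * ((\<Sum>j<w. \<rho> (x2 \<odot> one) j j) * F (x1 \<odot> u1))"
        by (rule antipode_right) (intro c)
      then show "SW y (\<lambda>u2 v. (\<Sum>j<w. \<rho> (x2 \<odot> (u2 \<odot> S v)) j j) * F (x1 \<odot> u1)) = eps y * ((\<Sum>j<w. \<rho> x2 j j) * F (x1 \<odot> u1))"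
        using x2 by (simp add: one_right)
    qed
    also have "\<dots> = SW x (\<lambda>x1 x2. (\<Sum>j<w. \<rho> x2 j j) * F (x1 \<odot> a))"
      by (rule Sw_cong, rule counit_right) (intro c)
    finally show ?thesis by (simp only: mult.commute)
  qed
  \<comment> \<open>As \<open>\<rho>\<close> may fail to be unital, the two maps compose to
    \<open>\<rho> one\<close> and not to the identity.\<close>
  have B: "(\<Sum>j<w. F (\<Psi> k j (\<Phi> j k a))) = \<rho> one k k * F a" if F: "flin d F" for F a k
  proof -
    note c = lin flin_comp[OF F] flin_comp[OF fr] F
    have "F (\<Psi> k j (\<Phi> j k a)) = SW a (\<lambda>u v. \<rho> v j k * SW u (\<lambda>p q. \<rho> (S q) k j * F p))" for j
      unfolding aQ[OF F] by (rule aP) (intro c)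
    then have "(\<Sum>j<w. F (\<Psi> k j (\<Phi> j k a))) = SW a (\<lambda>u v. SW u (\<lambda>p q. (\<Sum>j<w. \<rho> (S q) k j * \<rho> v j k) * F p))"
      unfolding sum_distrib_right Sw_sum
      by (intro sum.cong refl) (simp add: Sw_scale[symmetric] ac_simps)
    also have "\<dots> = SW a (\<lambda>u v. SW u (\<lambda>p q. \<rho> (S q \<odot> v) k k * F p))"
      by (simp only: mrepD(2)[OF r])
    also have "\<dots> = SW a (\<lambda>p y. SW y (\<lambda>q v. \<rho> (S q \<odot> v) k k * F p))"
      by (rule coassoc)
    also have "\<dots> = SW a (\<lambda>p y. eps y * (\<rho> one k k * F p))"
      by (rule Sw_cong, rule antipode_left[where F="\<lambda>z. \<rho> z k k * F p" for p]) (intro c fr)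
    also have "\<dots> = \<rho> one k k * F a"
      by (rule counit_right) (intro c)
    finally show ?thesis .
  qed
  have "SW x (\<lambda>a b. chi a * (\<Sum>j<w. \<rho> b j j)) = (\<Sum>i<d. \<Sum>j<w. \<Sum>k<w. \<Phi> j k (x \<odot> \<Psi> k j (bs i)) i)"
    unfolding chi_def tr_def by (simp add: A[OF flin_coord] sum_distrib_right Sw_sum)
  also have "\<dots> = (\<Sum>j<w. \<Sum>k<w. tr d (\<lambda>v. \<Phi> j k (x \<odot> \<Psi> k j v)))"
    unfolding tr_def by (simp only: sum.swap[of _ "{..<w}" "{..<d}"])
  also have "\<dots> = (\<Sum>j<w. \<Sum>k<w. tr d (\<lambda>v. x \<odot> \<Psi> k j (\<Phi> j k v)))"
    by (rule sum.cong[OF refl], rule sum.cong[OF refl], rule tr_cyclic[OF vlin_comp[OF _ vQ] vP])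
       (rule lmapD[OF lop_mul_left])
  also have "\<dots> = (\<Sum>k<w. \<Sum>i<d. \<Sum>j<w. (x \<odot> \<Psi> k j (\<Phi> j k (bs i))) i)"
    unfolding tr_def by (subst sum.swap, rule sum.cong[OF refl], rule sum.swap)
  also have "\<dots> = (\<Sum>k<w. \<Sum>i<d. \<rho> one k k * (x \<odot> bs i) i)"
    by (intro sum.cong refl B lmap_flin[OF lop_mul_left])
  also have "\<dots> = chi x * (\<Sum>k<w. \<rho> one k k)"
    unfolding chi_def tr_def by (subst sum.swap) (simp add: sum_distrib_left sum_distrib_right mult.commute)
  finally show ?thesis .
qed

text \<open>The same for \<open>V \<otimes> A\<close>. Here the legs of the coproduct meet in the
  opposite order, so the conjugating map is inverted by means of the inverse antipode
  \<open>Si\<close>.\<close>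

lemma chi_conv_right:
  assumes r: "mrep H w \<rho>"
  shows "SW x (\<lambda>a b. (\<Sum>j<w. \<rho> a j j) * chi b) = chi x * (\<Sum>j<w. \<rho> one j j)"
proof -
  obtain Si where Si: "lop d Si" "\<And>x. x \<in> vecs d \<Longrightarrow> Si (S x) = x" "\<And>x. x \<in> vecs d \<Longrightarrow> S (Si x) = x"
    using S_inverse_exists by blast
  have vSi: "vlin d' d f \<Longrightarrow> vlin d' n (\<lambda>v. Si (f v))" for d' n f by (rule lmap_vlin_comp[OF Si(1)])
  have S_eq: "y = z" if "y \<in> vecs d" "z \<in> vecs d" "S y = S z" for y z
    using that Si(2) by metis
  \<comment> \<open>\<open>S\<close> turns this identity and the next one into the two antipode
    axioms, and it is injective.\<close>
  have sl: "SW a (\<lambda>u v. F (Si v \<odot> u)) = eps a * F one" if F: "flin d F" for F a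
  proof -
    let ?y = "\<lambda>i. SW a (\<lambda>u v. (Si v \<odot> u) i)"
    have "?y = (\<lambda>i. eps a * one i)"
    proof (rule S_eq)
      show "?y \<in> vecs d" by (rule vecs_Sw) simp
      show "(\<lambda>i. eps a * one i) \<in> vecs d" using hone_vecs[of H] by (simp add: vecs_def)
      show "S ?y = S (\<lambda>i. eps a * one i)"
      proof (rule vecs_eq_flinI[of _ d])
        fix G :: "(nat \<Rightarrow> 'k) \<Rightarrow> 'k" assume G: "flin d G"
        have GS: "flin d (\<lambda>z. G (S z))" by (intro lin flin_comp[OF G])
        have "G (S ?y) = SW a (\<lambda>u v. G (S (Si v \<odot> u)))" by (rule flin_Sw_vec[OF GS])
        also have "\<dots> = SW a (\<lambda>u v. G (S u \<odot> v))" by (rule Sw_cong) (simp add: S_mul Si)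
        also have "\<dots> = G (S (\<lambda>i. eps a * one i))"
          by (simp add: antipode_left[OF G] flin_scale[OF GS] S_one)
        finally show "G (S ?y) = G (S (\<lambda>i. eps a * one i))" .
      qed simp_all
    qed
    then show ?thesis using flin_Sw_vec[OF F, of H a "\<lambda>u v. Si v \<odot> u"] by (simp add: flin_scale[OF F])
  qed
  have sr: "SW a (\<lambda>u v. F (v \<odot> Si u)) = eps a * F one" if F: "flin d F" for F a
  proof -
    let ?y = "\<lambda>i. SW a (\<lambda>u v. (v \<odot> Si u) i)"
    have "?y = (\<lambda>i. eps a * one i)"
    proof (rule S_eq)
      show "?y \<in> vecs d" by (rule vecs_Sw) simp
      show "(\<lambda>i. eps a * one i) \<in> vecs d" using hone_vecs[of H] by (simp add: vecs_def)
      show "S ?y = S (\<lambda>i. eps a * one i)"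
      proof (rule vecs_eq_flinI[of _ d])
        fix G :: "(nat \<Rightarrow> 'k) \<Rightarrow> 'k" assume G: "flin d G"
        have GS: "flin d (\<lambda>z. G (S z))" by (intro lin flin_comp[OF G])
        have "G (S ?y) = SW a (\<lambda>u v. G (S (v \<odot> Si u)))" by (rule flin_Sw_vec[OF GS])
        also have "\<dots> = SW a (\<lambda>u v. G (u \<odot> S v))" by (rule Sw_cong) (simp add: S_mul Si)
        also have "\<dots> = G (S (\<lambda>i. eps a * one i))"
          by (simp add: antipode_right[OF G] flin_scale[OF GS] S_one)
        finally show "G (S ?y) = G (S (\<lambda>i. eps a * one i))" .
      qed simp_all
    qed
    then show ?thesis using flin_Sw_vec[OF F, of H a "\<lambda>u v. v \<odot> Si u"] by (simp add: flin_scale[OF F])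
  qed
  have fr: "flin d (\<lambda>x. \<rho> x i j)" for i j by (rule mrepD(1)[OF r])
  define \<Phi> where "\<Phi> j k z = (\<lambda>i. SW z (\<lambda>u v. \<rho> u j k * v i))" for j k z
  define \<Psi> where "\<Psi> k j z = (\<lambda>i. SW z (\<lambda>u v. \<rho> (Si u) k j * v i))" for j k z
  have aP: "F (\<Phi> j k z) = SW z (\<lambda>u v. \<rho> u j k * F v)" if "flin d F" for F j k z
    using flin_Sw_vec[OF that, of H z "\<lambda>u v i. \<rho> u j k * v i"] by (simp add: \<Phi>_def flin_scale[OF that])
  have aQ: "F (\<Psi> k j z) = SW z (\<lambda>u v. \<rho> (Si u) k j * F v)" if "flin d F" for F j k z
    using flin_Sw_vec[OF that, of H z "\<lambda>u v i. \<rho> (Si u) k j * v i"] by (simp add: \<Psi>_def flin_scale[OF that])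
  have vP: "vlin d d (\<Phi> j k)" for j k unfolding \<Phi>_def by (rule vlinI) (intro lin)
  have vQ: "vlin d d (\<Psi> j k)" for j k unfolding \<Psi>_def by (rule vlinI) (intro lin)
  have A: "(\<Sum>j<w. \<Sum>k<w. F (\<Phi> j k (x \<odot> \<Psi> k j a))) = SW x (\<lambda>x1 x2. (\<Sum>j<w. \<rho> x1 j j) * F (x2 \<odot> a))"
    if F: "flin d F" for F a
  proof -
    note c = lin flin_comp[OF F] flin_comp[OF fr] vSi
    have "F (\<Phi> j k (x \<odot> \<Psi> k j a)) = SW a (\<lambda>u v. \<rho> (Si u) k j * SW (x \<odot> v) (\<lambda>p q. \<rho> p j k * F q))" for j k
      unfolding aP[OF F] by (rule aQ[where F="\<lambda>z. SW (x \<odot> z) (\<lambda>p q. \<rho> p j k * F q)"]) (intro c)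
    then have "(\<Sum>j<w. \<Sum>k<w. F (\<Phi> j k (x \<odot> \<Psi> k j a)))
       = SW a (\<lambda>u v. SW (x \<odot> v) (\<lambda>p q. (\<Sum>j<w. \<Sum>k<w. \<rho> p j k * \<rho> (Si u) k j) * F q))"
      unfolding sum_distrib_right Sw_sum
      by (intro sum.cong refl) (simp add: Sw_scale[symmetric] ac_simps)
    also have "\<dots> = SW a (\<lambda>u v. SW (x \<odot> v) (\<lambda>p q. (\<Sum>j<w. \<rho> (p \<odot> Si u) j j) * F q))"
      by (simp only: mrepD(2)[OF r])
    also have "\<dots> = SW a (\<lambda>u v. SW x (\<lambda>x1 x2. SW v (\<lambda>v1 v2. (\<Sum>j<w. \<rho> ((x1 \<odot> v1) \<odot> Si u) j j) * F (x2 \<odot> v2))))"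
      by (rule Sw_cong, rule Sw_mul) (intro c)+
    also have "\<dots> = SW x (\<lambda>x1 x2. SW a (\<lambda>u v. SW v (\<lambda>v1 v2. (\<Sum>j<w. \<rho> (x1 \<odot> (v1 \<odot> Si u)) j j) * F (x2 \<odot> v2))))"
      unfolding assoc by (rule Sw_swap)
    also have "\<dots> = SW x (\<lambda>x1 x2. SW a (\<lambda>y v2. SW y (\<lambda>u v1. (\<Sum>j<w. \<rho> (x1 \<odot> (v1 \<odot> Si u)) j j) * F (x2 \<odot> v2))))"
      by (simp only: coassoc)
    also have "\<dots> = SW x (\<lambda>x1 x2. SW a (\<lambda>y v2. eps y * ((\<Sum>j<w. \<rho> x1 j j) * F (x2 \<odot> v2))))"
    proof (rule Sw_cong, rule Sw_cong)
      fix x1 x2 v2 y :: "nat \<Rightarrow> 'k" assume x1: "x1 \<in> vecs d"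
      have "SW y (\<lambda>u v1. (\<Sum>j<w. \<rho> (x1 \<odot> (v1 \<odot> Si u)) j j) * F (x2 \<odot> v2)) = eps y * ((\<Sum>j<w. \<rho> (x1 \<odot> one) j j) * F (x2 \<odot> v2))"
        by (rule sr) (intro c)
      then show "SW y (\<lambda>u v1. (\<Sum>j<w. \<rho> (x1 \<odot> (v1 \<odot> Si u)) j j) * F (x2 \<odot> v2)) = eps y * ((\<Sum>j<w. \<rho> x1 j j) * F (x2 \<odot> v2))"
        using x1 by (simp add: one_right)
    qed
    also have "\<dots> = SW x (\<lambda>x1 x2. (\<Sum>j<w. \<rho> x1 j j) * F (x2 \<odot> a))"
      by (rule Sw_cong, rule counit_left) (intro c)
    finally show ?thesis .
  qed
  have B: "(\<Sum>j<w. F (\<Psi> k j (\<Phi> j k a))) = \<rho> one k k * F a" if F: "flin d F" for F a k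
  proof -
    note c = lin flin_comp[OF F] flin_comp[OF fr] F vSi
    have "F (\<Psi> k j (\<Phi> j k a)) = SW a (\<lambda>u v. \<rho> u j k * SW v (\<lambda>p q. \<rho> (Si p) k j * F q))" for j
      unfolding aQ[OF F] by (rule aP) (intro c)
    then have "(\<Sum>j<w. F (\<Psi> k j (\<Phi> j k a))) = SW a (\<lambda>u v. SW v (\<lambda>p q. (\<Sum>j<w. \<rho> (Si p) k j * \<rho> u j k) * F q))"
      unfolding sum_distrib_right Sw_sum
      by (intro sum.cong refl) (simp add: Sw_scale[symmetric] ac_simps)
    also have "\<dots> = SW a (\<lambda>u v. SW v (\<lambda>p q. \<rho> (Si p \<odot> u) k k * F q))"
      by (simp only: mrepD(2)[OF r])
    also have "\<dots> = SW a (\<lambda>y q. SW y (\<lambda>u p. \<rho> (Si p \<odot> u) k k * F q))"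
      by (rule coassoc[symmetric])
    also have "\<dots> = SW a (\<lambda>y q. eps y * (\<rho> one k k * F q))"
      by (rule Sw_cong, rule sl[where F="\<lambda>z. \<rho> z k k * F q" for q]) (intro c fr)
    also have "\<dots> = \<rho> one k k * F a"
      by (rule counit_left) (intro c)
    finally show ?thesis .
  qed
  have "SW x (\<lambda>a b. (\<Sum>j<w. \<rho> a j j) * chi b) = (\<Sum>i<d. \<Sum>j<w. \<Sum>k<w. \<Phi> j k (x \<odot> \<Psi> k j (bs i)) i)"
    unfolding chi_def tr_def by (simp add: A[OF flin_coord] sum_distrib_left Sw_sum)
  also have "\<dots> = (\<Sum>j<w. \<Sum>k<w. tr d (\<lambda>v. \<Phi> j k (x \<odot> \<Psi> k j v)))"
    unfolding tr_def by (simp only: sum.swap[of _ "{..<w}" "{..<d}"])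
  also have "\<dots> = (\<Sum>j<w. \<Sum>k<w. tr d (\<lambda>v. x \<odot> \<Psi> k j (\<Phi> j k v)))"
    by (rule sum.cong[OF refl], rule sum.cong[OF refl], rule tr_cyclic[OF vlin_comp[OF _ vQ] vP])
       (rule lmapD[OF lop_mul_left])
  also have "\<dots> = (\<Sum>k<w. \<Sum>i<d. \<Sum>j<w. (x \<odot> \<Psi> k j (\<Phi> j k (bs i))) i)"
    unfolding tr_def by (subst sum.swap, rule sum.cong[OF refl], rule sum.swap)
  also have "\<dots> = (\<Sum>k<w. \<Sum>i<d. \<rho> one k k * (x \<odot> bs i) i)"
    by (intro sum.cong refl B lmap_flin[OF lop_mul_left])
  also have "\<dots> = chi x * (\<Sum>k<w. \<rho> one k k)"
    unfolding chi_def tr_def by (subst sum.swap) (simp add: sum_distrib_left sum_distrib_right mult.commute)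
  finally show ?thesis .
qed

text \<open>An idempotent matrix over a semisimple algebra is a sum of rank-one idempotents \<open>a\<^sub>i b\<^sub>j\<close>
  with \<open>\<Sum> b\<^sub>i a\<^sub>i\<close> an idempotent of the algebra; here one such summand is split off so that
  the last row vanishes.\<close>

lemma trace_idempotent_matrix:
  fixes w :: nat
  assumes e: "nint e" and g: "flin d g" "\<And>x y. g (x \<odot> y) = g (y \<odot> x)"
    and pos: "\<And>q. q \<in> vecs d \<Longrightarrow> q \<odot> q = q \<Longrightarrow> \<exists>n. g q = of_nat n"
  shows "(\<And>i j. Q i j \<in> vecs d) \<Longrightarrow> (\<And>i j. i < w \<Longrightarrow> j < w \<Longrightarrow> (\<Sum>l<w. Q i l \<odot> Q l j) = Q i j) \<Longrightarrow>
    \<exists>n. (\<Sum>i<w. g (Q i i)) = of_nat n"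
proof (induction w arbitrary: Q)
  case 0
  have "(\<Sum>i<0. g (Q i i)) = of_nat 0" by simp
  then show ?case by blast
next
  case (Suc w)
  note Qv = Suc(2) and QQ = Suc(3)
  define b where "b j = Q w j" for j
  \<comment> \<open>The right ideal generated by the last row of \<open>Q\<close>; Maschke provides
    a left identity \<open>q\<close> of it, which is a combination of the entries of that
    row.\<close>
  define J where "J = range (\<lambda>c. \<Sum>j<Suc w. b j \<odot> c j)"
  have JI: "(\<Sum>j<Suc w. b j \<odot> c j) \<in> J" for c
    unfolding J_def by (rule range_eqI[where x=c]) (rule refl)
  have J: "subsp d J"
    unfolding subsp_def
  proof (intro conjI ballI allI)
    show "J \<subseteq> vecs d" unfolding J_def by (auto intro!: vecs_sumf simp del: sum.lessThan_Suc)
    have "(\<Sum>j<Suc w. b j \<odot> (\<lambda>_. 0)) = (\<lambda>_. 0)" unfolding hmul_zero_right sum_fun by simp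
    then show "(\<lambda>_. 0) \<in> J"  using JI[of "\<lambda>_ _. 0"] by simp
    fix x y assume "x \<in> J" "y \<in> J"
    then obtain u v where uv: "x = (\<Sum>j<Suc w. b j \<odot> u j)" "y = (\<Sum>j<Suc w. b j \<odot> v j)" unfolding J_def by blast
    have "(\<lambda>i. x i + y i) = (\<Sum>j<Suc w. b j \<odot> (\<lambda>i. u j i + v j i))"
      unfolding uv lmap_add[OF lop_mul_left] by (simp add: sum_fun sum.distrib del: sum.lessThan_Suc)
    then show "(\<lambda>i. x i + y i) \<in> J" using JI by (simp only:)
  next
    fix s x assume "x \<in> J"
    then obtain u where uv: "x = (\<Sum>j<Suc w. b j \<odot> u j)" unfolding J_def by blast
    have "(\<lambda>i. s * x i) = (\<Sum>j<Suc w. b j \<odot> (\<lambda>i. s * u j i))"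
      unfolding uv lmap_scale[OF lop_mul_left] by (simp add: sum_fun sum_distrib_left del: sum.lessThan_Suc)
    then show "(\<lambda>i. s * x i) \<in> J" using JI by (simp only:)
  qed
  have id: "x \<odot> y \<in> J" if x: "x \<in> J" for x y
  proof -
    obtain u where "x = (\<Sum>j<Suc w. b j \<odot> u j)" using x unfolding J_def by blast
    then have "x \<odot> y = (\<Sum>j<Suc w. b j \<odot> (u j \<odot> y))" by (simp only: hmul_sum_left assoc)
    then show ?thesis using JI by (simp only:)
  qed
  obtain q where q: "q \<in> J" "\<And>x. x \<in> J \<Longrightarrow> q \<odot> x = x" using maschke_right[OF e J id] by blast
  have bJ: "b j \<in> J" if j: "j < Suc w" for j
  proof -
    have "b j = (\<Sum>l<Suc w. if l = j then b j else 0)"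
      using j by (subst sum.delta) (auto simp del: sum.lessThan_Suc)
    also have "\<dots> = (\<Sum>l<Suc w. b l \<odot> (if l = j then one else 0))"
      by (rule sum.cong) (auto simp: hmul_0_right one_right b_def Qv)
    finally show ?thesis using JI by (simp only:)
  qed
  obtain c where c: "q = (\<Sum>j<Suc w. b j \<odot> c j)" using q(1) unfolding J_def by blast
  have qq: "q \<odot> q = q" by (rule q(2)[OF q(1)])
  have qv: "q \<in> vecs d" by (rule subspD(1)[OF J q(1)])
  \<comment> \<open>A column with Q a = a, b a = q and last entry \<open>q\<close>. Hence the matrix
    with entries a_i b_j is idempotent and has the same last row as \<open>Q\<close>; subtracting it
    from \<open>Q\<close> leaves an idempotent whose last row is 0.\<close>
  define a where "a i = (\<Sum>j<Suc w. Q i j \<odot> c j) \<odot> q" for i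
  have aw: "a w = q" unfolding a_def b_def[symmetric] c[symmetric] by (rule qq)
  have aq: "a i \<odot> q = a i" for i unfolding a_def assoc qq ..
  have Qa: "(\<Sum>l<Suc w. Q i l \<odot> a l) = a i" if i: "i < Suc w" for i
  proof -
    have "(\<Sum>l<Suc w. Q i l \<odot> a l) = (\<Sum>l<Suc w. \<Sum>j<Suc w. (Q i l \<odot> Q l j) \<odot> c j) \<odot> q"
      unfolding a_def by (simp only: hmul_sum_right hmul_sum_left assoc)
    also have "\<dots> = (\<Sum>j<Suc w. (\<Sum>l<Suc w. Q i l \<odot> Q l j) \<odot> c j) \<odot> q"
      unfolding hmul_sum_left by (subst sum.swap) (rule refl)
    also have "\<dots> = a i" unfolding a_def
      by (rule arg_cong[where f="\<lambda>z. z \<odot> q"], rule sum.cong[OF refl]) (simp only: lessThan_iff QQ[OF i])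
    finally show ?thesis .
  qed
  have ba: "(\<Sum>l<Suc w. b l \<odot> a l) = q" unfolding b_def by (rule trans[OF Qa[OF lessI] aw])
  have bQ: "(\<Sum>l<Suc w. b l \<odot> Q l j) = b j" if "j < Suc w" for j unfolding b_def by (rule QQ[OF lessI that])
  have qb: "q \<odot> b j = b j" if "j < Suc w" for j by (rule q(2)[OF bJ[OF that]])
  define R where "R i j = Q i j - a i \<odot> b j" for i j
  have Rv: "R i j \<in> vecs d" for i j unfolding R_def by (rule vecs_minus) (simp_all add: Qv)
  have Rw: "R w j = (\<lambda>_. 0)" if "j < Suc w" for j
  proof -
    have "R w j = Q w j - b j" unfolding R_def aw qb[OF that] ..
    then show ?thesis unfolding b_def by (simp add: zero_fun_def)
  qed
  have RR: "(\<Sum>l<Suc w. R i l \<odot> R l j) = R i j" if ij: "i < Suc w" "j < Suc w" for i j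
  proof -
    have "(\<Sum>l<Suc w. R i l \<odot> R l j)
      = (\<Sum>l<Suc w. Q i l \<odot> Q l j) - a i \<odot> (\<Sum>l<Suc w. b l \<odot> Q l j)
        - ((\<Sum>l<Suc w. Q i l \<odot> a l) \<odot> b j - a i \<odot> ((\<Sum>l<Suc w. b l \<odot> a l) \<odot> b j))"
      unfolding R_def hmul_minus_left hmul_minus_right hmul_sum_left hmul_sum_right assoc
      by (simp only: sum_subtractf)
    also have "\<dots> = R i j"
      unfolding QQ[OF ij] Qa[OF ij(1)] bQ[OF ij(2)] ba qb[OF ij(2)] R_def by simp
    finally show ?thesis .
  qed
  have "(\<Sum>l<w. R i l \<odot> R l j) = R i j" if "i < w" "j < w" for i j
    using RR[of i j] that Rw[of j] by (simp add: hmul_0_right zero_fun_def[symmetric])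
  from Suc(1)[of R, OF Rv this]
  obtain n where n: "(\<Sum>i<w. g (R i i)) = of_nat n" by blast
  obtain m where m: "g q = of_nat m" using pos[OF qv qq] by blast
  have "(\<Sum>i<Suc w. g (Q i i)) = (\<Sum>i<Suc w. g (R i i)) + (\<Sum>i<Suc w. g (a i \<odot> b i))"
    unfolding R_def flin_minus_fun[OF g(1)] by (simp only: sum.distrib[symmetric] diff_add_cancel)
  also have "(\<Sum>i<Suc w. g (R i i)) = of_nat n"
    using n Rw[of w] flin_zero[OF g(1)] by simp
  also have "(\<Sum>i<Suc w. g (a i \<odot> b i)) = g (\<Sum>i<Suc w. b i \<odot> a i)"
    unfolding flin_sumf[OF g(1)] g(2)[of "a _"] ..
  also have "\<dots> = of_nat m" unfolding ba m ..
  finally have "(\<Sum>i<Suc w. g (Q i i)) = of_nat (n + m)" by simp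
  then show ?case by blast
qed

text \<open>Applying \<open>\<rho>\<close> to the second leg of Delta(q) yields an idempotent matrix
  over the algebra, to which \<open>trace_idempotent_matrix\<close> applies. In terms of modules:
  tensoring with an actual representation preserves non-negativity on idempotents, also for a trace
  \<open>g\<close> not known to be a character.\<close>

lemma positive_conv:
  assumes e: "nint e" and g: "flin d g" "\<And>x y. g (x \<odot> y) = g (y \<odot> x)"
    and pos: "\<And>q. q \<in> vecs d \<Longrightarrow> q \<odot> q = q \<Longrightarrow> \<exists>n. g q = of_nat n"
    and r: "mrep H w \<rho>" and q: "q \<odot> q = q"
  shows "\<exists>n. SW q (\<lambda>a b. g a * (\<Sum>j<w. \<rho> b j j)) = of_nat n"
proof -
  define Q where "Q i j = (\<lambda>k. SW q (\<lambda>a b. \<rho> b i j * a k))" for i j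
  have fr: "flin d (\<lambda>x. \<rho> x i j)" for i j by (rule mrepD(1)[OF r])
  have aQ: "F (Q i j) = SW q (\<lambda>a b. \<rho> b i j * F a)" if "flin d F" for F i j
    using flin_Sw_vec[OF that, of H q "\<lambda>a b k. \<rho> b i j * a k"] by (simp add: Q_def flin_scale[OF that])
  have Qv: "Q i j \<in> vecs d" for i j
    by (auto simp: Q_def vecs_def Sw_def bs_def intro!: sum.neutral)
  have QQ: "(\<Sum>l<w. Q i l \<odot> Q l j) = Q i j" for i j
  proof (rule vecs_eq_flinI[of _ d])
    show "(\<Sum>l<w. Q i l \<odot> Q l j) \<in> vecs d" by (rule vecs_sumf) simp
    fix F :: "(nat \<Rightarrow> 'k) \<Rightarrow> 'k" assume F: "flin d F"
    note c = lin flin_comp[OF F] flin_comp[OF fr] F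
    have "F (Q i l \<odot> Q l j) = SW q (\<lambda>a b. \<rho> b i l * SW q (\<lambda>a' b'. \<rho> b' l j * F (a \<odot> a')))" for l
    proof -
      have "F (Q i l \<odot> Q l j) = SW q (\<lambda>a b. \<rho> b i l * F (a \<odot> Q l j))"
        by (rule aQ[where F="\<lambda>z. F (z \<odot> Q l j)"]) (intro c)
      also have "\<dots> = SW q (\<lambda>a b. \<rho> b i l * SW q (\<lambda>a' b'. \<rho> b' l j * F (a \<odot> a')))"
        by (subst aQ[where F="\<lambda>z. F (_ \<odot> z)"]) (intro c, rule refl)
      finally show ?thesis .
    qed
    then have "F (\<Sum>l<w. Q i l \<odot> Q l j) = SW q (\<lambda>a b. SW q (\<lambda>a' b'. (\<Sum>l<w. \<rho> b i l * \<rho> b' l j) * F (a \<odot> a')))"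
      unfolding flin_sumf[OF F] sum_distrib_right Sw_sum
      by (intro sum.cong refl) (simp add: Sw_scale[symmetric] ac_simps)
    also have "\<dots> = SW q (\<lambda>a b. SW q (\<lambda>a' b'. \<rho> (b \<odot> b') i j * F (a \<odot> a')))"
      by (simp only: mrepD(2)[OF r])
    also have "\<dots> = SW (q \<odot> q) (\<lambda>a b. \<rho> b i j * F a)"
      by (rule Sw_mul[symmetric]) (intro c fr)+
    also have "\<dots> = F (Q i j)" unfolding q aQ[OF F] ..
    finally show "F (\<Sum>l<w. Q i l \<odot> Q l j) = F (Q i j)" .
  qed (rule Qv)
  have "SW q (\<lambda>a b. g a * (\<Sum>j<w. \<rho> b j j)) = (\<Sum>j<w. g (Q j j))"
    unfolding aQ[OF g(1)] by (simp add: sum_distrib_left Sw_sum mult.commute)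
  then show ?thesis using trace_idempotent_matrix[OF e g pos Qv QQ] by simp
qed

end

text \<open>An embedding \<open>\<iota>\<close> with a linear retraction \<open>\<kappa>\<close>.
  Compatibility with the coproduct is expressed through bilinear forms on the larger algebra;
  compatibility with counit and antipode follows in \<open>iota_eps\<close> and
  \<open>iota_S\<close>.\<close>

locale hopf_sub = A: hopf A + H: hopf H
  for A H :: "'k::field_char_0 hopf_data" +
  fixes \<iota> \<kappa> :: "(nat \<Rightarrow> 'k) \<Rightarrow> nat \<Rightarrow> 'k"
  assumes iota: "lmap (hdim A) (hdim H) \<iota>"
    and kappa: "lmap (hdim H) (hdim A) \<kappa>"
    and kappa_iota: "x \<in> vecs (hdim A) \<Longrightarrow> \<kappa> (\<iota> x) = x"
    and iota_mul: "\<iota> (hmul A x y) = hmul H (\<iota> x) (\<iota> y)"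
    and iota_one: "\<iota> (hone A) = hone H"
    and iota_Sw: "(\<And>y. flin (hdim H) (\<lambda>x. B x y)) \<Longrightarrow> (\<And>x. flin (hdim H) (B x)) \<Longrightarrow>
      Sw H (\<iota> x) B = Sw A x (\<lambda>a b. B (\<iota> a) (\<iota> b))"
begin

lemma vlin_iota: "vlin d' (hdim A) f \<Longrightarrow> vlin d' n (\<lambda>v. \<iota> (f v))"
  by (rule lmap_vlin_comp[OF iota])

lemma vlin_kappa: "vlin d' (hdim H) f \<Longrightarrow> vlin d' n (\<lambda>v. \<kappa> (f v))"
  by (rule lmap_vlin_comp[OF kappa])

lemmas lk = lin vlin_iota vlin_kappa

lemma iota_vecs [simp]: "\<iota> x \<in> vecs (hdim H)" by (rule lmapD(2)[OF iota])
lemma kappa_vecs [simp]: "\<kappa> x \<in> vecs (hdim A)" by (rule lmapD(2)[OF kappa])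

definition chiH where "chiH x = H.chi (\<iota> x)" for x

lemma flin_chiH: "flin (hdim A) chiH"
  unfolding chiH_def by (rule flin_comp[OF H.flin_chi lmapD(1)[OF iota]])

lemma mrep_H: "mrep A (hdim H) (\<lambda>x i j. hmul H (\<iota> x) (bs j) i)"
  unfolding mrep_def
proof (intro conjI allI)
  show "flin (hdim A) (\<lambda>x. hmul H (\<iota> x) (bs j) i)" for i j by (intro lk)
  fix x y i j
  show "hmul H (\<iota> (hmul A x y)) (bs j) i = (\<Sum>l<hdim H. hmul H (\<iota> x) (bs l) i * hmul H (\<iota> y) (bs j) l)"
    unfolding iota_mul by (rule mrepD(2)[OF mrep_regular[OF H.hopf]])
qed

lemma chiH_tr: "chiH x = (\<Sum>j<hdim H. hmul H (\<iota> x) (bs j) j)"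
  by (simp add: chiH_def H.chi_def tr_def)

lemma chiA_tr: "A.chi x = (\<Sum>j<hdim A. hmul A x (bs j) j)"
  by (simp add: A.chi_def tr_def)

lemma chiH_one: "chiH (hone A) = of_nat (hdim H)"
  by (simp add: chiH_def iota_one H.chi_one)

lemma conv_AH: "Sw A x (\<lambda>a b. A.chi a * chiH b) = A.chi x * of_nat (hdim H)"
  using A.chi_conv_left[OF mrep_H, of x] by (simp only: chiH_tr[symmetric] chiH_one)

lemma conv_HA: "Sw A x (\<lambda>a b. chiH a * A.chi b) = A.chi x * of_nat (hdim H)"
  using A.chi_conv_right[OF mrep_H, of x] by (simp only: chiH_tr[symmetric] chiH_one)

lemma conv_AA: "Sw A x (\<lambda>a b. A.chi a * A.chi b) = A.chi x * of_nat (hdim A)"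
  using A.chi_conv_left[OF mrep_regular[OF A.hopf], of x] by (simp only: chiA_tr[symmetric] A.chi_one)

lemma conv_HH: "Sw A x (\<lambda>a b. chiH a * chiH b) = chiH x * of_nat (hdim H)"
proof -
  have "Sw H (\<iota> x) (\<lambda>a b. H.chi a * H.chi b) = H.chi (\<iota> x) * of_nat (hdim H)"
    using H.chi_conv_left[OF mrep_regular[OF H.hopf], of "\<iota> x"]
    by (simp only: tr_def[symmetric] H.chi_def[symmetric] H.chi_one)
  moreover have "Sw H (\<iota> x) (\<lambda>a b. H.chi a * H.chi b) = Sw A x (\<lambda>a b. H.chi (\<iota> a) * H.chi (\<iota> b))"
    by (rule iota_Sw) (intro lin H.flin_chi)+
  ultimately show ?thesis by (simp add: chiH_def)
qed

lemma chiH_idempotent: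
  assumes q: "q \<in> vecs (hdim A)" "hmul A q q = q"
  shows "\<exists>n. chiH q = of_nat n"
proof -
  have "hmul H (\<iota> q) (\<iota> q) = \<iota> q" using q(2) iota_mul[of q q] by simp
  then show ?thesis using H.chi_idempotent[OF iota_vecs] unfolding chiH_def by blast
qed

lemma chiH_commute: "chiH (hmul A x y) = chiH (hmul A y x)"
  by (simp add: chiH_def iota_mul H.chi_commute)

end

text \<open>A minimum of f/g exists because the denominators are at most \<open>D\<close>, so that
  all ratios times \<open>fact D\<close> are natural numbers. The conclusion is cross-multiplied to
  avoid division.\<close>

lemma minimal_ratio:
  fixes f g :: "'a \<Rightarrow> nat"
  assumes "x0 \<in> X" "\<And>x. x \<in> X \<Longrightarrow> 0 < g x \<and> g x \<le> D"
  obtains x where "x \<in> X" "\<And>y. y \<in> X \<Longrightarrow> f x * g y \<le> f y * g x"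
proof -
  define m where "m x = f x * (fact D div g x)" for x
  obtain x where x: "x \<in> X" "\<And>y. y \<in> X \<Longrightarrow> m x \<le> m y"
    using ex_has_least_nat[of "\<lambda>x. x \<in> X" x0 m] assms(1) by blast
  have dv: "g y * (fact D div g y) = fact D" if "y \<in> X" for y
    using assms(2)[OF that] by (simp add: dvd_fact)
  have "f x * g y \<le> f y * g x" if y: "y \<in> X" for y
  proof -
    have "f x * g y * fact D = m x * (g x * g y)"
      unfolding m_def using dv[OF x(1)] by (simp add: ac_simps)
    also have "\<dots> \<le> m y * (g x * g y)" using x(2)[OF y] by simp
    also have "\<dots> = f y * g x * fact D"
      unfolding m_def using dv[OF y] by (simp add: ac_simps)
    finally show ?thesis by simp
  qed
  then show ?thesis using that x(1) by blast
qed

section \<open>The theorem of Nichols and Zoeller for semisimple subalgebras\<close>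

context hopf_sub
begin

text \<open>Maschke's average of \<open>\<kappa>\<close> over \<open>e\<close>: for a normalised
  integral the result is \<open>A\<close>-linear and still a retraction onto
  \<open>A\<close>.\<close>

definition retr where
  "retr e h = (\<lambda>k. Sw A e (\<lambda>a b. hmul A a (\<kappa> (hmul H (\<iota> (hS A b)) h)) k))" for e h

lemma flin_retr: "flin (hdim A) F \<Longrightarrow> F (retr e h) = Sw A e (\<lambda>a b. F (hmul A a (\<kappa> (hmul H (\<iota> (hS A b)) h))))"
  unfolding retr_def by (rule flin_Sw_vec)

lemma retr_vecs [simp]: "retr e h \<in> vecs (hdim A)"
  unfolding retr_def by (rule vecs_Sw) simp

lemma lmap_retr: "lmap (hdim H) (hdim A) (retr e)"
  by (rule lmapI[OF vlinI retr_vecs]) (unfold retr_def, intro lk)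

lemma retr_linear:
  assumes e: "A.nint e"
  shows "retr e (hmul H (\<iota> x) h) = hmul A x (retr e h)"
proof (rule vecs_eq_flinI[of _ "hdim A"])
  fix F :: "(nat \<Rightarrow> 'k) \<Rightarrow> 'k" assume F: "flin (hdim A) F"
  note c = lk flin_comp[OF F]
  have "F (retr e (hmul H (\<iota> x) h)) = Sw A e (\<lambda>a b. F (hmul A a (\<kappa> (hmul H (\<iota> (hmul A (hS A b) x)) h))))"
    unfolding flin_retr[OF F] iota_mul H.assoc ..
  also have "\<dots> = Sw A e (\<lambda>a b. F (hmul A (hmul A x a) (\<kappa> (hmul H (\<iota> (hS A b)) h))))"
    by (rule A.nint_move_left[OF e, where B="\<lambda>p s. F (hmul A p (\<kappa> (hmul H (\<iota> s) h)))"]) (intro c)+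
  also have "\<dots> = F (hmul A x (retr e h))"
    unfolding A.assoc by (rule flin_retr[where F="\<lambda>z. F (hmul A x z)", symmetric]) (intro c)
  finally show "F (retr e (hmul H (\<iota> x) h)) = F (hmul A x (retr e h))" .
qed simp_all

lemma retr_iota:
  assumes e: "A.nint e" and x: "x \<in> vecs (hdim A)"
  shows "retr e (\<iota> x) = x"
proof (rule vecs_eq_flinI[of _ "hdim A"])
  fix F :: "(nat \<Rightarrow> 'k) \<Rightarrow> 'k" assume F: "flin (hdim A) F"
  note c = lk flin_comp[OF F]
  have "F (retr e (\<iota> x)) = Sw A e (\<lambda>a b. F (hmul A (hmul A a (hS A b)) x))"
    unfolding flin_retr[OF F] by (simp only: iota_mul[symmetric] kappa_iota hmul_vecs A.assoc)
  also have "\<dots> = heps A e * F (hmul A (hone A) x)"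
    by (rule A.antipode_right[where F="\<lambda>z. F (hmul A z x)"]) (intro c)
  finally show "F (retr e (\<iota> x)) = F x" using A.nintD(2)[OF e] x by (simp add: A.one_left)
qed (use x in simp_all)

text \<open>The kernel of the \<open>A\<close>-linear retraction is a complement of \<open>A\<close>
  in \<open>H\<close>. It is represented on all of \<open>H\<close> by projecting onto it before
  multiplying; the part projected onto \<open>A\<close> has trace \<open>A.chi\<close> by
  cyclicity.\<close>

lemma chi_complement_rep:
  assumes e: "A.nint e"
  defines "\<rho> \<equiv> (\<lambda>x i j. hmul H (\<iota> x) (bs j - \<iota> (retr e (bs j))) i)"
  shows "mrep A (hdim H) \<rho>" and "(\<Sum>j<hdim H. \<rho> x j j) = chiH x - A.chi x"
proof -
  define pi where "pi v = \<iota> (retr e v)" for v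
  have pi: "lmap (hdim H) (hdim H) pi" unfolding pi_def
    by (rule lmapI) (auto intro!: lk lmap_vlin_comp[OF lmap_retr] simp: lmapD(1)[OF lmap_retr])
  have pi_lin: "pi (hmul H (\<iota> x) v) = hmul H (\<iota> x) (pi v)" for x v
    unfolding pi_def retr_linear[OF e] iota_mul ..
  have pi_pi: "pi (pi v) = pi v" for v unfolding pi_def by (simp add: retr_iota[OF e])
  have M0: "pi (hmul H (\<iota> y) (v - pi v)) = (\<lambda>_. 0)" for y v
    unfolding pi_lin lmap_minus[OF pi] pi_pi by (simp add: zero_fun_def[symmetric] hmul_0_right)
  show "mrep A (hdim H) \<rho>"
    unfolding mrep_def
  proof (intro conjI allI)
    show "flin (hdim A) (\<lambda>x. \<rho> x i j)" for i j unfolding \<rho>_def by (intro lk)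
    fix x y i j
    let ?w = "hmul H (\<iota> y) (bs j - pi (bs j))"
    have fl: "flin (hdim H) (\<lambda>v. hmul H (\<iota> x) (v - pi v) i)"
    proof -
      have "(\<lambda>v. hmul H (\<iota> x) (v - pi v) i) = (\<lambda>v. hmul H (\<iota> x) v i - hmul H (\<iota> x) (pi v) i)"
        by (simp add: hmul_minus_right)
      then show ?thesis by (simp only:) (intro lk lmap_vlin_comp[OF pi])
    qed
    have "\<rho> (hmul A x y) i j = hmul H (\<iota> x) (?w - pi ?w) i"
      unfolding \<rho>_def M0 iota_mul pi_def[symmetric] H.assoc by (simp add: zero_fun_def[symmetric])
    also have "\<dots> = (\<Sum>l<hdim H. ?w l * hmul H (\<iota> x) (bs l - pi (bs l)) i)"
      by (rule flinD[OF fl])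
    finally show "\<rho> (hmul A x y) i j = (\<Sum>l<hdim H. \<rho> x i l * \<rho> y l j)"
      unfolding \<rho>_def pi_def by (simp add: mult.commute)
  qed
  have "tr (hdim H) (\<lambda>v. hmul H (\<iota> x) (pi v)) = tr (hdim H) (\<lambda>v. \<iota> (hmul A x (retr e v)))"
    unfolding pi_def iota_mul ..
  also have "\<dots> = tr (hdim A) (\<lambda>u. retr e (\<iota> (hmul A x u)))"
    by (rule tr_cyclic[where F="\<lambda>u. \<iota> (hmul A x u)"]) (auto intro!: lk lmapD(1)[OF lmap_retr])
  also have "\<dots> = A.chi x" unfolding A.chi_def by (simp add: retr_iota[OF e])
  finally have "tr (hdim H) (\<lambda>v. hmul H (\<iota> x) (pi v)) = A.chi x" .
  then show "(\<Sum>j<hdim H. \<rho> x j j) = chiH x - A.chi x"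
    unfolding \<rho>_def pi_def[symmetric] chiH_tr hmul_minus_right tr_def by (simp add: sum_subtractf)
qed

text \<open>The argument of Nichols and Zoeller: an idempotent \<open>q\<close> of \<open>A\<close> minimising
  \<open>dim qH / dim qA\<close> shows that some multiple of the \<open>A\<close>-module \<open>H\<close> is free up to a complement
  which is killed by \<open>q\<close>, and this complement has to vanish.\<close>

theorem nichols_zoeller:
  assumes e: "A.nint e"
  shows "of_nat (hdim A) * chiH e = of_nat (hdim H)"
proof -
  define idem where "idem q \<longleftrightarrow> q \<in> vecs (hdim A) \<and> hmul A q q = q" for q
  have "\<forall>q. \<exists>n. idem q \<longrightarrow> chiH q = of_nat n" using chiH_idempotent unfolding idem_def by blast
  then obtain nf where nf: "\<And>q. idem q \<Longrightarrow> chiH q = of_nat (nf q)" by metis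
  have "\<forall>q. \<exists>n. idem q \<longrightarrow> n \<le> hdim A \<and> A.chi q = of_nat n \<and> (n = 0 \<longrightarrow> q = (\<lambda>_. 0))"
    using A.chi_idempotent unfolding idem_def by blast
  then obtain nc where nc: "\<And>q. idem q \<Longrightarrow> nc q \<le> hdim A \<and> A.chi q = of_nat (nc q) \<and> (nc q = 0 \<longrightarrow> q = (\<lambda>_. 0))"
    by metis
  have idem_one: "idem (hone A)" unfolding idem_def by (simp add: A.one_left)
  have idem_e: "idem e"
    unfolding idem_def using A.nintD[OF e] by simp
  have e_nz: "e \<noteq> (\<lambda>_. 0)" using A.nintD(2)[OF e] flin_zero[OF flin_eps[of A]] by auto
  obtain q0 where q0: "idem q0" "q0 \<noteq> (\<lambda>_. 0)"
    and min: "\<And>q. idem q \<Longrightarrow> q \<noteq> (\<lambda>_. 0) \<Longrightarrow> nf q0 * nc q \<le> nf q * nc q0"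
  proof (rule minimal_ratio[of e "{q. idem q \<and> q \<noteq> (\<lambda>_. 0)}" nc "hdim A" nf])
    show "e \<in> {q. idem q \<and> q \<noteq> (\<lambda>_. 0)}" using idem_e e_nz by simp
    show "\<And>x. x \<in> {q. idem q \<and> q \<noteq> (\<lambda>_. 0)} \<Longrightarrow> 0 < nc x \<and> nc x \<le> hdim A" using nc by auto
  qed (use that in auto)
  \<comment> \<open>These are the dimensions of q0 A and q0 H. The function \<open>g\<close> below
    plays the role of the character of a complement of A^m0 in H^n0: by minimality of the ratio it
    takes natural values on idempotents, and it vanishes at \<open>q0\<close>.\<close>
  define n0 m0 where "n0 = nc q0" and "m0 = nf q0"
  have n0: "0 < n0" using nc[OF q0(1)] q0(2) unfolding n0_def by auto
  define g where "g x = of_nat n0 * chiH x - of_nat m0 * A.chi x" for x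
  have fg: "flin (hdim A) g" unfolding g_def by (intro lin flin_chiH A.flin_chi)
  have gc: "g (hmul A x y) = g (hmul A y x)" for x y
    unfolding g_def by (simp add: chiH_commute[of x y] A.chi_commute[of x y])
  have gpos: "\<exists>n. g q = of_nat n" if q: "idem q" for q
  proof (cases "q = (\<lambda>_. 0)")
    case True
    then have "g q = of_nat 0" using flin_zero[OF fg] by simp
    then show ?thesis by blast
  next
    case False
    have "m0 * nc q \<le> n0 * nf q" using min[OF q False] unfolding n0_def m0_def by (simp add: mult.commute)
    then have "g q = of_nat (n0 * nf q - m0 * nc q)"
      unfolding g_def using nf[OF q] nc[OF q] by (simp add: of_nat_diff)
    then show ?thesis by blast
  qed
  have gq0: "g q0 = 0" unfolding g_def using nf[OF q0(1)] nc[OF q0(1)] by (simp add: n0_def m0_def)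
  let ?\<rho> = "\<lambda>x i j. hmul H (\<iota> x) (bs j - \<iota> (retr e (bs j))) i"
  \<comment> \<open>Convolution with \<open>chiH\<close> multiplies \<open>g\<close> by dim H, so
    the value at \<open>q0\<close> remains 0. Convolution with \<open>A.chi\<close> gives the free
    character g(1) \<open>A.chi\<close>, whose value at \<open>q0\<close> is
    \<open>s * n0\<close>.\<close>
  have g1: "Sw A q0 (\<lambda>a b. g a * chiH b) = 0"
  proof -
    have "Sw A q0 (\<lambda>a b. g a * chiH b)
      = of_nat n0 * Sw A q0 (\<lambda>a b. chiH a * chiH b) - of_nat m0 * Sw A q0 (\<lambda>a b. A.chi a * chiH b)"
      unfolding g_def Sw_scale[symmetric] Sw_diff[symmetric] by (simp add: left_diff_distrib mult.assoc)
    also have "\<dots> = g q0 * of_nat (hdim H)" unfolding conv_HH conv_AH g_def by (simp add: left_diff_distrib mult.assoc)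
    finally show ?thesis by (simp add: gq0)
  qed
  obtain s where s: "g (hone A) = of_nat s" using gpos[OF idem_one] by blast
  have g2: "Sw A q0 (\<lambda>a b. g a * A.chi b) = of_nat (s * n0)"
  proof -
    have "Sw A q0 (\<lambda>a b. g a * A.chi b)
      = of_nat n0 * Sw A q0 (\<lambda>a b. chiH a * A.chi b) - of_nat m0 * Sw A q0 (\<lambda>a b. A.chi a * A.chi b)"
      unfolding g_def Sw_scale[symmetric] Sw_diff[symmetric] by (simp add: left_diff_distrib mult.assoc)
    also have "\<dots> = g (hone A) * A.chi q0" unfolding conv_HA conv_AA g_def chiH_one A.chi_one
      by (simp add: left_diff_distrib right_diff_distrib ac_simps)
    finally show ?thesis using nc[OF q0(1)] s by (simp add: n0_def)
  qed
  \<comment> \<open>Tensoring with the complement of \<open>A\<close> in \<open>H\<close> keeps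
    \<open>g\<close> non-negative, but by the two values just computed the result at
    \<open>q0\<close> is -(s n0). Hence s = 0.\<close>
  have "\<exists>n. Sw A q0 (\<lambda>a b. g a * (\<Sum>j<hdim H. ?\<rho> b j j)) = of_nat n"
    by (rule A.positive_conv[OF e fg gc _ chi_complement_rep(1)[OF e]])
       (use gpos q0(1) in \<open>auto simp: idem_def\<close>)
  then obtain n where "Sw A q0 (\<lambda>a b. g a * (chiH b - A.chi b)) = of_nat n"
    unfolding chi_complement_rep(2)[OF e] by blast
  moreover have "Sw A q0 (\<lambda>a b. g a * (chiH b - A.chi b)) = Sw A q0 (\<lambda>a b. g a * chiH b) - Sw A q0 (\<lambda>a b. g a * A.chi b)"
    unfolding Sw_diff[symmetric] by (simp add: right_diff_distrib)
  ultimately have "of_nat n = 0 - (of_nat (s * n0) :: 'k)" unfolding g1 g2 by simp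
  then have "of_nat (n + s * n0) = (0 :: 'k)" unfolding of_nat_add by simp
  then have "s = 0" using n0 by (simp only: of_nat_eq_0_iff) simp
  then have g_one: "g (hone A) = 0" using s by simp
  \<comment> \<open>\<open>g\<close> is non-negative at \<open>e\<close> and at the complementary
    idempotent, and these values add up to g(1) = 0; so g(e) = 0, where \<open>A.chi\<close> has the
    value 1.\<close>
  have "idem (hone A - e)"
    unfolding idem_def using A.nintD(1)[OF e] idem_e unfolding idem_def
    by (simp add: vecs_minus hmul_minus_left hmul_minus_right A.one_left A.one_right)
  then obtain t where t: "g (hone A - e) = of_nat t" using gpos by blast
  obtain r where r: "g e = of_nat r" using gpos[OF idem_e] by blast
  have "g (hone A - e) = - g e" unfolding flin_minus_fun[OF fg] g_one by simp
  then have "of_nat (t + r) = (0 :: 'k)" using t r by simp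
  then have "r = 0" by (simp only: of_nat_eq_0_iff)
  then have "g e = 0" using r by simp
  then have 1: "of_nat n0 * chiH e = of_nat m0" unfolding g_def A.chi_nint[OF e] by simp
  have 2: "of_nat n0 * (of_nat (hdim H) :: 'k) = of_nat m0 * of_nat (hdim A)"
    using g_one unfolding g_def chiH_one A.chi_one by simp
  have "of_nat n0 * (of_nat (hdim A) * chiH e) = of_nat n0 * (of_nat (hdim H) :: 'k)"
    unfolding 2 1[symmetric] by (simp add: ac_simps)
  then show ?thesis using n0 by simp
qed

end

section \<open>Group-like elements\<close>

text \<open>The independence of distinct group-like elements, in a form that also fits their
  projections to \<open>eH\<close>: all it asks for is a way to realise products of the values of
  two functionals at the \<open>v i\<close>. Functionals are coded by coefficient vectors to match
  \<open>interpolation\<close>.\<close>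

lemma dual_functionals:
  fixes v :: "nat \<Rightarrow> nat \<Rightarrow> 'k::field"
  assumes v: "\<And>i. i < n \<Longrightarrow> v i \<in> vecs d"
    and dist: "\<And>i j. i < n \<Longrightarrow> j < n \<Longrightarrow> i \<noteq> j \<Longrightarrow> v i \<noteq> v j"
    and unit: "flin d U" "\<And>i. i < n \<Longrightarrow> U (v i) = 1"
    and mult: "\<And>F G. flin d F \<Longrightarrow> flin d G \<Longrightarrow> \<exists>K. flin d K \<and> (\<forall>i<n. K (v i) = F (v i) * G (v i))"
  shows "\<exists>\<kappa>. (\<forall>i<n. flin d (\<kappa> i)) \<and> (\<forall>i<n. \<forall>j<n. \<kappa> i (v j) = (if i = j then 1 else 0))"
proof -
  define a where "a i \<phi> = (\<Sum>k<d. \<phi> k * v i k)" for i \<phi>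
  define fn where "fn \<phi> x = (\<Sum>k<d. \<phi> k * x k)" for \<phi> x :: "nat \<Rightarrow> 'k"
  have ffn: "flin d (fn \<phi>)" for \<phi> unfolding fn_def by (intro lin) auto
  have rep: "F x = fn (\<lambda>k. F (bs k)) x" if "flin d F" for F x
    unfolding fn_def using flinD[OF that, of x] by (simp add: mult.commute)
  have a_fn: "a i \<phi> = fn \<phi> (v i)" for i \<phi> unfolding a_def fn_def ..
  obtain w where w: "\<And>i j. i \<in> {..<n} \<Longrightarrow> j \<in> {..<n} \<Longrightarrow> a i (w j) = (if i = j then 1 else 0)"
  proof (rule interpolation[of "{..<n}" a])
    fix x y :: "nat \<Rightarrow> 'k"
    obtain K where "flin d K" "\<forall>i<n. K (v i) = fn x (v i) * fn y (v i)"
      using mult[OF ffn ffn] by blast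
    then show "\<exists>z. \<forall>i\<in>{..<n}. a i z = a i x * a i y"
      unfolding a_fn by (intro exI[of _ "\<lambda>k. K (bs k)"]) (simp add: rep[symmetric])
    fix c s
    have "flin d (\<lambda>z. s * (fn x z - c * U z))" by (intro lin ffn unit(1))
    from rep[OF this] show "\<exists>z. \<forall>i\<in>{..<n}. a i z = s * (a i x - c)"
      unfolding a_fn using unit(2) by (intro exI[of _ "\<lambda>k. s * (fn x (bs k) - c * U (bs k))"]) (metis lessThan_iff mult.right_neutral)
  next
    show "\<exists>z. \<forall>i\<in>{..<n}. a i z = 1"
      unfolding a_fn using unit(2) rep[OF unit(1), symmetric] by (intro exI[of _ "\<lambda>k. U (bs k)"]) simp
    fix i j assume ij: "i \<in> {..<n}" "j \<in> {..<n}" "i \<noteq> j"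
    show "\<exists>x. a i x \<noteq> a j x"
    proof (rule ccontr)
      assume "\<not> ?thesis"
      then have eq: "a i x = a j x" for x by blast
      have "v i = v j"
      proof (rule vecs_eqI[of _ d])
        fix k assume "k < d"
        then show "v i k = v j k" using eq[of "bs k"] unfolding a_def by simp
      qed (use v ij in auto)
      then show False using dist ij by auto
    qed
  qed (use that in auto)
  then show ?thesis using ffn
    by (intro exI[of _ "\<lambda>j. fn (w j)"]) (auto simp: a_fn)
qed

section \<open>The dual pairing, characters, and orders of group-like elements\<close>

definition pair :: "nat \<Rightarrow> (nat \<Rightarrow> 'k::field) \<Rightarrow> (nat \<Rightarrow> 'k) \<Rightarrow> 'k" where
  "pair d \<phi> x = (\<Sum>i<d. \<phi> i * x i)"

lemma flin_pair: "flin d (pair d \<phi>)"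
  unfolding pair_def by (intro lin) auto

lemma flin_pair' [lin]: "vlin d' d f \<Longrightarrow> flin d' (\<lambda>v. pair d \<phi> (f v))"
  by (rule flin_comp[OF flin_pair])

lemma pair_bs: "i < d \<Longrightarrow> pair d \<phi> (bs i) = \<phi> i"
  unfolding pair_def by simp

lemma pair_vector:
  assumes F: "flin d F" shows "pair d (\<lambda>i. if i < d then F (bs i) else 0) x = F x"
  unfolding pair_def flinD[OF F, of x] by (simp add: mult.commute)

lemma pair_eqI: "\<phi> \<in> vecs d \<Longrightarrow> \<psi> \<in> vecs d \<Longrightarrow> (\<And>x. pair d \<phi> x = pair d \<psi> x) \<Longrightarrow> \<phi> = \<psi>"
  by (rule vecs_eqI[of _ d]) (auto simp: pair_bs[symmetric])

context hopf
begin

lemma pair_mul: "pair d (hmul (hdual H) \<phi> \<psi>) x = SW x (\<lambda>a b. pair d \<phi> a * pair d \<psi> b)"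
proof (rule flin_eqI[where v=x and d=d])
  fix k assume k: "k < d"
  show "pair d (hmul (hdual H) \<phi> \<psi>) (bs k) = SW (bs k) (\<lambda>a b. pair d \<phi> a * pair d \<psi> b)"
    using k by (simp add: pair_bs hmul_def Sw_bs ac_simps)
qed (intro lin flin_pair)+

lemma pair_one: "pair d (hone (hdual H)) x = eps x"
  unfolding pair_def hone_def heps_def by (simp add: mult.commute)

lemma pair_S: "pair d (hS (hdual H) \<phi>) x = pair d \<phi> (S x)"
proof (rule flin_eqI[where v=x and d=d])
  fix k assume k: "k < d"
  have "pair d \<phi> (S (bs k)) = (\<Sum>i<d. \<phi> i * hanti H k i)"
    unfolding pair_def by (rule sum.cong[OF refl]) (simp add: hS_bs k)
  then show "pair d (hS (hdual H) \<phi>) (bs k) = pair d \<phi> (S (bs k))"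
    using k by (simp add: pair_bs hS_def)
qed (intro lin flin_pair)+

lemma grouplike_dual:
  assumes b: "\<beta> \<in> vecs d"
  shows "grouplike (hdual H) \<beta> \<longleftrightarrow> pair d \<beta> one = 1 \<and> (\<forall>x y. pair d \<beta> (x \<odot> y) = pair d \<beta> x * pair d \<beta> y)"
proof -
  have e: "heps (hdual H) \<beta> = pair d \<beta> one"
    unfolding heps_def pair_def hone_def by simp
  have D: "hDelta (hdual H) \<beta> i j = pair d \<beta> (bs i \<odot> bs j)" if "i < d" "j < d" for i j
    unfolding pair_def hDelta_def using that by (simp add: hmul_bs)
  have "(\<forall>i<d. \<forall>j<d. hDelta (hdual H) \<beta> i j = \<beta> i * \<beta> j) \<longleftrightarrow>
     (\<forall>x y. pair d \<beta> (x \<odot> y) = pair d \<beta> x * pair d \<beta> y)" (is "?L \<longleftrightarrow> ?R")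
  proof
    assume L: ?L
    show ?R
    proof (intro allI)
      fix x y
      show "pair d \<beta> (x \<odot> y) = pair d \<beta> x * pair d \<beta> y"
      proof (rule flin_eqI[where v=x and d=d])
        fix i assume i: "i < d"
        show "pair d \<beta> (bs i \<odot> y) = pair d \<beta> (bs i) * pair d \<beta> y"
        proof (rule flin_eqI[where v=y and d=d])
          fix j assume j: "j < d"
          show "pair d \<beta> (bs i \<odot> bs j) = pair d \<beta> (bs i) * pair d \<beta> (bs j)"
            using L i j by (simp add: D[symmetric] pair_bs)
        qed (intro lin flin_pair)+
      qed (intro lin flin_pair)+
    qed
  next
    assume ?R then show ?L by (simp add: D pair_bs)
  qed
  then show ?thesis unfolding grouplike_def e using b by simp
qed

lemma grouplike_cancel:
  assumes g: "grouplike H g" and eq: "gpow H g i = gpow H g j" and "i < j"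
  shows "gpow H g (j - i) = one"
proof -
  have gi: "grouplike H (gpow H g i)" by (rule grouplike_gpow[OF g])
  have "gpow H g j = gpow H g i \<odot> gpow H g (j - i)"
    using gpow_add[of g i "j - i"] \<open>i < j\<close> by simp
  then have "S (gpow H g i) \<odot> gpow H g i = (S (gpow H g i) \<odot> gpow H g i) \<odot> gpow H g (j - i)"
    using eq by (simp add: assoc)
  then show ?thesis by (simp add: grouplike_inv[OF gi] one_left)
qed

lemma grouplike_dual_functionals:
  fixes v :: "nat \<Rightarrow> nat \<Rightarrow> 'k"
  assumes g: "\<And>i. i < n \<Longrightarrow> grouplike H (v i)"
    and dist: "\<And>i j. i < n \<Longrightarrow> j < n \<Longrightarrow> i \<noteq> j \<Longrightarrow> v i \<noteq> v j"
  shows "\<exists>\<kappa>. (\<forall>i<n. flin d (\<kappa> i)) \<and> (\<forall>i<n. \<forall>j<n. \<kappa> i (v j) = (if i = j then 1 else 0))"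
proof (rule dual_functionals[where U=eps])
  fix F G :: "(nat \<Rightarrow> 'k) \<Rightarrow> 'k" assume FG: "flin d F" "flin d G"
  show "\<exists>K. flin d K \<and> (\<forall>i<n. K (v i) = F (v i) * G (v i))"
  proof (intro exI conjI allI impI)
    show "flin d (\<lambda>x. SW x (\<lambda>a b. F a * G b))" by (intro lin)
    fix i assume "i < n"
    then show "SW (v i) (\<lambda>a b. F a * G b) = F (v i) * G (v i)"
      by (intro Sw_grouplike g) (assumption | intro lin FG)+
  qed
qed (use g dist grouplikeD flin_eps in auto)

text \<open>Otherwise \<open>Suc d\<close> distinct powers would be linearly independent.\<close>

lemma grouplike_finite_order:
  assumes g: "grouplike H g"
  shows "\<exists>N>0. gpow H g N = one"
proof (rule ccontr)
  assume no: "\<not> ?thesis"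
  have dist: "gpow H g i \<noteq> gpow H g j" if "i \<noteq> j" for i j
  proof
    assume eq: "gpow H g i = gpow H g j"
    show False
    proof (cases "i < j")
      case True
      then show ?thesis using no grouplike_cancel[OF g eq True] zero_less_diff by blast
    next
      case False
      with that have "j < i" by simp
      then show ?thesis using no grouplike_cancel[OF g eq[symmetric]] zero_less_diff by blast
    qed
  qed
  obtain \<kappa> where "\<forall>i<Suc d. flin d (\<kappa> i)" "\<forall>i<Suc d. \<forall>j<Suc d. \<kappa> i (gpow H g j) = (if i = j then 1 else 0)"
    using grouplike_dual_functionals[of "Suc d" "gpow H g", OF grouplike_gpow[OF g] dist] by blast
  then have "Suc d \<le> d" by (intro dual_family_le[of "Suc d" d \<kappa> "gpow H g"]) auto
  then show False by simp
qed

lemma gpow_distinct: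
  assumes g: "grouplike H g" "g \<noteq> one" and p: "prime p" "gpow H g p = one"
    and ij: "i < p" "j < p" "i \<noteq> j"
  shows "gpow H g i \<noteq> gpow H g j"
proof
  assume eq: "gpow H g i = gpow H g j"
  obtain k where k: "0 < k" "k < p" "gpow H g k = one"
  proof (cases "i < j")
    case True
    then show ?thesis using that[of "j - i"] grouplike_cancel[OF g(1) eq] ij by auto
  next
    case False
    then show ?thesis using that[of "i - j"] grouplike_cancel[OF g(1) eq[symmetric]] ij by auto
  qed
  \<comment> \<open>A Bezout relation k x = p y + 1 turns g^k = 1 and g^p = 1 into g = 1.\<close>
  have "coprime k p"
    using prime_imp_coprime[OF p(1), of k] k nat_dvd_not_less by (auto simp: coprime_commute)
  then obtain x y where xy: "k * x = p * y + 1" using bezout_nat[of k p] k(1) by auto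
  have "gpow H g (k * x) = one" unfolding gpow_mult k(3) by simp
  moreover have "gpow H g (p * y + 1) = g"
    unfolding gpow_add gpow_mult p(2) using gpow_1[OF grouplikeD(1)[OF g(1)]]
    by (simp add: one_left grouplikeD(1)[OF g(1)])
  ultimately show False using xy g(2) by simp
qed

lemma gpow_neq_one:
  assumes g: "grouplike H g" "g \<noteq> one" and p: "prime p" "gpow H g p = one" and k: "0 < k" "k < p"
  shows "gpow H g k \<noteq> one"
  using gpow_distinct[OF g p k(2), of 0] k by simp

end

text \<open>The group algebra of the cyclic group of order \<open>p\<close>, with the group elements
  as basis. It serves as the subalgebra in \<open>nichols_zoeller\<close> when Lagrange's theorem is
  derived.\<close>

definition cyclic_alg :: "nat \<Rightarrow> 'k::field hopf_data" where
  "cyclic_alg p = \<lparr>hdim = p, hmult = (\<lambda>i j r. bs ((i + j) mod p) r), hunit = bs 0,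
     hcomult = (\<lambda>i a b. bs i a * bs i b), hcounit = (\<lambda>i. 1), hanti = (\<lambda>i j. bs ((p - i) mod p) j)\<rparr>"

lemma cyclic_sel [simp]: "hdim (cyclic_alg p) = p" "hmult (cyclic_alg p) i j r = bs ((i + j) mod p) r"
  "hunit (cyclic_alg p) = bs 0" "hcomult (cyclic_alg p) i a b = bs i a * bs i b"
  "hcounit (cyclic_alg p) i = 1" "hanti (cyclic_alg p) i j = bs ((p - i) mod p) j"
  by (simp_all add: cyclic_alg_def)

lemma bs_apply: "bs i j = (if j = i then 1 else 0)" by (simp add: bs_def)

lemma cyclic_hopf:
  assumes p: "p > 0"
  shows "is_hopf_algebra (cyclic_alg p :: 'k::field hopf_data)"
  unfolding is_hopf_algebra_def Let_def cyclic_sel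
proof (intro conjI allI impI)
  fix i j k l assume "i < p" "j < p" "k < p" "l < p"
  then show "(\<Sum>r<p. bs ((i + j) mod p) r * bs ((r + k) mod p) l) =
       (\<Sum>r<p. bs ((j + k) mod p) r * (bs ((i + r) mod p) l :: 'k))"
    using p by (simp add: mod_simps add.assoc)
next
  fix i l assume "i < p" "l < p"
  then show "(\<Sum>r<p. bs 0 r * bs ((r + i) mod p) l) = (if i = l then 1 else (0::'k))"
    "(\<Sum>r<p. bs 0 r * bs ((i + r) mod p) l) = (if i = l then 1 else (0::'k))"
    using p by (auto simp: bs_apply[of i l])
next
  fix i a b k assume "i < p"
  then show "(\<Sum>r<p. bs i r * bs i k * (bs r a * bs r b)) = (\<Sum>r<p. bs i a * bs i r * (bs r b * (bs r k :: 'k)))"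
    by (simp add: mult.assoc mult.left_commute[of "bs i a"])
next
  fix i k assume "i < p" "k < p"
  then show "(\<Sum>r<p. 1 * (bs i r * bs i k)) = (if i = k then 1 else (0::'k))"
    "(\<Sum>r<p. 1 * (bs i k * bs i r)) = (if i = k then 1 else (0::'k))"
    using sum_bs[of i "\<lambda>_. bs i k :: 'k" p] by (simp_all add: bs_apply[of i k] mult.commute)
next
  fix i j a b assume "i < p" "j < p" "a < p" "b < p"
  have 1: "(\<Sum>b2<p. bs i a1 * bs i b1 * (bs j a2 * bs j b2) * bs ((a1 + a2) mod p) a * bs ((b1 + b2) mod p) b)
     = bs i a1 * (bs i b1 * (bs j a2 * (bs ((a1 + a2) mod p) a * (bs ((b1 + j) mod p) b :: 'k))))" for a1 b1 a2
    using sum_bs[of j "\<lambda>b2. bs i a1 * (bs i b1 * (bs j a2 * (bs ((a1 + a2) mod p) a * bs ((b1 + b2) mod p) b)))" p] \<open>j < p\<close>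
    by (simp add: ac_simps)
  show "(\<Sum>r<p. bs ((i + j) mod p) r * (bs r a * bs r b)) =
    (\<Sum>a1<p. \<Sum>b1<p. \<Sum>a2<p. \<Sum>b2<p. bs i a1 * bs i b1 * (bs j a2 * bs j b2) * bs ((a1 + a2) mod p) a * (bs ((b1 + b2) mod p) b :: 'k))"
    unfolding 1 using \<open>i < p\<close> \<open>j < p\<close> p by (simp add: sum_distrib_left[symmetric])
next
  fix a b assume "a < p" "b < p"
  then show "(\<Sum>r<p. bs 0 r * (bs r a * bs r b)) = bs 0 a * (bs 0 b :: 'k)" using p by simp
next
  fix i j
  show "(\<Sum>r<p. bs ((i + j) mod p) r * 1) = 1 * (1::'k)" using p sum_bs[of "(i + j) mod p" "\<lambda>_. 1 :: 'k" p] by simp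
next
  show "(\<Sum>r<p. bs 0 r * 1) = (1::'k)" using p sum_bs[of 0 "\<lambda>_. 1 :: 'k" p] by simp
next
  fix i l assume il: "i < p" "l < p"
  have z: "((p - i) mod p + i) mod p = 0" "(i + (p - i) mod p) mod p = 0"
    using il by (simp_all add: mod_simps)
  have 1: "(\<Sum>b<p. bs i a * bs i b * (\<Sum>r<p. bs ((p - a) mod p) r * bs ((r + b) mod p) l)) = bs i a * (bs (((p - a) mod p + i) mod p) l :: 'k)" for a
    using sum_bs[of i "\<lambda>b. bs i a * (bs (((p - a) mod p + b) mod p) l :: 'k)" p] il p by (simp add: ac_simps)
  show "(\<Sum>a<p. \<Sum>b<p. bs i a * bs i b * (\<Sum>r<p. bs ((p - a) mod p) r * bs ((r + b) mod p) l)) = 1 * (bs 0 l :: 'k)"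
    unfolding 1 using il z by simp
  have 2: "(\<Sum>b<p. bs i a * bs i b * (\<Sum>r<p. bs ((p - b) mod p) r * bs ((a + r) mod p) l)) = bs i a * (bs ((a + (p - i) mod p) mod p) l :: 'k)" for a
    using sum_bs[of i "\<lambda>b. bs i a * (bs ((a + (p - b) mod p) mod p) l :: 'k)" p] il p by (simp add: ac_simps)
  show "(\<Sum>a<p. \<Sum>b<p. bs i a * bs i b * (\<Sum>r<p. bs ((p - b) mod p) r * bs ((a + r) mod p) l)) = 1 * (bs 0 l :: 'k)"
    unfolding 2 using il z by simp
qed

context hopf
begin

text \<open>The powers of \<open>g\<close> span a copy of the group algebra of a cyclic group of
  order \<open>p\<close>. This algebra has a normalised integral, so \<open>nichols_zoeller\<close>
  writes \<open>d\<close> as \<open>p\<close> times the value of a character at an idempotent, a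
  natural number.\<close>

theorem lagrange_prime:
  assumes g: "grouplike H g" "g \<noteq> one" and p: "prime p" "gpow H g p = one"
  shows "p dvd d"
proof -
  have p0: "p > 0" using p(1) prime_gt_0_nat by blast
  let ?A = "cyclic_alg p :: 'k hopf_data"
  obtain \<kappa>' where k': "\<forall>i<p. flin d (\<kappa>' i)" "\<forall>i<p. \<forall>j<p. \<kappa>' i (gpow H g j) = (if i = j then 1 else 0)"
    using grouplike_dual_functionals[of p "gpow H g", OF grouplike_gpow[OF g(1)] gpow_distinct[OF g p]] by blast
  define \<iota> where "\<iota> x = (\<lambda>k. \<Sum>i<p. x i * gpow H g i k)" for x
  define \<kappa> where "\<kappa> y = (\<lambda>i. if i < p then \<kappa>' i y else 0)" for y
  have ib: "\<iota> (bs i) = gpow H g i" if "i < p" for i using that by (simp add: \<iota>_def)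
  have fi: "flin p (\<lambda>x. \<iota> x k)" for k unfolding \<iota>_def by (intro lin) auto
  have li: "lmap p d \<iota>" by (rule lmapI[OF vlinI[OF fi]]) (simp add: \<iota>_def vecs_sum)
  have vi: "vlin d' p f \<Longrightarrow> vlin d' n (\<lambda>v. \<iota> (f v))" for d' n f by (rule lmap_vlin_comp[OF li])
  have gmod: "gpow H g (n mod p) = gpow H g n" for n
  proof -
    have "gpow H g n = gpow H g (p * (n div p) + n mod p)" by simp
    also have "\<dots> = gpow H g (n mod p)" unfolding gpow_add gpow_mult p(2) by (simp add: one_left)
    finally show ?thesis ..
  qed
  have mb: "hmul ?A (bs i) (bs j) = bs ((i + j) mod p)" if "i < p" "j < p" for i j
    by (rule vecs_eqI[of _ p]) (use that p0 in \<open>auto simp: hmul_bs\<close>, metis cyclic_sel(1) hmul_vecs)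
  interpret A: hopf ?A by unfold_locales (rule cyclic_hopf[OF p0])
  interpret sub: hopf_sub ?A H \<iota> \<kappa>
  proof (unfold_locales, unfold cyclic_sel)
    show "lmap p d \<iota>" by (rule li)
    show "lmap d p \<kappa>" by (rule lmapI, rule vlinI) (use k'(1) in \<open>simp_all add: \<kappa>_def vecs_def\<close>)
    show "\<kappa> (\<iota> x) = x" if x: "x \<in> vecs p" for x
    proof (rule vecs_eqI[OF _ x])
      show "\<kappa> (\<iota> x) \<in> vecs p" by (simp add: \<kappa>_def vecs_def)
      fix i assume i: "i < p"
      have "\<kappa>' i (\<iota> x) = (\<Sum>j<p. x j * \<kappa>' i (gpow H g j))"
        by (rule flin_sum_apply[of d]) (use k'(1) i in \<open>auto simp: \<iota>_def\<close>)
      also have "\<dots> = (\<Sum>j<p. if j = i then x j else 0)"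
        by (rule sum.cong) (use k'(2) i in auto)
      finally show "\<kappa> (\<iota> x) i = x i" using i by (simp add: \<kappa>_def)
    qed
    show "\<iota> (hmul ?A x y) = \<iota> x \<odot> \<iota> y" for x y
    proof (rule ext)
      fix k
      show "\<iota> (hmul ?A x y) k = (\<iota> x \<odot> \<iota> y) k"
      proof (rule flin_eqI[where v=x and d=p])
        fix i assume i: "i < p"
        show "\<iota> (hmul ?A (bs i) y) k = (\<iota> (bs i) \<odot> \<iota> y) k"
        proof (rule flin_eqI[where v=y and d=p])
          fix j assume j: "j < p"
          show "\<iota> (hmul ?A (bs i) (bs j)) k = (\<iota> (bs i) \<odot> \<iota> (bs j)) k"
            using i j p0 by (simp add: mb ib gmod gpow_add)
        qed (rule flin_comp[OF fi], intro lin vi, simp, intro lin vi)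
      qed (rule flin_comp[OF fi], intro lin vi, simp, intro lin vi)
    qed
    show "\<iota> (hone ?A) = one"
    proof -
      have "hone ?A = bs 0" using p0 by (auto simp: hone_def bs_def fun_eq_iff)
      then show ?thesis using ib[OF p0] by simp
    qed
    fix B :: "(nat \<Rightarrow> 'k) \<Rightarrow> (nat \<Rightarrow> 'k) \<Rightarrow> 'k" and x
    assume B: "\<And>y. flin d (\<lambda>x. B x y)" "\<And>x. flin d (B x)"
    show "SW (\<iota> x) B = Sw ?A x (\<lambda>a b. B (\<iota> a) (\<iota> b))"
    proof (rule flin_eqI[where v=x and d=p])
      show "flin p (\<lambda>v. SW (\<iota> v) B)" by (intro lin vi)
      show "flin p (\<lambda>v. Sw ?A v (\<lambda>a b. B (\<iota> a) (\<iota> b)))" by (rule flin_Sw1) (simp add: vlin_id)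
      fix i assume i: "i < p"
      have "SW (\<iota> (bs i)) B = B (gpow H g i) (gpow H g i)"
        unfolding ib[OF i] by (rule Sw_grouplike[OF grouplike_gpow[OF g(1)] B])
      moreover have "Sw ?A (bs i) (\<lambda>a b. B (\<iota> a) (\<iota> b)) = B (gpow H g i) (gpow H g i)"
      proof -
        have "Sw ?A (bs i) (\<lambda>a b. B (\<iota> a) (\<iota> b)) = (\<Sum>a<p. bs i a * (\<Sum>b<p. bs i b * B (\<iota> (bs a)) (\<iota> (bs b))))"
          using i by (simp add: Sw_bs sum_distrib_left mult.assoc del: sum_bs)
        then show ?thesis using i by (simp add: ib)
      qed
      ultimately show "SW (\<iota> (bs i)) B = Sw ?A (bs i) (\<lambda>a b. B (\<iota> a) (\<iota> b))" by simp
    qed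
  qed
  \<comment> \<open>The average of the group elements; it is invariant because multiplication by a
    group element permutes the basis.\<close>
  define e :: "nat \<Rightarrow> 'k" where "e = (\<lambda>i. if i < p then 1 / of_nat p else 0)"
  have pk: "(of_nat p :: 'k) \<noteq> 0" using p0 by simp
  have shift: "bij_betw (\<lambda>j. (i + j) mod p) {..<p} {..<p}" if "i < p" for i
  proof (rule bij_betw_byWitness[where f'="\<lambda>j. ((p - i) + j) mod p"])
    have "(p - i + (i + a)) mod p = a" "(i + (p - i + a)) mod p = a" if "a < p" for a
      using \<open>i < p\<close> that by (simp_all add: add.assoc[symmetric])
    then show "\<forall>a\<in>{..<p}. (p - i + (i + a) mod p) mod p = a"
      "\<forall>a\<in>{..<p}. (i + (p - i + a) mod p) mod p = a"
      unfolding mod_add_right_eq by simp_all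
  qed (use p0 in auto)
  have be: "hmul ?A (bs i) e k = e k" if "i < p" "k < p" for i k
  proof -
    have "hmul ?A (bs i) e k = (\<Sum>j<p. (1 / of_nat p) * bs k ((i + j) mod p))"
      using that p0 by (subst hmul_bs_left) (auto simp: e_def bs_apply intro!: sum.cong)
    also have "\<dots> = (\<Sum>j<p. (1 / of_nat p) * bs k j)"
      by (rule sum.reindex_bij_betw[OF shift[OF that(1)]])
    also have "\<dots> = 1 / of_nat p" using that sum_bs'[of "\<lambda>_. 1 / of_nat p :: 'k" k p] by simp
    finally show ?thesis using that by (simp add: e_def)
  qed
  have eb: "hmul ?A e (bs i) k = e k" if "i < p" "k < p" for i k
  proof -
    have "hmul ?A e (bs i) k = hmul ?A (bs i) e k"
      using that by (subst hmul_bs_left, simp, simp, subst hmul_bs_right, simp, simp) (simp add: add.commute)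
    then show ?thesis using be that by simp
  qed
  have ev: "e \<in> vecs p" by (simp add: e_def vecs_def)
  have nint: "A.nint e"
    unfolding A.nint_def cyclic_sel
  proof (intro conjI allI)
    show "e \<in> vecs p" by (rule ev)
    show "heps ?A e = 1" using pk by (simp add: heps_def e_def)
    fix x
    show "hmul ?A x e = (\<lambda>i. heps ?A x * e i)"
    proof (rule vecs_eqI[of _ p])
      show "hmul ?A x e \<in> vecs p" using hmul_vecs[of ?A x e] by simp
      show "(\<lambda>i. heps ?A x * e i) \<in> vecs p" using ev by (simp add: vecs_def)
      fix k assume k: "k < p"
      show "hmul ?A x e k = heps ?A x * e k"
      proof (rule flin_eqI[where v=x and d=p])
        show "flin p (\<lambda>x. hmul ?A x e k)" by (rule flin_mulL_coord) (simp add: vlin_id)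
        show "flin p (\<lambda>x. heps ?A x * e k)" by (rule flin_mult_right, rule flin_heps) (simp add: vlin_id)
      qed (use k be in \<open>simp add: heps_bs\<close>)
    qed
    show "hmul ?A e x = (\<lambda>i. heps ?A x * e i)"
    proof (rule vecs_eqI[of _ p])
      show "hmul ?A e x \<in> vecs p" using hmul_vecs[of ?A e x] by simp
      show "(\<lambda>i. heps ?A x * e i) \<in> vecs p" using ev by (simp add: vecs_def)
      fix k assume k: "k < p"
      show "hmul ?A e x k = heps ?A x * e k"
      proof (rule flin_eqI[where v=x and d=p])
        show "flin p (\<lambda>x. hmul ?A e x k)" by (rule flin_mulR_coord) (simp add: vlin_id)
        show "flin p (\<lambda>x. heps ?A x * e k)" by (rule flin_mult_right, rule flin_heps) (simp add: vlin_id)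
      qed (use k eb in \<open>simp add: heps_bs\<close>)
    qed
  qed
  have "hmul ?A e e = e" using A.nintD[OF nint] by simp
  then obtain n where n: "sub.chiH e = of_nat n" using sub.chiH_idempotent[of e] ev by auto
  have "of_nat p * of_nat n = (of_nat d :: 'k)" using sub.nichols_zoeller[OF nint] n by simp
  then have "p * n = d" by (metis of_nat_eq_iff of_nat_mult)
  then show ?thesis by (metis dvd_triv_left)
qed

end

section \<open>Hopf subalgebras as Hopf algebras\<close>

text \<open>The axioms as Sweedler identities on basis vectors, the form in which they can be
  transported along an embedding.\<close>

lemma is_hopf_algebraI:
  fixes H :: "'k::field hopf_data"
  defines "d \<equiv> hdim H"
  assumes assoc: "\<And>i j k. i < d \<Longrightarrow> j < d \<Longrightarrow> k < d \<Longrightarrow> hmul H (hmul H (bs i) (bs j)) (bs k) = hmul H (bs i) (hmul H (bs j) (bs k))"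
    and unit: "\<And>i. i < d \<Longrightarrow> hmul H (hone H) (bs i) = bs i" "\<And>i. i < d \<Longrightarrow> hmul H (bs i) (hone H) = bs i"
    and coassoc: "\<And>i a b k. i < d \<Longrightarrow> a < d \<Longrightarrow> b < d \<Longrightarrow> k < d \<Longrightarrow>
      Sw H (bs i) (\<lambda>x y. Sw H x (\<lambda>u v. u a * v b) * y k) = Sw H (bs i) (\<lambda>x y. x a * Sw H y (\<lambda>u v. u b * v k))"
    and counit: "\<And>i k. i < d \<Longrightarrow> k < d \<Longrightarrow> Sw H (bs i) (\<lambda>x y. heps H x * y k) = bs i k"
      "\<And>i k. i < d \<Longrightarrow> k < d \<Longrightarrow> Sw H (bs i) (\<lambda>x y. heps H y * x k) = bs i k"
    and mult: "\<And>i j a b. i < d \<Longrightarrow> j < d \<Longrightarrow> a < d \<Longrightarrow> b < d \<Longrightarrow>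
      Sw H (hmul H (bs i) (bs j)) (\<lambda>u v. u a * v b) = Sw H (bs i) (\<lambda>p q. Sw H (bs j) (\<lambda>u v. hmul H p u a * hmul H q v b))"
    and one: "\<And>a b. a < d \<Longrightarrow> b < d \<Longrightarrow> Sw H (hone H) (\<lambda>u v. u a * v b) = hone H a * hone H b"
    and eps: "\<And>i j. i < d \<Longrightarrow> j < d \<Longrightarrow> heps H (hmul H (bs i) (bs j)) = heps H (bs i) * heps H (bs j)" "heps H (hone H) = 1"
    and anti: "\<And>i l. i < d \<Longrightarrow> l < d \<Longrightarrow> Sw H (bs i) (\<lambda>x y. hmul H (hS H x) y l) = heps H (bs i) * hone H l"
      "\<And>i l. i < d \<Longrightarrow> l < d \<Longrightarrow> Sw H (bs i) (\<lambda>x y. hmul H x (hS H y) l) = heps H (bs i) * hone H l"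
  shows "is_hopf_algebra H"
proof -
  have D: "hDelta H y a b = Sw H y (\<lambda>u v. u a * v b)" if "a < d" "b < d" for y a b
    using that unfolding Sw_def d_def by (simp add: mult.assoc[symmetric])
  have one_sum: "(\<Sum>r<d. hunit H r * f r) = (\<Sum>r<d. hone H r * f r)" for f :: "nat \<Rightarrow> 'k"
    by (simp add: hone_def d_def)
  show ?thesis
    unfolding is_hopf_algebra_def Let_def d_def[symmetric]
  proof (intro conjI allI impI)
    fix i j k l assume "i < d" "j < d" "k < d" "l < d"
    then show "(\<Sum>r<d. hmult H i j r * hmult H r k l) = (\<Sum>r<d. hmult H j k r * hmult H i r l)"
      using fun_cong[OF assoc[of i j k], of l] by (simp add: hmul_bs_left hmul_bs_right d_def)
  next
    fix i l assume il: "i < d" "l < d"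
    show "(\<Sum>r<d. hunit H r * hmult H r i l) = (if i = l then 1 else 0)"
      using fun_cong[OF unit(1)[OF il(1)], of l] il unfolding one_sum by (simp add: hmul_bs_right d_def bs_apply)
    show "(\<Sum>r<d. hunit H r * hmult H i r l) = (if i = l then 1 else 0)"
      using fun_cong[OF unit(2)[OF il(1)], of l] il unfolding one_sum by (simp add: hmul_bs_left d_def bs_apply)
  next
    fix i a b k assume l: "i < d" "a < d" "b < d" "k < d"
    have 1: "(\<Sum>r<d. hcomult H i r k * hcomult H r a b) = Sw H (bs i) (\<lambda>x y. Sw H x (\<lambda>u v. u a * v b) * y k)"
      unfolding D[OF l(2,3), symmetric] using l by (simp add: Sw_bs d_def hDelta_bs mult.assoc[symmetric])
    have "Sw H (bs i) (\<lambda>x y. x a * Sw H y (\<lambda>u v. u b * v k)) = (\<Sum>s<d. \<Sum>r<d. bs s a * (hcomult H i s r * hcomult H r b k))"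
      unfolding D[OF l(3,4), symmetric] using l by (simp add: Sw_bs d_def hDelta_bs ac_simps)
    also have "\<dots> = (\<Sum>r<d. hcomult H i a r * hcomult H r b k)"
      using l sum_bs2[of "\<lambda>s. \<Sum>r<d. hcomult H i s r * hcomult H r b k" a d]
      by (simp add: sum_distrib_left[symmetric] mult.commute)
    finally have 2: "Sw H (bs i) (\<lambda>x y. x a * Sw H y (\<lambda>u v. u b * v k)) = (\<Sum>r<d. hcomult H i a r * hcomult H r b k)" .
    show "(\<Sum>r<d. hcomult H i r k * hcomult H r a b) = (\<Sum>r<d. hcomult H i a r * hcomult H r b k)"
      unfolding 1 2[symmetric] by (rule coassoc[OF l])
  next
    fix i k assume l: "i < d" "k < d"
    have "Sw H (bs i) (\<lambda>x y. heps H x * y k) = (\<Sum>r<d. hcounit H r * hcomult H i r k)"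
      using l by (simp add: Sw_bs d_def heps_bs mult.assoc[symmetric] mult.commute[of "hcomult H _ _ _"])
    then show "(\<Sum>r<d. hcounit H r * hcomult H i r k) = (if i = k then 1 else 0)"
      using counit(1)[OF l] by (simp add: bs_apply eq_commute)
    have "Sw H (bs i) (\<lambda>x y. heps H y * x k) = (\<Sum>s<d. \<Sum>r<d. bs s k * (hcounit H r * hcomult H i s r))"
      using l by (simp add: Sw_bs d_def heps_bs ac_simps)
    also have "\<dots> = (\<Sum>r<d. hcounit H r * hcomult H i k r)"
      using l sum_bs2[of "\<lambda>s. \<Sum>r<d. hcounit H r * hcomult H i s r" k d]
      by (simp add: sum_distrib_left[symmetric] mult.commute)
    finally show "(\<Sum>r<d. hcounit H r * hcomult H i k r) = (if i = k then 1 else 0)"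
      using counit(2)[OF l] by (simp add: bs_apply eq_commute)
  next
    fix i j a b assume l: "i < d" "j < d" "a < d" "b < d"
    have "(\<Sum>r<d. hmult H i j r * hcomult H r a b) = hDelta H (hmul H (bs i) (bs j)) a b"
      using l by (simp add: hDelta_def d_def hmul_bs)
    also have "\<dots> = Sw H (bs i) (\<lambda>p q. Sw H (bs j) (\<lambda>u v. hmul H p u a * hmul H q v b))"
      unfolding D[OF l(3,4)] by (rule mult[OF l])
    also have "\<dots> = (\<Sum>a1<d. \<Sum>b1<d. \<Sum>a2<d. \<Sum>b2<d.
            hcomult H i a1 b1 * hcomult H j a2 b2 * hmult H a1 a2 a * hmult H b1 b2 b)"
      using l by (simp add: Sw_bs d_def hmul_bs sum_distrib_left mult.assoc)
    finally show "(\<Sum>r<d. hmult H i j r * hcomult H r a b) = (\<Sum>a1<d. \<Sum>b1<d. \<Sum>a2<d. \<Sum>b2<d.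
            hcomult H i a1 b1 * hcomult H j a2 b2 * hmult H a1 a2 a * hmult H b1 b2 b)" .
  next
    fix a b assume l: "a < d" "b < d"
    have "(\<Sum>r<d. hunit H r * hcomult H r a b) = hDelta H (hone H) a b"
      unfolding one_sum using l by (simp add: hDelta_def d_def)
    then show "(\<Sum>r<d. hunit H r * hcomult H r a b) = hunit H a * hunit H b"
      using one[OF l] l unfolding D[OF l] by (simp add: hone_def d_def)
  next
    fix i j assume l: "i < d" "j < d"
    show "(\<Sum>r<d. hmult H i j r * hcounit H r) = hcounit H i * hcounit H j"
      using eps(1)[OF l] l by (simp add: heps_bs d_def) (simp add: heps_def hmul_bs)
  next
    show "(\<Sum>r<d. hunit H r * hcounit H r) = 1"
      unfolding one_sum using eps(2) by (simp add: heps_def d_def)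
  next
    fix i l assume l: "i < d" "l < d"
    show "(\<Sum>a<d. \<Sum>b<d. hcomult H i a b * (\<Sum>r<d. hanti H a r * hmult H r b l)) = hcounit H i * hunit H l"
      using anti(1)[OF l] l by (simp add: Sw_bs d_def heps_bs hmul_bs_right hS_bs) (simp add: hone_def)
    show "(\<Sum>a<d. \<Sum>b<d. hcomult H i a b * (\<Sum>r<d. hanti H b r * hmult H a r l)) = hcounit H i * hunit H l"
      using anti(2)[OF l] l by (simp add: Sw_bs d_def heps_bs hmul_bs_left hS_bs) (simp add: hone_def)
  qed
qed

context hopf
begin

text \<open>The structure constants of a Hopf subalgebra with respect to a basis, where \<open>\<iota>\<close> is the
  inclusion and \<open>\<kappa>\<close> a linear retraction onto it.\<close>

definition sub_data :: "nat \<Rightarrow> ((nat \<Rightarrow> 'k) \<Rightarrow> nat \<Rightarrow> 'k) \<Rightarrow> ((nat \<Rightarrow> 'k) \<Rightarrow> nat \<Rightarrow> 'k) \<Rightarrow> 'k hopf_data" where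
  "sub_data m \<iota> \<kappa> = \<lparr>hdim = m, hmult = (\<lambda>i j r. \<kappa> (\<iota> (bs i) \<odot> \<iota> (bs j)) r), hunit = \<kappa> one,
     hcomult = (\<lambda>i a b. SW (\<iota> (bs i)) (\<lambda>x y. \<kappa> x a * \<kappa> y b)), hcounit = (\<lambda>i. eps (\<iota> (bs i))),
     hanti = (\<lambda>i j. \<kappa> (S (\<iota> (bs i))) j)\<rparr>"

text \<open>The crux is \<open>SwA\<close>: Sweedler sums over the new structure constants agree
  with those in \<open>H\<close>. All axioms are then inherited from \<open>H\<close>, as
  \<open>\<kappa>\<close> inverts \<open>\<iota>\<close>.\<close>

lemma hopf_sub_of_subalgebra:
  fixes K :: "(nat \<Rightarrow> 'k) set"
  assumes K: "is_hopf_subalgebra H K" and dim: "has_dim K m"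
  shows "\<exists>A \<iota> \<kappa>. hopf_sub A H \<iota> \<kappa> \<and> hdim A = m \<and> range \<iota> = K"
proof -
  have Ksub: "subsp d K" and K1: "one \<in> K" and Km: "\<And>x y. x \<in> K \<Longrightarrow> y \<in> K \<Longrightarrow> x \<odot> y \<in> K"
    and KD: "\<And>x. x \<in> K \<Longrightarrow> hDelta H x \<in> tensor_sq K" and KS: "\<And>x. x \<in> K \<Longrightarrow> S x \<in> K"
    using K unfolding is_hopf_subalgebra_def subsp_is_subspace by blast+
  obtain Bs where Bs: "finite Bs" "card Bs = m" "Bs \<subseteq> K" "lin_indep Bs" "K = lin_span Bs"
    using dim unfolding has_dim_def by blast
  obtain b where b: "bij_betw b {..<m} Bs"
    using ex_bij_betw_nat_finite[OF Bs(1)] Bs(2) unfolding atLeast0LessThan by blast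
  define \<iota> where "\<iota> x = (\<lambda>k. \<Sum>i<m. x i * b i k)" for x :: "nat \<Rightarrow> 'k"
  have bK: "i < m \<Longrightarrow> b i \<in> K" for i using b Bs(3) unfolding bij_betw_def by auto
  have iK: "\<iota> x \<in> K" for x unfolding \<iota>_def by (rule subsp_sum[OF Ksub]) (use bK in auto)
  have fi: "flin m (\<lambda>x. \<iota> x k)" for k unfolding \<iota>_def by (intro lin) auto
  have li: "lmap m d \<iota>" by (rule lmapI[OF vlinI[OF fi]]) (rule subspD(1)[OF Ksub iK])
  have inj: "x = (\<lambda>_. 0)" if x: "x \<in> vecs m" "\<iota> x = (\<lambda>_. 0)" for x
  proof -
    define c where "c v = x (the_inv_into {..<m} b v)" for v
    have cb: "c (b i) = x i" if "i < m" for i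
      unfolding c_def using the_inv_into_f_f[of b "{..<m}" i] b that unfolding bij_betw_def by simp
    have "(\<Sum>v\<in>Bs. c v * v j) = 0" for j
    proof -
      have "(\<Sum>v\<in>Bs. c v * v j) = (\<Sum>i<m. c (b i) * b i j)"
        by (rule sum.reindex_bij_betw[OF b, symmetric])
      also have "\<dots> = \<iota> x j" unfolding \<iota>_def by (simp add: cb)
      finally show ?thesis using x(2) by simp
    qed
    then have "\<forall>v\<in>Bs. c v = 0" using Bs(4) unfolding lin_indep_def by blast
    then have "x i = 0" if "i < m" for i using cb[OF that] b that unfolding bij_betw_def by auto
    then show ?thesis by (intro vecs_eqI[OF x(1)]) auto
  qed
  obtain \<kappa> where lk: "lmap d m \<kappa>" and ki: "\<And>x. x \<in> vecs m \<Longrightarrow> \<kappa> (\<iota> x) = x"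
    using linear_left_inverse[OF li inj] by blast
  have rng: "range \<iota> = K"
  proof
    show "range \<iota> \<subseteq> K" using iK by blast
    show "K \<subseteq> range \<iota>"
    proof
      fix x assume "x \<in> K"
      then obtain c where "x = (\<lambda>j. \<Sum>v\<in>Bs. c v * v j)" using Bs(5) unfolding lin_span_def by blast
      then have "x = \<iota> (\<lambda>i. c (b i))"
        unfolding \<iota>_def using sum.reindex_bij_betw[OF b, of "\<lambda>v. c v * v j" for j] by auto
      then show "x \<in> range \<iota>" by (rule range_eqI[where f=\<iota> and x="\<lambda>i. c (b i)"])
    qed
  qed
  have ik: "\<iota> (\<kappa> x) = x" if xK: "x \<in> K" for x
  proof -
    obtain y where "x = \<iota> y" using xK unfolding rng[symmetric] by blast
    then have "x = \<iota> (trunc m y)" by (simp add: lmap_trunc[OF li])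
    then show ?thesis using ki[OF trunc_vecs] by simp
  qed
  have vi: "vlin d' m f \<Longrightarrow> vlin d' n (\<lambda>v. \<iota> (f v))" for d' n f by (rule lmap_vlin_comp[OF li])
  have vk: "vlin d' d f \<Longrightarrow> vlin d' n (\<lambda>v. \<kappa> (f v))" for d' n f by (rule lmap_vlin_comp[OF lk])
  have fk: "flin d (\<lambda>v. \<kappa> v i)" for i by (rule lmap_flin[OF lk])
  note c = lin vi vk fk flin_comp[OF fk]
  have kv: "\<kappa> x \<in> vecs m" for x by (rule lmapD(2)[OF lk])
  define A where "A = sub_data m \<iota> \<kappa>"
  have Asel [simp]: "hdim A = m" "hmult A i j r = \<kappa> (\<iota> (bs i) \<odot> \<iota> (bs j)) r" "hunit A r = \<kappa> one r"
     "hcomult A i a b' = SW (\<iota> (bs i)) (\<lambda>x y. \<kappa> x a * \<kappa> y b')" "hcounit A i = eps (\<iota> (bs i))"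
     "hanti A i j = \<kappa> (S (\<iota> (bs i))) j" for i j r a b'
    by (simp_all add: A_def sub_data_def)
  have Av [simp]: "hmul A x y \<in> vecs m" "hone A \<in> vecs m" "hS A x \<in> vecs m" for x y
    using hmul_vecs[of A x y] hone_vecs[of A] hS_vecs[of A x] by simp_all
  have mulA: "\<iota> (hmul A x y) = \<iota> x \<odot> \<iota> y" for x y
  proof (rule ext)
    fix k
    have c': "flin m (\<lambda>x. \<iota> (hmul A x y) k)" "flin m (\<lambda>y. \<iota> (hmul A x y) k)" for x y
      by (rule flin_comp[OF fi], rule vlin_mulL, simp add: vlin_id)
         (rule flin_comp[OF fi], rule vlin_mulR, simp add: vlin_id)
    show "\<iota> (hmul A x y) k = (\<iota> x \<odot> \<iota> y) k"
    proof (rule flin_eqI[where v=x and d=m])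
      fix i assume i: "i < m"
      show "\<iota> (hmul A (bs i) y) k = (\<iota> (bs i) \<odot> \<iota> y) k"
      proof (rule flin_eqI[where v=y and d=m])
        fix j assume j: "j < m"
        have "hmul A (bs i) (bs j) = \<kappa> (\<iota> (bs i) \<odot> \<iota> (bs j))"
          by (rule vecs_eqI[OF Av(1) kv]) (use i j in \<open>simp add: hmul_bs\<close>)
        then show "\<iota> (hmul A (bs i) (bs j)) k = (\<iota> (bs i) \<odot> \<iota> (bs j)) k"
          by (simp add: ik[OF Km[OF iK iK]])
      qed (rule c', intro c)
    qed (rule c', intro c)
  qed
  have oneA: "hone A = \<kappa> one"
    by (rule vecs_eqI[OF Av(2) kv]) (simp add: hone_def)
  have i1: "\<iota> (hone A) = one" unfolding oneA by (rule ik[OF K1])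
  have SA: "\<iota> (hS A x) = S (\<iota> x)" for x
  proof (rule ext)
    fix k
    show "\<iota> (hS A x) k = S (\<iota> x) k"
    proof (rule flin_eqI[where v=x and d=m])
      show "flin m (\<lambda>x. \<iota> (hS A x) k)" by (rule flin_comp[OF fi], rule vlin_S) (simp add: vlin_id)
      show "flin m (\<lambda>x. S (\<iota> x) k)" by (intro c)
      fix i assume i: "i < m"
      have "hS A (bs i) = \<kappa> (S (\<iota> (bs i)))"
        by (rule vecs_eqI[OF Av(3) kv]) (use i in \<open>simp add: hS_bs\<close>)
      then show "\<iota> (hS A (bs i)) k = S (\<iota> (bs i)) k" by (simp add: ik[OF KS[OF iK]])
    qed
  qed
  have epsA: "heps A x = eps (\<iota> x)" for x
  proof (rule flin_eqI[where v=x and d=m])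
    show "flin m (heps A)" using flin_eps[of A] by simp
    show "flin m (\<lambda>x. eps (\<iota> x))" by (intro c)
  qed (simp add: heps_bs)
  \<comment> \<open>The coproduct of \<open>x\<close> is a sum of tensors of vectors of
    \<open>K\<close>, and each of these is fixed by \<open>\<kappa>\<close> followed by
    \<open>\<iota>\<close>.\<close>
  have retrK: "SW x (\<lambda>p q. B (\<iota> (\<kappa> p)) (\<iota> (\<kappa> q))) = SW x B"
    if x: "x \<in> K" and B: "\<And>y. flin d (\<lambda>x. B x y)" "\<And>x. flin d (B x)" for x B
  proof -
    obtain N :: nat and xs ys where T: "\<forall>q<N. xs q \<in> K \<and> ys q \<in> K" "hDelta H x = (\<lambda>a b. \<Sum>q<N. xs q a * ys q b)"
      using KD[OF x] unfolding tensor_sq_def by blast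
    have ex: "SW x C = (\<Sum>q<N. C (xs q) (ys q))" if C: "\<And>y. flin d (\<lambda>x. C x y)" "\<And>x. flin d (C x)" for C
    proof -
      have "SW x C = (\<Sum>a<d. \<Sum>b<d. \<Sum>q<N. xs q a * ys q b * C (bs a) (bs b))"
        unfolding Sw_def T(2) by (simp add: sum_distrib_right)
      also have "\<dots> = (\<Sum>a<d. \<Sum>q<N. \<Sum>b<d. xs q a * ys q b * C (bs a) (bs b))"
        by (rule sum.cong[OF refl], rule sum.swap)
      also have "\<dots> = (\<Sum>q<N. \<Sum>a<d. \<Sum>b<d. xs q a * ys q b * C (bs a) (bs b))" by (rule sum.swap)
      also have "\<dots> = (\<Sum>q<N. C (xs q) (ys q))" by (simp only: bilin_expand[OF C, symmetric])
      finally show ?thesis .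
    qed
    have "SW x (\<lambda>p q. B (\<iota> (\<kappa> p)) (\<iota> (\<kappa> q))) = (\<Sum>q<N. B (\<iota> (\<kappa> (xs q))) (\<iota> (\<kappa> (ys q))))"
      by (rule ex) (intro c flin_comp[OF B(1)] flin_comp[OF B(2)])+
    also have "\<dots> = (\<Sum>q<N. B (xs q) (ys q))" using T(1) by (simp add: ik)
    also have "\<dots> = SW x B" by (rule ex[OF B, symmetric])
    finally show ?thesis .
  qed
  have SwA: "Sw A x (\<lambda>a b. B (\<iota> a) (\<iota> b)) = SW (\<iota> x) B"
    if B: "\<And>y. flin d (\<lambda>x. B x y)" "\<And>x. flin d (B x)" for x B
  proof (rule flin_eqI[where v=x and d=m])
    show "flin m (\<lambda>v. Sw A v (\<lambda>a b. B (\<iota> a) (\<iota> b)))" by (rule flin_Sw1) (simp add: vlin_id)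
    show "flin m (\<lambda>v. SW (\<iota> v) B)" by (intro c)
    fix i assume i: "i < m"
    have "Sw A (bs i) (\<lambda>a b. B (\<iota> a) (\<iota> b)) = SW (\<iota> (bs i)) (\<lambda>x y. \<Sum>a<m. \<Sum>b'<m. \<kappa> x a * \<kappa> y b' * B (\<iota> (bs a)) (\<iota> (bs b')))"
      using i by (simp add: Sw_bs Sw_sum Sw_scale_right)
    also have "\<dots> = SW (\<iota> (bs i)) (\<lambda>x y. B (\<iota> (\<kappa> x)) (\<iota> (\<kappa> y)))"
      by (subst bilin_expand[where d=m and B="\<lambda>x y. B (\<iota> x) (\<iota> y)"])
         (intro c flin_comp[OF B(1)], intro c flin_comp[OF B(2)], rule refl)
    also have "\<dots> = SW (\<iota> (bs i)) B" by (rule retrK[OF iK B])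
    finally show "Sw A (bs i) (\<lambda>a b. B (\<iota> a) (\<iota> b)) = SW (\<iota> (bs i)) B" .
  qed
  have inj_eq: "x = y" if "x \<in> vecs m" "y \<in> vecs m" "\<iota> x = \<iota> y" for x y
  proof -
    have "\<kappa> (\<iota> x) = \<kappa> (\<iota> y)" by (simp only: that(3))
    then show ?thesis by (simp only: ki[OF that(1)] ki[OF that(2)])
  qed
  have SwA': "Sw A x (\<lambda>u v. u a * v b') = SW (\<iota> x) (\<lambda>u v. \<kappa> u a * \<kappa> v b')" for x a b'
  proof -
    have "Sw A x (\<lambda>u v. u a * v b') = Sw A x (\<lambda>u v. \<kappa> (\<iota> u) a * \<kappa> (\<iota> v) b')"
      by (rule Sw_cong) (simp add: ki)
    also have "\<dots> = SW (\<iota> x) (\<lambda>u v. \<kappa> u a * \<kappa> v b')"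
      by (rule SwA) (intro c)+
    finally show ?thesis .
  qed
  have "is_hopf_algebra A"
  proof (rule is_hopf_algebraI, unfold Asel(1))
    fix i j k assume l: "i < m" "j < m" "k < m"
    show "hmul A (hmul A (bs i) (bs j)) (bs k) = hmul A (bs i) (hmul A (bs j) (bs k))"
      by (rule inj_eq) (simp_all add: mulA assoc)
  next
    fix i assume i: "i < m"
    show "hmul A (hone A) (bs i) = bs i"
      by (rule inj_eq) (use i subspD(1)[OF Ksub iK] in \<open>simp_all add: mulA i1 one_left\<close>)
    show "hmul A (bs i) (hone A) = bs i"
      by (rule inj_eq) (use i subspD(1)[OF Ksub iK] in \<open>simp_all add: mulA i1 one_right\<close>)
  next
    fix i a b' k assume "i < m" "a < m" "b' < m" "k < m"
    have "Sw A (bs i) (\<lambda>x y. Sw A x (\<lambda>u v. u a * v b') * y k)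
       = Sw A (bs i) (\<lambda>x y. SW (\<iota> x) (\<lambda>u v. \<kappa> u a * \<kappa> v b') * \<kappa> (\<iota> y) k)"
      unfolding SwA' by (rule Sw_cong) (simp add: ki)
    also have "\<dots> = SW (\<iota> (bs i)) (\<lambda>x y. SW x (\<lambda>u v. \<kappa> u a * \<kappa> v b') * \<kappa> y k)"
      by (rule SwA) (intro c)+
    also have "\<dots> = SW (\<iota> (bs i)) (\<lambda>x y. SW x (\<lambda>u v. \<kappa> u a * \<kappa> v b' * \<kappa> y k))"
      by (simp only: Sw_scale_right)
    also have "\<dots> = SW (\<iota> (bs i)) (\<lambda>x y. SW y (\<lambda>u v. \<kappa> x a * \<kappa> u b' * \<kappa> v k))"
      by (rule coassoc)
    also have "\<dots> = SW (\<iota> (bs i)) (\<lambda>x y. \<kappa> x a * SW y (\<lambda>u v. \<kappa> u b' * \<kappa> v k))"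
      by (simp only: Sw_scale mult.assoc)
    also have "\<dots> = Sw A (bs i) (\<lambda>x y. \<kappa> (\<iota> x) a * SW (\<iota> y) (\<lambda>u v. \<kappa> u b' * \<kappa> v k))"
      by (rule SwA[symmetric]) (intro c)+
    also have "\<dots> = Sw A (bs i) (\<lambda>x y. x a * Sw A y (\<lambda>u v. u b' * v k))"
      unfolding SwA' by (rule Sw_cong) (simp add: ki)
    finally show "Sw A (bs i) (\<lambda>x y. Sw A x (\<lambda>u v. u a * v b') * y k) = Sw A (bs i) (\<lambda>x y. x a * Sw A y (\<lambda>u v. u b' * v k))" .
  next
    fix i k assume l: "i < m" "k < m"
    have "Sw A (bs i) (\<lambda>x y. heps A x * y k) = Sw A (bs i) (\<lambda>x y. eps (\<iota> x) * \<kappa> (\<iota> y) k)"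
      unfolding epsA by (rule Sw_cong) (simp add: ki)
    also have "\<dots> = SW (\<iota> (bs i)) (\<lambda>x y. eps x * \<kappa> y k)" by (rule SwA) (intro c)+
    also have "\<dots> = bs i k" using counit_left[OF fk] l by (simp add: ki)
    finally show "Sw A (bs i) (\<lambda>x y. heps A x * y k) = bs i k" .
    have "Sw A (bs i) (\<lambda>x y. heps A y * x k) = Sw A (bs i) (\<lambda>x y. eps (\<iota> y) * \<kappa> (\<iota> x) k)"
      unfolding epsA by (rule Sw_cong) (simp add: ki)
    also have "\<dots> = SW (\<iota> (bs i)) (\<lambda>x y. eps y * \<kappa> x k)" by (rule SwA) (intro c)+
    also have "\<dots> = bs i k" using counit_right[OF fk] l by (simp add: ki)
    finally show "Sw A (bs i) (\<lambda>x y. heps A y * x k) = bs i k" .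
  next
    fix i j a b' assume "i < m" "j < m" "a < m" "b' < m"
    have kmul: "\<kappa> (\<iota> p \<odot> \<iota> u) = hmul A p u" for p u using ki[OF Av(1)] by (simp add: mulA[symmetric])
    have "Sw A (hmul A (bs i) (bs j)) (\<lambda>u v. u a * v b') = SW (\<iota> (bs i) \<odot> \<iota> (bs j)) (\<lambda>u v. \<kappa> u a * \<kappa> v b')"
      unfolding SwA' mulA ..
    also have "\<dots> = SW (\<iota> (bs i)) (\<lambda>p q. SW (\<iota> (bs j)) (\<lambda>u v. \<kappa> (p \<odot> u) a * \<kappa> (q \<odot> v) b'))"
      by (rule Sw_mul) (intro c)+
    also have "\<dots> = Sw A (bs i) (\<lambda>p q. SW (\<iota> (bs j)) (\<lambda>u v. \<kappa> (\<iota> p \<odot> u) a * \<kappa> (\<iota> q \<odot> v) b'))"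
      by (rule SwA[symmetric]) (intro c)+
    also have "\<dots> = Sw A (bs i) (\<lambda>p q. Sw A (bs j) (\<lambda>u v. \<kappa> (\<iota> p \<odot> \<iota> u) a * \<kappa> (\<iota> q \<odot> \<iota> v) b'))"
      by (rule Sw_cong, rule SwA[symmetric]) (intro c)+
    finally show "Sw A (hmul A (bs i) (bs j)) (\<lambda>u v. u a * v b') = Sw A (bs i) (\<lambda>p q. Sw A (bs j) (\<lambda>u v. hmul A p u a * hmul A q v b'))"
      unfolding kmul .
  next
    fix a b' assume "a < m" "b' < m"
    have "Sw A (hone A) (\<lambda>u v. u a * v b') = SW one (\<lambda>u v. \<kappa> u a * \<kappa> v b')" unfolding SwA' i1 ..
    also have "\<dots> = \<kappa> one a * \<kappa> one b'" by (rule Sw_one) (intro c)+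
    finally show "Sw A (hone A) (\<lambda>u v. u a * v b') = hone A a * hone A b'" by (simp add: oneA)
  next
    show "heps A (hmul A (bs i) (bs j)) = heps A (bs i) * heps A (bs j)" for i j
      by (simp add: epsA mulA eps_mul)
    show "heps A (hone A) = 1" by (simp add: epsA i1 eps_one)
  next
    fix i l assume "i < m" "l < m"
    have "Sw A (bs i) (\<lambda>x y. hmul A (hS A x) y l) = Sw A (bs i) (\<lambda>x y. \<kappa> (S (\<iota> x) \<odot> \<iota> y) l)"
      by (simp add: SA[symmetric] mulA[symmetric] ki)
    also have "\<dots> = SW (\<iota> (bs i)) (\<lambda>x y. \<kappa> (S x \<odot> y) l)" by (rule SwA) (intro c)+
    also have "\<dots> = eps (\<iota> (bs i)) * \<kappa> one l" by (rule antipode_left[OF fk])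
    finally show "Sw A (bs i) (\<lambda>x y. hmul A (hS A x) y l) = heps A (bs i) * hone A l" by (simp add: epsA oneA)
    have "Sw A (bs i) (\<lambda>x y. hmul A x (hS A y) l) = Sw A (bs i) (\<lambda>x y. \<kappa> (\<iota> x \<odot> S (\<iota> y)) l)"
      by (simp add: SA[symmetric] mulA[symmetric] ki)
    also have "\<dots> = SW (\<iota> (bs i)) (\<lambda>x y. \<kappa> (x \<odot> S y) l)" by (rule SwA) (intro c)+
    also have "\<dots> = eps (\<iota> (bs i)) * \<kappa> one l" by (rule antipode_right[OF fk])
    finally show "Sw A (bs i) (\<lambda>x y. hmul A x (hS A y) l) = heps A (bs i) * hone A l" by (simp add: epsA oneA)
  qed
  then have "hopf_sub A H \<iota> \<kappa>"
    by (unfold_locales) (use li lk ki mulA i1 SwA in \<open>simp_all\<close>)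
  then show ?thesis using rng Asel(1) by blast
qed

end

section \<open>Semisimplicity in dimension \<open>2\<^sup>n p\<close>\<close>

context hopf
begin

text \<open>\<open>e\<close> absorbs factors of counit 1. With \<open>Si\<close> the inverse of
  \<open>S\<close>, absorption in e Si(e) gives S(e) = S(e Si(e)) = e S(e), and absorption in e S(e)
  gives \<open>e\<close>.\<close>

lemma nint_S:
  assumes e: "nint e" shows "S e = e"
proof -
  obtain Si where Si: "lop d Si" "\<And>x. x \<in> vecs d \<Longrightarrow> S (Si x) = x" using S_inverse_exists by blast
  have Se: "S (Si e) = e" by (rule Si(2)[OF nintD(1)[OF e]])
  have "eps (Si e) = 1" using eps_S[of "Si e"] unfolding Se nintD(2)[OF e] by simp
  then have "S (e \<odot> Si e) = S e" unfolding nintD(4)[OF e] by simp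
  then have "e \<odot> S e = S e" unfolding S_mul Se .
  moreover have "e \<odot> S e = e" unfolding nintD(4)[OF e] eps_S nintD(2)[OF e] by simp
  ultimately show ?thesis by metis
qed

text \<open>A power of \<open>g\<close> of odd prime order q would give q | 2^n p by
  \<open>lagrange_prime\<close>, so q = p, which \<open>np\<close> excludes. The induction strips
  prime factors off an exponent that kills \<open>g\<close>.\<close>

lemma grouplike_two_power_order:
  assumes np: "\<And>h. grouplike H h \<Longrightarrow> gpow H h p = one \<Longrightarrow> h = one"
    and d: "d = 2 ^ n * p" and p: "prime p"
    and g: "grouplike H g"
  shows "\<exists>a. gpow H g (2 ^ a) = one"
proof -
  have "\<exists>a. gpow H g (2 ^ a) = one" if "grouplike H g" "0 < N" "gpow H g N = one" for g N
    using that
  proof (induction N arbitrary: g rule: less_induct)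
    case (less N)
    show ?case
    proof (cases "N = 1")
      case True
      then have "gpow H g (2 ^ 0) = one" using less(4) by simp
      then show ?thesis by blast
    next
      case False
      then obtain q where q: "prime q" "q dvd N" using prime_factor_nat by blast
      then obtain M where M: "N = q * M" by (elim dvdE)
      have q1: "1 < q" using q(1) prime_gt_1_nat by blast
      have M0: "0 < M" "M < N" using less(3) M q1 by auto
      show ?thesis
      proof (cases "q = 2")
        case True
        obtain a where "gpow H (gpow H g 2) (2 ^ a) = one"
          using less(1)[OF M0(2) grouplike_gpow[OF less(2)] M0(1)] less(4) unfolding M True gpow_mult by blast
        then have "gpow H g (2 ^ Suc a) = one" by (simp add: gpow_mult)
        then show ?thesis by blast
      next
        case False
        let ?h = "gpow H g M"
        have h: "grouplike H ?h" "gpow H ?h q = one"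
          using grouplike_gpow[OF less(2)] less(4) unfolding M by (simp_all add: gpow_mult[symmetric] mult.commute)
        have "?h = one"
        proof (rule ccontr)
          assume ne: "?h \<noteq> one"
          then have "q dvd 2 ^ n * p" using lagrange_prime[OF h(1) _ q(1) h(2)] d by simp
          then have "q dvd 2 ^ n \<or> q dvd p" using q(1) by (simp add: prime_dvd_mult_iff)
          then have "q = p"
            using False q(1) p prime_dvd_power[of q 2 n] primes_dvd_imp_eq[of q 2] primes_dvd_imp_eq[of q p] by auto
          then show False using np[OF h(1)] h(2) ne by simp
        qed
        then show ?thesis using less(1)[OF M0(2) less(2) M0(1)] by blast
      qed
    qed
  qed
  then show ?thesis using grouplike_finite_order[OF g] g by blast
qed

end

section \<open>The order of the squared antipode\<close>

context hopf_int
begin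

lemma alpha_dual_grouplike:
  defines "av \<equiv> (\<lambda>i. if i < d then alpha (bs i) else 0)"
  shows "grouplike (hdual H) av" "pair d av x = alpha x"
proof -
  show pa: "pair d av x = alpha x" for x unfolding av_def by (rule pair_vector[OF flin_alpha])
  have "av \<in> vecs d" by (simp add: av_def vecs_def)
  then show "grouplike (hdual H) av"
    by (simp add: grouplike_dual pa alpha_mul alpha_one)
qed

text \<open>\<open>X\<close> and \<open>Z\<close> are the transposes of left and right
  multiplication by \<open>av\<close>, which is \<open>alpha\<close> as an element of the
  dual.\<close>

lemma X_Z_power:
  defines "av \<equiv> (\<lambda>i. if i < d then alpha (bs i) else 0)"
  assumes N: "gpow (hdual H) av N = hone (hdual H)" and a: "a \<in> vecs d"
  shows "(X ^^ N) a = a" "(Z ^^ N) a = a"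
proof -
  interpret D: hopf "hdual H" by unfold_locales (rule dual_hopf)
  have pa: "pair d av x = alpha x" for x unfolding av_def by (rule alpha_dual_grouplike(2))
  have av: "av \<in> vecs d" by (simp add: av_def vecs_def)
  have X: "pair d (hmul (hdual H) (gpow (hdual H) av n) \<phi>) x = pair d \<phi> ((X ^^ n) x)"
    if x: "x \<in> vecs d" and phi: "\<phi> \<in> vecs d" for n \<phi> x
    using x
  proof (induction n arbitrary: x)
    case 0 then show ?case using phi by (simp add: D.one_left)
  next
    case (Suc n)
    have "pair d (hmul (hdual H) (gpow (hdual H) av (Suc n)) \<phi>) x = pair d (hmul (hdual H) av (hmul (hdual H) (gpow (hdual H) av n) \<phi>)) x"
      by (simp add: D.gpow_Suc D.assoc)
    also have "\<dots> = pair d (hmul (hdual H) (gpow (hdual H) av n) \<phi>) (X x)"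
      unfolding pair_mul[of av] pa by (rule flin_X[OF flin_pair, symmetric])
    finally show ?case using Suc(1)[of "X x"] by (simp add: funpow_swap1)
  qed
  have Z: "pair d (hmul (hdual H) \<phi> (gpow (hdual H) av n)) x = pair d \<phi> ((Z ^^ n) x)"
    if x: "x \<in> vecs d" and phi: "\<phi> \<in> vecs d" for n \<phi> x
    using x
  proof (induction n arbitrary: x)
    case 0 then show ?case using phi by (simp add: D.one_right)
  next
    case (Suc n)
    have "pair d (hmul (hdual H) \<phi> (gpow (hdual H) av (Suc n))) x = pair d (hmul (hdual H) (hmul (hdual H) \<phi> (gpow (hdual H) av n)) av) x"
      using av by (simp add: D.gpow_Suc2 D.assoc)
    also have "\<dots> = pair d (hmul (hdual H) \<phi> (gpow (hdual H) av n)) (Z x)"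
      unfolding pair_mul[of _ av] pa flin_Z[OF flin_pair] by (simp only: mult.commute)
    finally show ?case using Suc(1)[of "Z x"] by (simp add: funpow_swap1)
  qed
  have v: "(X ^^ N) a \<in> vecs d" "(Z ^^ N) a \<in> vecs d" using a by (cases N; simp)+
  show "(X ^^ N) a = a"
  proof (rule vecs_eqI[OF v(1) a])
    fix i assume i: "i < d"
    then show "(X ^^ N) a i = a i" using X[OF a bs_vecs[OF i], of N] N bs_vecs[OF i]
      by (simp add: D.one_left pair_def)
  qed
  show "(Z ^^ N) a = a"
  proof (rule vecs_eqI[OF v(2) a])
    fix i assume i: "i < d"
    then show "(Z ^^ N) a i = a i" using Z[OF a bs_vecs[OF i], of N] N bs_vecs[OF i]
      by (simp add: D.one_right pair_def)
  qed
qed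

text \<open>\<open>radford_order\<close> reduces the claim to the orders of the two distinguished
  group-like elements, \<open>gr\<close> in the algebra and \<open>alpha\<close> in the
  dual.\<close>

lemma S_two_power_order:
  assumes H: "\<And>g. grouplike H g \<Longrightarrow> \<exists>a. gpow H g (2 ^ a) = one"
    and D: "\<And>g. grouplike (hdual H) g \<Longrightarrow> \<exists>a. gpow (hdual H) g (2 ^ a) = hone (hdual H)"
  shows "\<exists>a. \<forall>x\<in>vecs d. (T ^^ (2 ^ a)) x = x"
proof -
  interpret D: hopf "hdual H" by unfold_locales (rule dual_hopf)
  define av where "av = (\<lambda>i. if i < d then alpha (bs i) else 0)"
  obtain a1 where a1: "gpow H gr (2 ^ a1) = one" using H[OF gr_grouplike] by blast
  obtain a2 where a2: "gpow (hdual H) av (2 ^ a2) = hone (hdual H)"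
    using D[OF alpha_dual_grouplike(1)] unfolding av_def by blast
  let ?N = "2 ^ a1 * 2 ^ a2 :: nat"
  have "gpow H gr ?N = one" unfolding gpow_mult a1 by simp
  moreover have "gpow (hdual H) av (2 ^ a2 * 2 ^ a1) = hone (hdual H)" unfolding D.gpow_mult a2 by simp
  then have "gpow (hdual H) av ?N = hone (hdual H)" by (simp add: mult.commute)
  ultimately have "(T ^^ (2 * ?N)) x = x" if "x \<in> vecs d" for x
    by (intro radford_order that C_power X_Z_power) (simp_all add: av_def)
  moreover have "2 * ?N = 2 ^ Suc (a1 + a2)" by (simp add: power_add)
  ultimately show ?thesis by metis
qed

end

section \<open>Embeddings: counit, antipode, and the stabiliser of the integral\<close>

context hopf_sub
begin

lemma iota_eps: "heps H (\<iota> x) = heps A x"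
proof -
  have f: "flin (hdim H) (\<lambda>b. heps A (\<kappa> b))" by (intro lk)
  have "heps A (\<kappa> (\<iota> x)) = Sw H (\<iota> x) (\<lambda>a b. heps H a * heps A (\<kappa> b))"
    by (rule H.counit_left[OF f, symmetric])
  also have "\<dots> = Sw A x (\<lambda>a b. heps H (\<iota> a) * heps A (\<kappa> (\<iota> b)))"
    by (rule iota_Sw) (intro lk)+
  also have "\<dots> = Sw A x (\<lambda>a b. heps H (\<iota> a) * heps A b)"
    by (rule Sw_cong) (simp add: kappa_iota)
  also have "\<dots> = heps H (\<iota> x)" by (rule A.counit_right') (intro lk)
  also have "heps A (\<kappa> (\<iota> x)) = heps A x"
  proof -
    have "\<iota> (trunc (hdim A) x) = \<iota> x" by (rule lmap_trunc[OF iota])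
    then have "heps A (\<kappa> (\<iota> x)) = heps A (trunc (hdim A) x)" using kappa_iota[of "trunc (hdim A) x"] by simp
    also have "\<dots> = heps A x" by (rule flin_cong[OF flin_eps]) (simp add: trunc_def)
    finally show ?thesis .
  qed
  finally show ?thesis by simp
qed

text \<open>Both sides are convolution inverses of \<open>\<iota>\<close>.\<close>

lemma iota_S: "hS H (\<iota> x) = \<iota> (hS A x)"
proof (rule vecs_eq_flinI[of _ "hdim H"])
  fix F :: "(nat \<Rightarrow> 'k) \<Rightarrow> 'k" assume F: "flin (hdim H) F"
  note c = lk flin_comp[OF F]
  have "F (hS H (\<iota> x)) = Sw A x (\<lambda>a b. F (hS H (\<iota> a)) * heps A b)"
    by (rule A.counit_right'[symmetric]) (intro c)
  also have "\<dots> = Sw A x (\<lambda>a b. Sw A b (\<lambda>u v. F (hmul H (hS H (\<iota> a)) (\<iota> (hmul A u (hS A v))))))"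
  proof (rule Sw_cong)
    fix a b :: "nat \<Rightarrow> 'k"
    have "Sw A b (\<lambda>u v. F (hmul H (hS H (\<iota> a)) (\<iota> (hmul A u (hS A v))))) = heps A b * F (hmul H (hS H (\<iota> a)) (\<iota> (hone A)))"
      by (rule A.antipode_right[where F="\<lambda>z. F (hmul H (hS H (\<iota> a)) (\<iota> z))"]) (intro c)
    then show "F (hS H (\<iota> a)) * heps A b = Sw A b (\<lambda>u v. F (hmul H (hS H (\<iota> a)) (\<iota> (hmul A u (hS A v)))))"
      by (simp add: iota_one H.one_right mult.commute)
  qed
  also have "\<dots> = Sw A x (\<lambda>w v. Sw A w (\<lambda>a u. F (hmul H (hS H (\<iota> a)) (\<iota> (hmul A u (hS A v))))))"
    by (rule A.coassoc[symmetric])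
  also have "\<dots> = Sw A x (\<lambda>w v. Sw A w (\<lambda>a u. F (hmul H (hmul H (hS H (\<iota> a)) (\<iota> u)) (\<iota> (hS A v)))))"
    by (simp only: iota_mul H.assoc)
  also have "\<dots> = Sw A x (\<lambda>w v. Sw H (\<iota> w) (\<lambda>a u. F (hmul H (hmul H (hS H a) u) (\<iota> (hS A v)))))"
    by (rule Sw_cong, rule iota_Sw[symmetric]) (intro c)+
  also have "\<dots> = Sw A x (\<lambda>w v. heps A w * F (\<iota> (hS A v)))"
  proof -
    have "Sw H (\<iota> w) (\<lambda>a u. F (hmul H (hmul H (hS H a) u) (\<iota> (hS A v)))) = heps A w * F (\<iota> (hS A v))" for w v
      using H.antipode_left[of "\<lambda>z. F (hmul H z (\<iota> (hS A v)))" "\<iota> w"] by (simp add: c iota_eps H.one_left)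
    then show ?thesis by simp
  qed
  also have "\<dots> = F (\<iota> (hS A x))" by (rule A.counit_left) (intro c)
  finally show "F (hS H (\<iota> x)) = F (\<iota> (hS A x))" .
qed simp_all

text \<open>The left tensor factors of \<open>\<Delta>(e)\<close> span \<open>A\<close>; hence \<open>e g = e\<close> forces \<open>g \<in> A\<close>.\<close>

lemma grouplike_stabiliser:
  assumes e: "A.nint e" and g: "grouplike H g" and eg: "hmul H (\<iota> e) g = \<iota> e"
  shows "g \<in> range \<iota>"
proof -
  obtain lam Lam where "hopf_int A lam Lam" using A.hopf_int_exists by blast
  then interpret AI: hopf_int A lam Lam .
  have e_nz: "e \<noteq> (\<lambda>_. 0)" using A.nintD(2)[OF e] flin_zero[OF flin_eps[of A]] by auto
  have eL: "e = (\<lambda>i. lam e * Lam i)"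
    by (rule AI.left_integral_unique) (use A.nintD[OF e] in blast)+
  define s where "s = lam e"
  have s: "s \<noteq> 0" using eL e_nz unfolding s_def by auto
  \<comment> \<open>The vector e_1 lam(e_2) is \<open>s\<close> times the unit, and \<open>s\<close>
    is nonzero because \<open>e\<close> is a nonzero multiple of \<open>Lam\<close>.\<close>
  have base: "Sw A e (\<lambda>x y. F x * lam y) = s * F (hone A)" if F: "flin (hdim A) F" for F
  proof -
    have "Sw A e (\<lambda>x y. F x * lam y) = s * Sw A Lam (\<lambda>x y. F x * lam y)"
      unfolding s_def by (subst eL) (rule A.Sw_arg_scale)
    also have "Sw A Lam (\<lambda>x y. F x * lam y) = Sw A Lam (\<lambda>x y. F x * lam (hmul A (hone A) y))"
      by (rule Sw_cong) (simp add: A.one_left)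
    also have "\<dots> = F (hone A)" using AI.S_via_Lam[OF F, of "hone A"] by (simp add: A.S_one)
    finally show ?thesis .
  qed
  note lg = lk flin_comp[OF AI.flam]
  have inv: "hmul H (\<iota> e) (hS H g) = \<iota> e"
  proof -
    have "hmul H (\<iota> e) (hS H g) = hmul H (hmul H (\<iota> e) g) (hS H g)" by (simp only: eg)
    also have "\<dots> = \<iota> e" by (simp only: H.assoc H.grouplike_inv[OF g] H.one_right[OF iota_vecs])
    finally show ?thesis .
  qed
  \<comment> \<open>By \<open>inv\<close>, right multiplication by S(g) in both legs leaves Delta(e)
    unchanged. In s g = e_1 g lam(e_2) this cancels \<open>g\<close> in the first leg and puts S(g)
    into the second, where it only affects a scalar; so \<open>g\<close> is a combination of first
    legs of Delta(e).\<close>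
  define w where "w = (\<lambda>i. Sw A e (\<lambda>x y. inverse s * lam (\<kappa> (hmul H (\<iota> y) (hS H g))) * x i))"
  have "g = \<iota> w"
  proof (rule vecs_eq_flinI[of _ "hdim H"])
    show "g \<in> vecs (hdim H)" by (rule H.grouplikeD[OF g])
    fix F :: "(nat \<Rightarrow> 'k) \<Rightarrow> 'k" assume F: "flin (hdim H) F"
    note c = lg flin_comp[OF F] F
    have "s * F g = s * F (hmul H (\<iota> (hone A)) g)" by (simp add: iota_one H.one_left H.grouplikeD[OF g])
    also have "\<dots> = Sw A e (\<lambda>x y. F (hmul H (\<iota> x) g) * lam y)"
      by (rule base[symmetric]) (intro c)
    also have "\<dots> = Sw A e (\<lambda>x y. F (hmul H (\<iota> x) g) * lam (\<kappa> (\<iota> y)))"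
      by (rule Sw_cong) (simp add: kappa_iota)
    also have "\<dots> = Sw H (\<iota> e) (\<lambda>x y. F (hmul H x g) * lam (\<kappa> y))"
      by (rule iota_Sw[symmetric]) (intro c)+
    also have "\<dots> = Sw H (hmul H (\<iota> e) (hS H g)) (\<lambda>x y. F (hmul H x g) * lam (\<kappa> y))"
      by (simp only: inv)
    also have "\<dots> = Sw H (\<iota> e) (\<lambda>p q. Sw H (hS H g) (\<lambda>u v. F (hmul H (hmul H p u) g) * lam (\<kappa> (hmul H q v))))"
      by (rule H.Sw_mul) (intro c)+
    also have "\<dots> = Sw H (\<iota> e) (\<lambda>p q. F (hmul H (hmul H p (hS H g)) g) * lam (\<kappa> (hmul H q (hS H g))))"
      by (rule Sw_cong, rule H.Sw_grouplike[OF H.grouplike_S[OF g]]) (intro c)+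
    also have "\<dots> = Sw H (\<iota> e) (\<lambda>p q. F p * lam (\<kappa> (hmul H q (hS H g))))"
      by (rule Sw_cong) (simp add: H.assoc H.grouplike_inv[OF g] H.one_right)
    also have "\<dots> = Sw A e (\<lambda>x y. F (\<iota> x) * lam (\<kappa> (hmul H (\<iota> y) (hS H g))))"
      by (rule iota_Sw) (intro c)+
    finally have 1: "s * F g = Sw A e (\<lambda>x y. F (\<iota> x) * lam (\<kappa> (hmul H (\<iota> y) (hS H g))))" .
    have Fi: "flin (hdim A) (\<lambda>z. F (\<iota> z))" by (intro c)
    have "F (\<iota> w) = Sw A e (\<lambda>x y. F (\<iota> (\<lambda>i. inverse s * lam (\<kappa> (hmul H (\<iota> y) (hS H g))) * x i)))"
      unfolding w_def by (rule flin_Sw_vec[OF Fi])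
    also have "\<dots> = inverse s * Sw A e (\<lambda>x y. F (\<iota> x) * lam (\<kappa> (hmul H (\<iota> y) (hS H g))))"
      unfolding Sw_scale[symmetric] flin_scale[OF Fi] by (simp add: ac_simps)
    also have "\<dots> = F g" unfolding 1[symmetric] using s by simp
    finally show "F g = F (\<iota> w)" ..
  qed simp
  then show ?thesis by blast
qed

end

section \<open>The contradiction derived from an integral with counit 0\<close>

locale two_power_p = hopf_sub A H \<iota> \<kappa> + HI: hopf_int H lam Lam
  for A H :: "'k::field_char_0 hopf_data" and \<iota> \<kappa> lam Lam +
  fixes n p :: nat and e :: "nat \<Rightarrow> 'k"
  assumes dimA: "hdim A = 2 ^ n" and dimH: "hdim H = 2 ^ n * p"
    and p: "prime p" "odd p"
    and e: "A.nint e"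
    and not_ss: "heps H Lam = 0"
begin

definition E where "E = \<iota> e"

abbreviation "TT x \<equiv> hS H (hS H x)"

lemma E_vecs: "E \<in> vecs (hdim H)" unfolding E_def by simp

lemma E_iota: "hmul H E (\<iota> x) = (\<lambda>i. heps A x * E i)"
  unfolding E_def iota_mul[symmetric] A.nintD(4)[OF e] lmap_scale[OF iota] ..

lemma E_idem: "hmul H E (hmul H E x) = hmul H E x"
proof -
  have "hmul H E E = E" using E_iota[of e] A.nintD(2)[OF e] unfolding E_def by simp
  then show ?thesis by (simp add: H.assoc[symmetric])
qed

lemma E_S: "hS H E = E"
  unfolding E_def iota_S A.nint_S[OF e] ..

lemma E_TT: "TT (hmul H E x) = hmul H E (TT x)"
  by (simp add: H.S_mul E_S)

lemma lop_E: "lop (hdim H) (hmul H E)"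
  by (rule lop_mul_left)

lemma tr_E: "tr (hdim H) (hmul H E) = of_nat p"
proof -
  have "of_nat (2 ^ n) * chiH e = of_nat (2 ^ n) * (of_nat p :: 'k)"
    using nichols_zoeller[OF e] unfolding dimA dimH by (simp only: of_nat_mult)
  then have "chiH e = of_nat p" by simp
  then show ?thesis unfolding chiH_def H.chi_def E_def .
qed

lemma tr_E_TT: "tr (hdim H) (\<lambda>v. hmul H E (TT v)) = 0"
  unfolding HI.trace_mul_S_S not_ss by simp

lemma TT_not_trivial: "\<not> (\<forall>x. hmul H E (TT x) = hmul H E x)"
proof
  assume "\<forall>x. hmul H E (TT x) = hmul H E x"
  then have "tr (hdim H) (\<lambda>v. hmul H E (TT v)) = of_nat p" using tr_E by simp
  then show False using tr_E_TT p(1) by simp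
qed

lemma p_not_dvd: "\<not> p dvd 2 ^ n"
proof
  assume "p dvd 2 ^ n"
  then have "p dvd 2" using prime_dvd_power[OF p(1)] by blast
  then show False using p primes_dvd_imp_eq[of p 2] by auto
qed

text \<open>The vectors e h^i need not be group-like, but their coproduct becomes v_i tensor v_i
  once \<open>E\<close> is applied to both legs, and this suffices for independence. They are
  distinct: if e h^k = e, then h^k lies in \<open>A\<close> by \<open>grouplike_stabiliser\<close>
  and has order \<open>p\<close> there, although \<open>p\<close> does not divide dim A.\<close>

lemma no_grouplike_order_p:
  assumes h: "grouplike H h" and hp: "gpow H h p = hone H"
  shows "h = hone H"
proof (rule ccontr)
  assume ne: "h \<noteq> hone H"
  define v where "v i = hmul H E (gpow H h i)" for i
  have stab: "hmul H E (gpow H h k) \<noteq> E" if k: "0 < k" "k < p" for k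
  proof
    assume eq: "hmul H E (gpow H h k) = E"
    let ?g = "gpow H h k"
    have g: "grouplike H ?g" by (rule H.grouplike_gpow[OF h])
    have gne: "?g \<noteq> hone H" by (rule H.gpow_neq_one[OF h ne p(1) hp k])
    have gp: "gpow H ?g p = hone H" using hp by (metis H.gpow_mult H.gpow_one mult.commute)
    obtain a' where "?g = \<iota> a'" using grouplike_stabiliser[OF e g] eq unfolding E_def by blast
    then obtain a where a: "a \<in> vecs (hdim A)" "?g = \<iota> a"
      using lmap_trunc[OF iota] trunc_vecs by metis
    have inj: "x = y" if "x \<in> vecs (hdim A)" "y \<in> vecs (hdim A)" "\<iota> x = \<iota> y" for x y
    proof -
      have "\<kappa> (\<iota> x) = \<kappa> (\<iota> y)" by (simp only: that(3))
      then show ?thesis by (simp only: kappa_iota[OF that(1)] kappa_iota[OF that(2)])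
    qed
    have kc: "flin (hdim H) (\<lambda>v. \<kappa> v i)" for i by (rule lmap_flin[OF kappa])
    have ga: "grouplike A a"
    proof (rule A.grouplikeI[OF a(1)])
      show "heps A a = 1" using iota_eps[of a] H.grouplikeD(2)[OF g] a(2) by simp
      fix i j
      have "Sw A a (\<lambda>u v. u i * v j) = Sw A a (\<lambda>u v. \<kappa> (\<iota> u) i * \<kappa> (\<iota> v) j)"
        by (rule Sw_cong) (simp add: kappa_iota)
      also have "\<dots> = Sw H (\<iota> a) (\<lambda>u v. \<kappa> u i * \<kappa> v j)"
        by (rule iota_Sw[symmetric]) (intro lin kc)+
      also have "\<dots> = \<kappa> (\<iota> a) i * \<kappa> (\<iota> a) j"
        unfolding a(2)[symmetric] by (rule H.Sw_grouplike[OF g]) (intro lin kc)+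
      finally show "Sw A a (\<lambda>u v. u i * v j) = a i * a j" by (simp add: kappa_iota a(1))
    qed
    have pw: "\<iota> (gpow A a m) = gpow H (\<iota> a) m" for m
      by (induction m) (simp_all add: iota_one A.gpow_Suc H.gpow_Suc iota_mul)
    have "gpow A a p = hone A" by (rule inj) (use gp a(2) pw iota_one in simp_all)
    moreover have "a \<noteq> hone A" using gne a(2) iota_one by auto
    ultimately have "p dvd hdim A" by (intro A.lagrange_prime[OF ga _ p(1)])
    then show False using p_not_dvd dimA by simp
  qed
  have dist: "v i \<noteq> v j" if ij: "i < p" "j < p" "i < j" for i j
  proof
    assume eq: "v i = v j"
    \<comment> \<open>Multiplying by h^(p - i) removes h^i, as h^p = 1, and reduces v_i = v_j to e =
      e h^(j - i).\<close>
    have "hmul H (v i) (gpow H h (p - i)) = E"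
      using ij unfolding v_def H.assoc H.gpow_add[symmetric] by (simp add: hp H.one_right E_vecs)
    moreover have "hmul H (v j) (gpow H h (p - i)) = hmul H E (gpow H h (j - i))"
    proof -
      have "j + (p - i) = p + (j - i)" using ij by simp
      then show ?thesis unfolding v_def H.assoc H.gpow_add[symmetric] by (simp add: H.gpow_add hp H.one_left)
    qed
    ultimately show False using stab[of "j - i"] eq ij by simp
  qed
  have dist': "v i \<noteq> v j" if "i < p" "j < p" "i \<noteq> j" for i j
    using dist[of i j] dist[of j i] that by (metis linorder_neqE_nat)
  have "\<exists>\<kappa>'. (\<forall>i<p. flin (hdim H) (\<kappa>' i)) \<and> (\<forall>i<p. \<forall>j<p. \<kappa>' i (v j) = (if i = j then 1 else 0))"
  proof (rule dual_functionals[where U="heps H"])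
    show "heps H (v i) = 1" for i
      unfolding v_def H.eps_mul E_def iota_eps A.nintD(2)[OF e] H.grouplikeD(2)[OF H.grouplike_gpow[OF h]] by simp
    fix F G :: "(nat \<Rightarrow> 'k) \<Rightarrow> 'k" assume F: "flin (hdim H) F" and G: "flin (hdim H) G"
    note c = lk flin_comp[OF F] flin_comp[OF G]
    show "\<exists>K. flin (hdim H) K \<and> (\<forall>i<p. K (v i) = F (v i) * G (v i))"
    proof (intro exI conjI allI impI)
      \<comment> \<open>The product of functionals is the convolution with \<open>E\<close> inserted
        in both legs: as e x = eps(x) e for x in \<open>A\<close>, the legs of Delta(e) are
        absorbed.\<close>
      show "flin (hdim H) (\<lambda>x. Sw H x (\<lambda>a b. F (hmul H E a) * G (hmul H E b)))" by (intro lin)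
      fix i
      let ?g = "gpow H h i"
      have "Sw H (v i) (\<lambda>a b. F (hmul H E a) * G (hmul H E b))
         = Sw H E (\<lambda>p q. Sw H ?g (\<lambda>u v. F (hmul H E (hmul H p u)) * G (hmul H E (hmul H q v))))"
        unfolding v_def by (rule H.Sw_mul) (intro c)+
      also have "\<dots> = Sw H E (\<lambda>p q. F (hmul H E (hmul H p ?g)) * G (hmul H E (hmul H q ?g)))"
        by (rule Sw_cong, rule H.Sw_grouplike[OF H.grouplike_gpow[OF h]]) (intro c)+
      also have "\<dots> = Sw A e (\<lambda>p q. F (hmul H E (hmul H (\<iota> p) ?g)) * G (hmul H E (hmul H (\<iota> q) ?g)))"
        unfolding E_def by (rule iota_Sw) (intro c)+
      also have "\<dots> = Sw A e (\<lambda>p q. heps A p * (heps A q * (F (v i) * G (v i))))"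
        unfolding H.assoc[symmetric] E_iota v_def lmap_scale[OF lop_mul_right]
          flin_scale[OF F] flin_scale[OF G] by (simp add: ac_simps)
      also have "\<dots> = heps A e * (F (v i) * G (v i))"
        by (rule A.counit_left) (intro lk)
      finally show "Sw H (v i) (\<lambda>a b. F (hmul H E a) * G (hmul H E b)) = F (v i) * G (v i)"
        by (simp add: A.nintD(2)[OF e])
    qed
  qed (simp_all add: v_def dist'[unfolded v_def] flin_eps)
  then obtain \<kappa>' where k: "\<And>i. i < p \<Longrightarrow> flin (hdim H) (\<kappa>' i)"
      "\<And>i j. i < p \<Longrightarrow> j < p \<Longrightarrow> \<kappa>' i (v j) = (if i = j then 1 else 0)" by blast
  have Ev: "hmul H E (v i) = v i" for i unfolding v_def E_idem ..
  have full: "hmul H E x = (\<lambda>i. \<Sum>j<p. \<kappa>' j (hmul H E x) * v j i)" for x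
    by (rule dual_family_full[OF k(1) Ev k(2) lop_E E_idem tr_E])
  have Tv: "TT (v i) = v i" for i
    unfolding v_def E_TT H.S_S_grouplike[OF H.grouplike_gpow[OF h]] ..
  have "hmul H E (TT x) = hmul H E x" for x
  proof -
    have "hmul H E (TT x) = TT (hmul H E x)" by (simp only: E_TT)
    also have "\<dots> = TT (\<lambda>i. \<Sum>j<p. \<kappa>' j (hmul H E x) * v j i)" using full[of x] by (rule arg_cong)
    also have "\<dots> = (\<lambda>i. \<Sum>j<p. \<kappa>' j (hmul H E x) * TT (v j) i)"
      by (rule lmap_sum[OF lmap_comp[OF lop_S lop_S]])
    also have "\<dots> = hmul H E x" unfolding Tv by (rule full[symmetric])
    finally show ?thesis .
  qed
  then show False using TT_not_trivial by blast
qed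

text \<open>The powers of \<open>b\<close> are characters \<open>f i\<close> of \<open>H\<close>.
  The restriction of \<open>b\<close> to \<open>A\<close> has order dividing \<open>p\<close> in the
  dual of \<open>A\<close>, whose dimension is 2^n, so it is trivial. Hence f_i(e x) = f_i(x), and
  the \<open>p\<close> distinct characters can be interpolated within the image of \<open>E\<close>.
  Each \<open>f i\<close> is fixed by the squared antipode of the dual.\<close>

lemma no_dual_grouplike_order_p:
  assumes b: "grouplike (hdual H) b" and bp: "gpow (hdual H) b p = hone (hdual H)"
  shows "b = hone (hdual H)"
proof (rule ccontr)
  assume ne: "b \<noteq> hone (hdual H)"
  interpret D: hopf "hdual H" by unfold_locales (rule H.dual_hopf)
  interpret DA: hopf "hdual A" by unfold_locales (rule A.dual_hopf)
  let ?d = "hdim H" and ?m = "hdim A"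
  define f where "f i = pair ?d (gpow (hdual H) b i)" for i
  have gl: "grouplike (hdual H) (gpow (hdual H) b i)" for i by (rule D.grouplike_gpow[OF b])
  have gv: "gpow (hdual H) b i \<in> vecs ?d" for i using D.gpow_vecs[of b i] by simp
  have f_mul: "f i (hmul H x y) = f i x * f i y" and f_one: "f i (hone H) = 1" for i x y
    using H.grouplike_dual[OF gv[of i]] gl[of i] unfolding f_def by auto
  have flin_f: "flin ?d (f i)" for i unfolding f_def by (rule flin_pair)
  define c where "c = (\<lambda>i. if i < ?m then f 1 (\<iota> (bs i)) else 0)"
  have cv: "c \<in> vecs ?m" by (simp add: c_def vecs_def)
  have pc: "pair ?m c x = f 1 (\<iota> x)" for x
    unfolding c_def by (rule pair_vector) (intro lk flin_comp[OF flin_f])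
  have c_gl: "grouplike (hdual A) c"
    unfolding A.grouplike_dual[OF cv] pc by (simp add: iota_one iota_mul f_mul f_one)
  have bv: "b \<in> vecs ?d" using D.grouplikeD(1)[OF b] by simp
  have f_Suc: "f (Suc i) x = Sw H x (\<lambda>u v. f 1 u * f i v)" for i x
    unfolding f_def using D.gpow_1 bv by (simp add: D.gpow_Suc H.pair_mul D.one_right)
  have f0: "f 0 x = heps H x" for x unfolding f_def by (simp add: H.pair_one)
  have pcn: "pair ?m (gpow (hdual A) c i) x = f i (\<iota> x)" for i x
  proof (induction i arbitrary: x)
    case 0 show ?case by (simp add: A.pair_one f0 iota_eps)
  next
    case (Suc i)
    have "pair ?m (gpow (hdual A) c (Suc i)) x = Sw A x (\<lambda>u v. f 1 (\<iota> u) * f i (\<iota> v))"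
      by (simp add: DA.gpow_Suc A.pair_mul pc Suc)
    also have "\<dots> = Sw H (\<iota> x) (\<lambda>u v. f 1 u * f i v)"
      by (rule iota_Sw[symmetric]) (intro lin flin_f)+
    finally show ?case by (simp only: f_Suc)
  qed
  have c_one: "c = hone (hdual A)"
  proof (rule ccontr)
    assume "c \<noteq> hone (hdual A)"
    moreover have "gpow (hdual A) c p = hone (hdual A)"
    proof (rule pair_eqI[of _ ?m])
      show "gpow (hdual A) c p \<in> vecs ?m" using DA.gpow_vecs[of c p] by simp
      show "hone (hdual A) \<in> vecs ?m" using hone_vecs[of "hdual A"] by simp
      fix x
      show "pair ?m (gpow (hdual A) c p) x = pair ?m (hone (hdual A)) x"
        unfolding pcn unfolding f_def bp H.pair_one A.pair_one iota_eps ..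
    qed
    ultimately have "p dvd hdim (hdual A)" by (intro DA.lagrange_prime[OF c_gl _ p(1)])
    then show False using p_not_dvd dimA by simp
  qed
  have f_iota: "f i (\<iota> x) = heps A x" for i x
    unfolding pcn[symmetric] c_one by (simp add: A.pair_one)
  have f_E: "f i (hmul H E x) = f i x" for i x
    unfolding f_mul E_def f_iota A.nintD(2)[OF e] by simp
  obtain v where v: "\<And>i j. i \<in> {..<p} \<Longrightarrow> j \<in> {..<p} \<Longrightarrow> f i (v j) = (if i = j then 1 else 0)"
  proof (rule interpolation[of "{..<p}" f])
    show "\<exists>z. \<forall>i\<in>{..<p}. f i z = f i x * f i y" for x y
      by (intro exI[of _ "hmul H x y"]) (simp add: f_mul)
    show "\<exists>z. \<forall>i\<in>{..<p}. f i z = s * (f i x - c)" for x c s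
    proof (intro exI ballI)
      fix i
      show "f i (\<lambda>k. s * (x k - c * hone H k)) = s * (f i x - c)"
        by (simp add: flin_scale[OF flin_f] flin_diff[OF flin_f] f_one)
    qed
    show "\<exists>z. \<forall>i\<in>{..<p}. f i z = 1" using f_one by blast
    fix i j assume ij: "i \<in> {..<p}" "j \<in> {..<p}" "i \<noteq> j"
    show "\<exists>x. f i x \<noteq> f j x"
    proof (rule ccontr)
      assume "\<not> ?thesis"
      then have "gpow (hdual H) b i = gpow (hdual H) b j"
        by (intro pair_eqI[OF gv gv]) (simp add: f_def)
      then show False using D.gpow_distinct[OF b ne p(1) bp] ij by auto
    qed
  qed (use that in auto)
  define v' where "v' j = hmul H E (v j)" for j
  have dual: "f i (v' j) = (if i = j then 1 else 0)" if "i < p" "j < p" for i j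
    unfolding v'_def f_E using v that by simp
  have Ev: "hmul H E (v' i) = v' i" for i unfolding v'_def E_idem ..
  have full: "hmul H E x = (\<lambda>i. \<Sum>j<p. f j (hmul H E x) * v' j i)" for x
    by (rule dual_family_full[OF flin_f Ev dual lop_E E_idem tr_E])
  have fT: "f i (TT x) = f i x" for i x
    unfolding f_def H.pair_S[symmetric] D.S_S_grouplike[OF gl] ..
  have "hmul H E (TT x) = hmul H E x" for x
  proof -
    have "hmul H E (TT x) = (\<lambda>i. \<Sum>j<p. f j (hmul H E (TT x)) * v' j i)" by (rule full)
    also have "\<dots> = (\<lambda>i. \<Sum>j<p. f j (hmul H E x) * v' j i)" by (simp only: f_E fT)
    also have "\<dots> = hmul H E x" by (rule full[symmetric])
    finally show ?thesis .
  qed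
  then show False using TT_not_trivial by blast
qed

lemma contradiction:
  assumes sq: "sqrt_closed TYPE('k)"
  shows False
proof -
  interpret D: hopf "hdual H" by unfold_locales (rule H.dual_hopf)
  have "\<exists>a. \<forall>x\<in>vecs (hdim H). (HI.T ^^ (2 ^ a)) x = x"
  proof (rule HI.S_two_power_order)
    show "\<exists>a. gpow H g (2 ^ a) = hone H" if "grouplike H g" for g
      by (rule H.grouplike_two_power_order[OF _ dimH p(1) that]) (rule no_grouplike_order_p)
    show "\<exists>a. gpow (hdual H) g (2 ^ a) = hone (hdual H)" if "grouplike (hdual H) g" for g
      by (rule D.grouplike_two_power_order[OF _ _ p(1) that, of n])
         (simp_all add: dimH no_dual_grouplike_order_p)
  qed
  then obtain a where a: "\<And>x. x \<in> vecs (hdim H) \<Longrightarrow> (HI.T ^^ (2 ^ a)) x = x" by blast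
  define F where "F v = hmul H E (TT v)" for v
  have T: "HI.T = (\<lambda>x. TT x)" by (rule ext) (simp add: HI.T_def)
  have lF: "lop (hdim H) F" unfolding F_def by (rule lmap_comp[OF lop_E lmap_comp[OF lop_S lop_S]])
  have FE: "F (hmul H E v) = F v" and EF: "hmul H E (F v) = F v" for v
    by (simp_all only: F_def E_TT E_idem)
  have Fa: "(F ^^ (2 ^ a)) v = hmul H E v" for v
  proof -
    have "(F ^^ (2 ^ a)) v = (HI.T ^^ (2 ^ a)) (hmul H E v)"
    proof -
      have "F = (\<lambda>v. HI.T (hmul H E v))" by (rule ext) (simp add: F_def T E_TT)
      then show ?thesis using funpow_comp_idem[of "hmul H E" HI.T "2 ^ a" v]
        by (simp add: E_idem T E_TT)
    qed
    then show ?thesis using a[of "hmul H E v"] by simp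
  qed
  have "tr (hdim H) F \<noteq> 0"
    by (rule two_power_trace_nonzero[OF sq lop_E lF E_idem FE EF Fa tr_E p(2)])
  then show False using tr_E_TT unfolding F_def by simp
qed

end

theorem theorem3p5:
  fixes H :: "'k::field_char_0 hopf_data" and n p :: nat
  assumes "alg_closed TYPE('k)"
    and "is_hopf_algebra H"
    and "hdim H = 2 ^ n * p"
    and "prime p" and "odd p"
    and "\<exists>K. is_hopf_subalgebra H K \<and> has_dim K (2 ^ n) \<and> semisimple_subalg H K"
  shows "semisimple_hopf H"
proof (rule ccontr)
  assume ns: "\<not> semisimple_hopf H"
  interpret H: hopf H by unfold_locales (rule assms(2))
  obtain lam Lam where "hopf_int H lam Lam" using H.hopf_int_exists by blast
  then interpret HI: hopf_int H lam Lam .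
  have not_ss: "heps H Lam = 0"
    using HI.nint_Lam H.nint_semisimple ns by blast
  obtain K where K: "is_hopf_subalgebra H K" "has_dim K (2 ^ n)" "semisimple_subalg H K"
    using assms(6) by blast
  obtain A \<iota> \<kappa> where A: "hopf_sub A H \<iota> \<kappa>" "hdim A = 2 ^ n" "range \<iota> = K"
    using H.hopf_sub_of_subalgebra[OF K(1,2)] by blast
  interpret sub: hopf_sub A H \<iota> \<kappa> by (rule A(1))
  obtain lamA LamA where "hopf_int A lamA LamA" using sub.A.hopf_int_exists by blast
  then interpret AI: hopf_int A lamA LamA .
  \<comment> \<open>If the counit vanished at \<open>LamA\<close>, the line spanned by the image of
    \<open>LamA\<close> would be an ideal of \<open>K\<close> of square zero, against
    semisimplicity. So \<open>LamA\<close> can be normalised to the integral that the locale asks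
    for.\<close>
  have nz: "heps A LamA \<noteq> 0"
  proof
    assume z: "heps A LamA = 0"
    define I where "I = range (\<lambda>c i. c * \<iota> LamA i)"
    have iL: "hmul H (\<iota> x) (\<iota> LamA) = (\<lambda>i. heps A x * \<iota> LamA i)" "hmul H (\<iota> LamA) (\<iota> x) = (\<lambda>i. AI.alpha x * \<iota> LamA i)" for x
      unfolding sub.iota_mul[symmetric] AI.Lam_left AI.Lam_right lmap_scale[OF sub.iota] by simp_all
    have mem: "(\<lambda>i. s * \<iota> LamA i) \<in> I" for s
      unfolding I_def by (rule range_eqI[where x=s]) (rule refl)
    have memE: "\<exists>s. x = (\<lambda>i. s * \<iota> LamA i)" if "x \<in> I" for x using that unfolding I_def by blast
    have sub: "subsp (hdim H) I"
      unfolding subsp_def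
    proof (intro conjI ballI allI)
      show "I \<subseteq> vecs (hdim H)" using sub.iota_vecs[of LamA] by (auto simp: I_def vecs_def)
      show "(\<lambda>_. 0) \<in> I" using mem[of 0] by simp
      fix x y assume "x \<in> I" "y \<in> I"
      then obtain s t where "x = (\<lambda>i. s * \<iota> LamA i)" "y = (\<lambda>i. t * \<iota> LamA i)" using memE by meson
      then have "(\<lambda>i. x i + y i) = (\<lambda>i. (s + t) * \<iota> LamA i)" by (simp only: distrib_right)
      then show "(\<lambda>i. x i + y i) \<in> I" by (simp only: mem)
    next
      fix c x assume "x \<in> I"
      then obtain s where "x = (\<lambda>i. s * \<iota> LamA i)" using memE by meson
      then have "(\<lambda>i. c * x i) = (\<lambda>i. (c * s) * \<iota> LamA i)" by (simp only: mult.assoc)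
      then show "(\<lambda>i. c * x i) \<in> I" by (simp only: mem)
    qed
    have "is_ideal_in H K I"
      unfolding is_ideal_in_def H.subsp_is_subspace
    proof (intro conjI ballI sub)
      show "I \<subseteq> K"
      proof
        fix x assume "x \<in> I"
        then obtain s where "x = (\<lambda>i. s * \<iota> LamA i)" using memE by meson
        then have "x = \<iota> (\<lambda>i. s * LamA i)" by (simp only: lmap_scale[OF sub.iota])
        then show "x \<in> K" unfolding A(3)[symmetric]
          by (rule range_eqI[where f=\<iota> and x="\<lambda>i. s * LamA i"])
      qed
      fix x y assume xy: "x \<in> K" "y \<in> I"
      obtain x' where x: "x = \<iota> x'" using xy(1) unfolding A(3)[symmetric] by blast
      obtain s where y: "y = (\<lambda>i. s * \<iota> LamA i)" using memE[OF xy(2)] by (elim exE)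
      show "hmul H x y \<in> I" unfolding x y lmap_scale[OF lop_mul_left] iL
        using mem[of "s * heps A x'"] by (simp only: mult.assoc)
      show "hmul H y x \<in> I" unfolding x y lmap_scale[OF lop_mul_right] iL
        using mem[of "s * AI.alpha x'"] by (simp only: mult.assoc)
    qed
    moreover have "is_nilpotent_set H I"
      unfolding is_nilpotent_set_def
    proof (intro exI[of _ 2] conjI allI impI)
      fix xs assume xs: "length xs = 2 \<and> set xs \<subseteq> I"
      then obtain x y where xy: "xs = [x, y]" by (auto simp: numeral_2_eq_2 length_Suc_conv)
      then have "x \<in> I" "y \<in> I" using xs by auto
      then obtain s t where "x = (\<lambda>i. s * \<iota> LamA i)" "y = (\<lambda>i. t * \<iota> LamA i)"
        using memE by meson
      then show "foldr (hmul H) (butlast xs) (last xs) = (\<lambda>_. 0)"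
        unfolding xy by (simp add: lmap_scale[OF lop_mul_right]
            lmap_scale[OF lop_mul_left] iL z)
    qed simp
    ultimately have "I = {\<lambda>_. 0}" using K(3) unfolding semisimple_subalg_def by blast
    moreover have "\<iota> LamA \<in> I" using mem[of 1] by simp
    ultimately have "\<iota> LamA = (\<lambda>_. 0)" by blast
    then have "LamA = (\<lambda>_. 0)"
      using sub.kappa_iota[OF AI.Lam_vecs] lmap_zero[OF sub.kappa] by simp
    then show False using AI.lam_one flin_zero[OF AI.flam] by simp
  qed
  interpret two_power_p A H \<iota> \<kappa> lam Lam n p "\<lambda>i. inverse (heps A LamA) * LamA i"
    by unfold_locales (use A(2) assms(3-5) not_ss AI.nint_Lam[OF nz] in auto)
  show False by (rule contradiction[OF alg_closed_sqrt[OF assms(1)]])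
qed

end
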